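(* Let $d\in\mathbb{N}$. There is a constant $c_d>0$ depending only on $d$ such that for every natural number $s\ge3$ there exists $\delta_s\ge c_d\log s/\log\log s$ with the following property. Given any finite set $A\subseteq\mathbb{Z}$ and any $\varphi\in\mathbb{Z}[x]$ with $\deg\varphi=d$, the largest $B^+_{s,\varphi}[1]$ subset $X$ of $A$ and the largest $B^\times_s[1]$ subset $Y$ of $A$ satisfy \[ \max\{|X|,|Y|\}\gg_{s,d}|A|^{\delta_s/s}. \] Moreover, if $\varphi(0)\ne0$, then writing $X'$ for the largest $B^\times_{s,\varphi}[1]$ subset of $A$, we have \[ \max\{|X'|,|Y|\}\gg_{s,d}|A|^{\delta_s/s}. \]
   Context: For $\varphi\in\mathbb{Z}[x]$, a finite set $X\subseteq\mathbb{Z}$ is a $B^+_{s,\varphi}[1]$ set if for every $n\in\mathbb{Z}$ there is at most one solution of $n=\varphi(x_1)+\dots+\varphi(x_s)$ with $x_1,\dots,x_s\in X$, where two solutions are considered the same if they differ only in the ordering of the summands. Similarly $X$ is a $B^\times_{s,\varphi}[1]$ set if for every $n\in\mathbb{Z}$ there is at most one solution (up to reordering of the factors) of $n=\varphi(x_1)\cdots\varphi(x_s)$ with $x_i\in X$. A $B^\times_s[1]$ set is a $B^\times_{s,\varphi}[1]$ set with $\varphi(x)=x$. $X\gg_z Y$ means $X\ge C_z|Y|$ for a positive constant $C_z$ depending only on $z$. Logarithms are to base 2. *)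

theory Defs
  imports Complex_Main "HOL-Library.Multiset" "HOL-Computational_Algebra.Polynomial"
begin

(* A solution is a tuple (x_1, ..., x_s) of elements of X, given as a list of length s;
   two solutions are identified when the tuples are permutations of each other. *)

definition B_plus :: "nat \<Rightarrow> int poly \<Rightarrow> int set \<Rightarrow> bool" where
  "B_plus s \<phi> X \<longleftrightarrow> finite X \<and>
     (\<forall>n xs ys.
        length xs = s \<and> set xs \<subseteq> X \<and> n = (\<Sum>x\<leftarrow>xs. poly \<phi> x) \<and>
        length ys = s \<and> set ys \<subseteq> X \<and> n = (\<Sum>y\<leftarrow>ys. poly \<phi> y)
        \<longrightarrow> mset xs = mset ys)"

definition B_times_poly :: "nat \<Rightarrow> int poly \<Rightarrow> int set \<Rightarrow> bool" where
  "B_times_poly s \<phi> X \<longleftrightarrow> finite X \<and>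
     (\<forall>n xs ys.
        length xs = s \<and> set xs \<subseteq> X \<and> n = (\<Prod>x\<leftarrow>xs. poly \<phi> x) \<and>
        length ys = s \<and> set ys \<subseteq> X \<and> n = (\<Prod>y\<leftarrow>ys. poly \<phi> y)
        \<longrightarrow> mset xs = mset ys)"

definition B_times :: "nat \<Rightarrow> int set \<Rightarrow> bool" where
  "B_times s X \<longleftrightarrow> B_times_poly s [:0, 1:] X"

(* For finite A the Max is over a finite set, which is nonempty for the predicates above
   because they hold of the empty set. *)
definition largest_card :: "(int set \<Rightarrow> bool) \<Rightarrow> int set \<Rightarrow> nat" where
  "largest_card P A = Max {card X | X. X \<subseteq> A \<and> P X}"

end

theory Submission imports Defs "HOL-Analysis.Convex" "HOL-Computational_Algebra.Primes" begin

text \<open>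
  Identify a nonzero integer with its vector of prime valuations, and count multiplicative
  relations of length \<open>2 s\<close> by Fourier analysis modulo a large prime \<open>M\<close>. Random sampling turns a
  set of small energy into a large Sidon set, so if \<open>A\<close> of size \<open>N\<close> contains no large set of either
  kind then all its subsets have large energy both for \<open>x\<close> and for \<open>\<phi>(x)\<close>.

  Large multiplicative energy forces structure: splitting \<open>A\<close> along one valuation at a time, each
  splitting that is not dominated by one fibre saves a power of \<open>s\<close> in the energy, so that a subset
  of size about \<open>N\<^bsup>1/2\<^esup>\<close> is determined by querying few valuations adaptively. Along a query of
  \<open>v\<^sub>p\<close> the sums of \<open>\<phi>(x)\<close> decouple in a moment of order \<open>2 k\<close> with \<open>k\<close> about
  \<open>log s / log log s\<close>: away from finitely many valuations the Newton lines of \<open>\<phi>\<close> have distinct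
  values, and in a relation the least \<open>p\<close>-adic order must occur twice. For products of values
  of \<open>\<phi>\<close> one divides by the dominant monomial, which is legitimate for solutions of the joint
  system \<open>\<Prod> x\<^sub>i = \<Prod> y\<^sub>i\<close>, \<open>\<Prod> \<phi>(x\<^sub>i) = \<Prod> \<phi>(y\<^sub>i)\<close>.
  Hence the joint energy of the structured subset is small; but simultaneous correlation with many
  characters of both kinds makes it large, a contradiction.
\<close>

section \<open>Fourier analysis modulo a prime\<close>

text \<open>With |A| = n and no Sidon set of size about n^(k/(20s)), every subset keeps a fraction
  \<tau> = n^(-k/(20s)) of the largest possible 2s-norm, for both functions. Correlating with both
  at once costs \<tau>^(4s) = n^(-k/5), far too much for a second moment; in a moment of order 2k
  its k-th root is only n^(-1/5). So the structured subset has to obey a square-root bound in the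
  joint 2k-norm, at a price of D = (2Rk)^2 per query with R bounded in terms of the degree. Its size
  is measured at the rate \<mu> = D^4 per query, so points of depth H with \<mu>^H about sqrt n pay
  only about n^(1/8), and n^(3/10) against n^(1/8) is the contradiction. The tree needs
  \<mu>^\<alpha>, \<alpha> = k/5, to stay below a power of s, that is k log k below a multiple of
  log s: hence log s / log log s. All energies live on the dual of (Z/M)^2 so that two functions can
  be tested together. Valuations forget signs and need nonzero arguments, so zeros are removed and
  signs fixed beforehand, at the cost of a constant depending on d.\<close>

definition ee :: "nat \<Rightarrow> int \<Rightarrow> complex" where
  "ee M n = cis (2 * pi * real_of_int n / real M)"

lemma ee_0 [simp]: "ee M 0 = 1"
  by (simp add: ee_def)

lemma ee_add: "ee M (a + b) = ee M a * ee M b"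
  by (simp add: ee_def cis_mult add_divide_distrib distrib_left)

lemma norm_ee [simp]: "cmod (ee M n) = 1"
  by (simp add: ee_def)

lemma cnj_ee: "cnj (ee M n) = ee M (- n)"
  by (simp add: ee_def cis_cnj)

lemma ee_sum: "finite I \<Longrightarrow> ee M (\<Sum>i\<in>I. f i) = (\<Prod>i\<in>I. ee M (f i))"
  by (induction I rule: finite_induct) (auto simp: ee_add)

lemma ee_eq_1_iff:
  assumes "M > 0"
  shows "ee M n = 1 \<longleftrightarrow> int M dvd n"
proof
  assume "ee M n = 1"
  then have "cos (2 * pi * real_of_int n / real M) = 1"
    by (simp add: ee_def cis.ctr complex_eq_iff)
  then obtain k :: int where "2 * pi * real_of_int n / real M = real_of_int k * 2 * pi"
    using cos_one_2pi_int by blast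
  then have "real_of_int n = real_of_int k * real M"
    using assms by (simp add: field_simps)
  then have "n = k * int M"
    by (metis of_int_eq_iff of_int_mult of_int_of_nat_eq)
  then show "int M dvd n" by simp
next
  assume "int M dvd n"
  then obtain k where "n = int M * k" by (elim dvdE)
  then have "2 * pi * real_of_int n / real M = (2 * pi) * real_of_int k"
    using assms by simp
  then show "ee M n = 1"
    by (simp only: ee_def complex_eq_iff cis.simps cos_int_2pin sin_int_2pin one_complex.simps)
qed

lemma ee_cong_mod:
  assumes "M > 0" "int M dvd a - b"
  shows "ee M a = ee M b"
proof -
  have "ee M a = ee M (a - b) * ee M b"
    by (simp flip: ee_add)
  then show ?thesis using assms by (simp add: ee_eq_1_iff)
qed

lemma sum_ee:
  assumes "M > 0"
  shows "(\<Sum>t\<in>{0..<int M}. ee M (t * n)) = (if int M dvd n then of_nat M else 0)"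
proof -
  have img: "{0..<int M} = int ` {..<M}"
    using image_int_atLeastLessThan[of 0 M] by (simp add: atLeast0LessThan)
  have pw: "ee M (int t * n) = ee M n ^ t" for t
    by (simp add: ee_def Complex.DeMoivre algebra_simps)
  have "(\<Sum>t\<in>{0..<int M}. ee M (t * n)) = (\<Sum>t<M. ee M n ^ t)"
    unfolding img by (subst sum.reindex) (auto simp: pw)
  also have "\<dots> = (if int M dvd n then of_nat M else 0)"
  proof (cases "int M dvd n")
    case True
    then show ?thesis using assms ee_eq_1_iff[of M n] by simp
  next
    case False
    then have "ee M n \<noteq> 1" using assms ee_eq_1_iff[of M n] by simp
    moreover have "ee M n ^ M = 1"
      using pw[of M] ee_eq_1_iff[of M "int M * n"] assms by simp
    ultimately show ?thesis using False by (simp add: geometric_sum)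
  qed
  finally show ?thesis .
qed

definition mean :: "'i set \<Rightarrow> ('i \<Rightarrow> 'b::real_normed_field) \<Rightarrow> 'b" where
  "mean T h = sum h T / of_nat (card T)"

lemma mean_cong: "(\<And>t. t \<in> T \<Longrightarrow> g t = h t) \<Longrightarrow> mean T g = mean T h"
  by (simp add: mean_def)

lemma mean_mono:
  fixes g h :: "'i \<Rightarrow> real"
  shows "(\<And>t. t \<in> T \<Longrightarrow> g t \<le> h t) \<Longrightarrow> mean T g \<le> mean T h"
  unfolding mean_def by (intro divide_right_mono sum_mono) auto

lemma mean_nonneg:
  fixes g :: "'i \<Rightarrow> real"
  shows "(\<And>t. t \<in> T \<Longrightarrow> 0 \<le> g t) \<Longrightarrow> 0 \<le> mean T g"
  unfolding mean_def by (intro divide_nonneg_nonneg sum_nonneg) auto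

lemma mean_const: "finite T \<Longrightarrow> T \<noteq> {} \<Longrightarrow> mean T (\<lambda>_. c) = c"
  by (simp add: mean_def)

lemma mean_add: "mean T (\<lambda>t. g t + h t) = mean T g + mean T h"
  by (simp add: mean_def sum.distrib add_divide_distrib)

lemma mean_cmult: "mean T (\<lambda>t. c * g t) = c * mean T g"
  by (simp add: mean_def sum_distrib_left)

lemma mean_sum: "mean T (\<lambda>t. \<Sum>i\<in>I. g i t) = (\<Sum>i\<in>I. mean T (g i))"
  unfolding mean_def by (subst sum.swap) (simp add: sum_divide_distrib)

lemma mean_lincomb: "mean T (\<lambda>t. \<Sum>i\<in>I. c i * g i t) = (\<Sum>i\<in>I. c i * mean T (g i))"
proof -
  have "(\<Sum>t\<in>T. \<Sum>i\<in>I. c i * g i t) = (\<Sum>i\<in>I. c i * (\<Sum>t\<in>T. g i t))"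
    by (subst sum.swap) (simp add: sum_distrib_left)
  then show ?thesis by (simp add: mean_def sum_divide_distrib[symmetric])
qed

lemma norm_mean_le:
  fixes g :: "'i \<Rightarrow> complex"
  shows "cmod (mean T g) \<le> mean T (\<lambda>t. cmod (g t))"
  by (simp add: mean_def norm_divide divide_right_mono norm_sum)

lemma of_real_mean: "complex_of_real (mean T g) = mean T (\<lambda>t. complex_of_real (g t))"
  by (simp add: mean_def)

lemma Re_mean: "Re (mean T g) = mean T (\<lambda>t. Re (g t))"
  by (simp add: mean_def)

text \<open>Frequencies of the characters of (Z/M)^2. Two coordinates let one exponential sum test
  two integer-valued functions at once; with the second function 0 only the first coordinate
  matters.\<close>

definition grid :: "nat \<Rightarrow> (int \<times> int) set" where
  "grid M = {0..<int M} \<times> {0..<int M}"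

lemma finite_grid [simp]: "finite (grid M)"
  by (simp add: grid_def)

lemma card_grid [simp]: "card (grid M) = M * M"
  by (simp add: grid_def card_cartesian_product)

lemma grid_nonempty: "M > 0 \<Longrightarrow> grid M \<noteq> {}"
  by (auto simp: grid_def)

lemma mean_grid_fst:
  assumes "M > 0"
  shows "mean (grid M) (\<lambda>z. h (fst z)) = mean {0..<int M} h"
proof -
  have "(\<Sum>z\<in>grid M. h (fst z)) = (\<Sum>t\<in>{0..<int M}. \<Sum>u\<in>{0..<int M}. h t)"
    unfolding grid_def by (subst sum.cartesian_product) (simp add: case_prod_unfold)
  also have "\<dots> = of_nat M * (\<Sum>t\<in>{0..<int M}. h t)"
    by (simp add: sum_distrib_left)
  finally show ?thesis using assms by (simp add: mean_def)
qed

lemma mean_grid_ee: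
  assumes "M > 0"
  shows "mean (grid M) (\<lambda>z. ee M (fst z * a + snd z * b)) =
    (if int M dvd a \<and> int M dvd b then 1 else 0)"
proof -
  have "(\<Sum>z\<in>grid M. ee M (fst z * a + snd z * b)) =
      (\<Sum>t\<in>{0..<int M}. \<Sum>u\<in>{0..<int M}. ee M (t * a) * ee M (u * b))"
    unfolding grid_def by (subst sum.cartesian_product) (simp add: case_prod_unfold ee_add)
  also have "\<dots> = (\<Sum>t\<in>{0..<int M}. ee M (t * a)) * (\<Sum>u\<in>{0..<int M}. ee M (u * b))"
    by (simp add: sum_product)
  finally show ?thesis using assms by (auto simp: mean_def sum_ee)
qed

definition ft :: "nat \<Rightarrow> ('a \<Rightarrow> int) \<Rightarrow> ('a \<Rightarrow> int) \<Rightarrow> 'a set \<Rightarrow> int \<times> int \<Rightarrow> complex" where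
  "ft M f g B z = (\<Sum>x\<in>B. ee M (fst z * f x + snd z * g x))"

lemma norm_ft_le: "cmod (ft M f g B z) \<le> real (card B)"
  unfolding ft_def by (rule order_trans[OF norm_sum]) simp

text \<open>Multiply out over all choice functions in \<open>PiE I B\<close>; orthogonality of
  characters keeps those whose \<open>c\<close>-combinations vanish modulo \<open>M\<close> in both
  coordinates. The weights \<open>w\<close> serve trigonometric polynomials as well as plain
  counts.\<close>

lemma mean_prod_eq_relation_sum:
  fixes w :: "'i \<Rightarrow> 'a \<Rightarrow> complex"
  assumes "M > 0" "finite I" "\<And>i. i \<in> I \<Longrightarrow> finite (B i)"
  shows "mean (grid M) (\<lambda>z. \<Prod>i\<in>I. \<Sum>x\<in>B i. w i x * ee M (c i * (fst z * f x + snd z * g x))) =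
    (\<Sum>x\<in>{x \<in> PiE I B. int M dvd (\<Sum>i\<in>I. c i * f (x i)) \<and> int M dvd (\<Sum>i\<in>I. c i * g (x i))}.
       \<Prod>i\<in>I. w i (x i))"
proof -
  have "mean (grid M) (\<lambda>z. \<Prod>i\<in>I. \<Sum>x\<in>B i. w i x * ee M (c i * (fst z * f x + snd z * g x))) =
     mean (grid M) (\<lambda>z. \<Sum>x\<in>PiE I B. (\<Prod>i\<in>I. w i (x i)) *
        ee M (fst z * (\<Sum>i\<in>I. c i * f (x i)) + snd z * (\<Sum>i\<in>I. c i * g (x i))))"
  proof (rule mean_cong, goal_cases)
    case (1 z)
    have "(\<Sum>i\<in>I. c i * (fst z * f (x i) + snd z * g (x i))) =
        fst z * (\<Sum>i\<in>I. c i * f (x i)) + snd z * (\<Sum>i\<in>I. c i * g (x i))" for x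
      by (simp add: sum_distrib_left sum.distrib algebra_simps)
    then show ?case
      using assms by (simp add: prod_sum_PiE prod.distrib flip: ee_sum)
  qed
  also have "\<dots> = (\<Sum>x\<in>PiE I B. (\<Prod>i\<in>I. w i (x i)) *
      (if int M dvd (\<Sum>i\<in>I. c i * f (x i)) \<and> int M dvd (\<Sum>i\<in>I. c i * g (x i)) then 1 else 0))"
    by (simp add: mean_sum mean_cmult mean_grid_ee[OF assms(1)])
  also have "\<dots> = (\<Sum>x\<in>{x \<in> PiE I B. int M dvd (\<Sum>i\<in>I. c i * f (x i)) \<and> int M dvd (\<Sum>i\<in>I. c i * g (x i))}.
       \<Prod>i\<in>I. w i (x i))"
    using assms finite_PiE[OF assms(2,3)] by (intro sum.mono_neutral_cong_right) auto
  finally show ?thesis .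
qed

lemma ft_dilate: "ft M f g B (c * fst z, c * snd z) = (\<Sum>x\<in>B. ee M (c * (fst z * f x + snd z * g x)))"
  by (simp add: ft_def algebra_simps)

definition relations :: "nat \<Rightarrow> 'i set \<Rightarrow> ('i \<Rightarrow> int) \<Rightarrow> ('a \<Rightarrow> int) \<Rightarrow> ('a \<Rightarrow> int) \<Rightarrow> ('i \<Rightarrow> 'a set) \<Rightarrow> ('i \<Rightarrow> 'a) set" where
  "relations M I c f g B =
    {x \<in> PiE I B. int M dvd (\<Sum>i\<in>I. c i * f (x i)) \<and> int M dvd (\<Sum>i\<in>I. c i * g (x i))}"

lemma card_relations_eq_mean:
  assumes "M > 0" "finite I" "\<And>i. i \<in> I \<Longrightarrow> finite (B i)"
  shows "of_nat (card (relations M I c f g B)) =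
    mean (grid M) (\<lambda>z. \<Prod>i\<in>I. ft M f g (B i) (c i * fst z, c i * snd z))"
  using mean_prod_eq_relation_sum[OF assms, where w = "\<lambda>_ _. 1" and c = c and f = f and g = g]
  unfolding ft_dilate relations_def by simp

lemma card_relations_le_mean:
  assumes "M > 0" "finite I" "\<And>i. i \<in> I \<Longrightarrow> finite (B i)"
  shows "real (card (relations M I c f g B)) \<le>
    mean (grid M) (\<lambda>z. \<Prod>i\<in>I. cmod (ft M f g (B i) (c i * fst z, c i * snd z)))"
proof -
  let ?P = "\<lambda>z. \<Prod>i\<in>I. ft M f g (B i) (c i * fst z, c i * snd z)"
  have "real (card (relations M I c f g B)) = cmod (of_nat (card (relations M I c f g B)))"
    by simp
  also have "of_nat (card (relations M I c f g B)) = mean (grid M) ?P"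
    using assms by (rule card_relations_eq_mean)
  also have "cmod (mean (grid M) ?P) \<le> mean (grid M) (\<lambda>z. cmod (?P z))"
    by (rule norm_mean_le)
  finally show ?thesis by (simp add: prod_norm)
qed

section \<open>Hoelder's inequality for products of exponential sums\<close>

text \<open>AM-GM for the \<open>n\<close>-th powers, padded with \<open>n - card I\<close> ones so
  that fewer than \<open>n\<close> factors are allowed.\<close>

lemma prod_le_mean_power:
  fixes a :: "'i \<Rightarrow> real"
  assumes "finite I" "card I \<le> n" "0 < n" "\<And>i. i \<in> I \<Longrightarrow> 0 \<le> a i"
  shows "real n * (\<Prod>i\<in>I. a i) \<le> (\<Sum>i\<in>I. a i ^ n) + real (n - card I)"
proof (cases "I = {}")
  case True
  then show ?thesis by simp
next
  case False
  define J where "J = Inl ` I \<union> Inr ` {..<n - card I}"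
  define b where "b = (\<lambda>j. case j of Inl i \<Rightarrow> a i ^ n | Inr (_::nat) \<Rightarrow> 1)"
  have disj: "Inl ` I \<inter> Inr ` {..<n - card I} = {}" by auto
  have fin: "finite J" and ne: "J \<noteq> {}" using False assms by (auto simp: J_def)
  have cJ: "card J = n"
    unfolding J_def using assms disj by (subst card_Un_disjoint) (auto simp: card_image)
  have p: "(\<Prod>j\<in>J. b j) = (\<Prod>i\<in>I. a i) ^ n"
    unfolding J_def using assms disj
    by (subst prod.union_disjoint) (auto simp: prod.reindex b_def prod_power_distrib)
  have s: "(\<Sum>j\<in>J. b j) = (\<Sum>i\<in>I. a i ^ n) + real (n - card I)"
    unfolding J_def using assms disj
    by (subst sum.union_disjoint) (auto simp: sum.reindex b_def)
  have pos: "0 \<le> b j" if "j \<in> J" for j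
    using that assms by (auto simp: b_def J_def)
  have "((\<Prod>i\<in>I. a i) ^ n) powr (1 / real n) \<le> (\<Sum>j\<in>J. b j / real n)"
    using arith_geom_mean[OF fin ne, of b] pos unfolding cJ p by simp
  moreover have "((\<Prod>i\<in>I. a i) ^ n) powr (1 / real n) = (\<Prod>i\<in>I. a i)"
    using assms(3,4) by (subst root_powr_inverse[symmetric]) (auto simp: prod_nonneg real_root_power_cancel)
  ultimately show ?thesis
    unfolding s[symmetric] using assms(3) by (simp add: sum_divide_distrib[symmetric] field_simps)
qed

text \<open>Hoelder's inequality for at most \<open>n\<close> factors: divide each factor by its
  \<open>n\<close>-th moment norm and average the pointwise AM-GM bound, in which every normalised
  moment contributes 1. A factor with vanishing moment vanishes on all of \<open>T\<close>.\<close>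

lemma mean_prod_le_prod_root:
  fixes g :: "'i \<Rightarrow> 't \<Rightarrow> real"
  assumes T: "finite T" "T \<noteq> {}" and I: "finite I" "card I \<le> n" "0 < n"
    and pos: "\<And>i t. i \<in> I \<Longrightarrow> t \<in> T \<Longrightarrow> 0 \<le> g i t"
  shows "mean T (\<lambda>t. \<Prod>i\<in>I. g i t) \<le> (\<Prod>i\<in>I. root n (mean T (\<lambda>t. g i t ^ n)))"
proof -
  define r where "r = (\<lambda>i. root n (mean T (\<lambda>t. g i t ^ n)))"
  have m0: "0 \<le> mean T (\<lambda>t. g i t ^ n)" if "i \<in> I" for i
    using that pos by (intro mean_nonneg) auto
  have r0: "0 \<le> r i" if "i \<in> I" for i
    using m0[OF that] I unfolding r_def by simp
  have rn: "r i ^ n = mean T (\<lambda>t. g i t ^ n)" if "i \<in> I" for i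
    using m0[OF that] I unfolding r_def by simp
  show ?thesis
  proof (cases "\<exists>i\<in>I. r i = 0")
    case True
    then obtain i where i: "i \<in> I" "r i = 0" by blast
    then have "(\<Sum>t\<in>T. g i t ^ n) = 0"
      using rn[of i] I T by (simp add: mean_def zero_power)
    then have "g i t = 0" if "t \<in> T" for t
      using that pos i I T by (subst (asm) sum_nonneg_eq_0_iff) auto
    then have "mean T (\<lambda>t. \<Prod>i\<in>I. g i t) = mean T (\<lambda>t. 0)"
      using i I by (intro mean_cong) auto
    then show ?thesis
      using r0 by (auto simp: mean_def r_def intro!: prod_nonneg)
  next
    case False
    then have rpos: "0 < r i" if "i \<in> I" for i using r0[OF that] that by fastforce
    define G where "G = mean T (\<lambda>t. \<Sum>i\<in>I. (1 / r i ^ n) * g i t ^ n)"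
    have 0: "mean T (\<lambda>t. real n * (\<Prod>i\<in>I. g i t / r i)) \<le>
        mean T (\<lambda>t. (\<Sum>i\<in>I. (1 / r i ^ n) * g i t ^ n) + real (n - card I))"
    proof (rule mean_mono)
      fix t assume t: "t \<in> T"
      have "real n * (\<Prod>i\<in>I. g i t / r i) \<le> (\<Sum>i\<in>I. (g i t / r i) ^ n) + real (n - card I)"
        using t pos rpos by (intro prod_le_mean_power[OF I]) (auto intro!: divide_nonneg_nonneg simp: less_imp_le)
      then show "real n * (\<Prod>i\<in>I. g i t / r i) \<le> (\<Sum>i\<in>I. (1 / r i ^ n) * g i t ^ n) + real (n - card I)"
        by (simp add: power_divide)
    qed
    have 1: "mean T (\<lambda>t. (\<Sum>i\<in>I. (1 / r i ^ n) * g i t ^ n) + real (n - card I)) = G + real (n - card I)"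
      unfolding G_def
      using mean_add[of T "\<lambda>t. \<Sum>i\<in>I. (1 / r i ^ n) * g i t ^ n" "\<lambda>_. real (n - card I)"]
        mean_const[OF T, of "real (n - card I)"] by simp
    have 2: "G = (\<Sum>i\<in>I. (1 / r i ^ n) * mean T (\<lambda>t. g i t ^ n))"
      unfolding G_def by (fact mean_lincomb[of T "\<lambda>i. 1 / r i ^ n" "\<lambda>i t. g i t ^ n" I])
    have 3: "(\<Sum>i\<in>I. (1 / r i ^ n) * mean T (\<lambda>t. g i t ^ n)) = (\<Sum>i\<in>I. 1)"
    proof (rule sum.cong[OF refl])
      fix i assume "i \<in> I"
      then show "(1 / r i ^ n) * mean T (\<lambda>t. g i t ^ n) = 1"
        using rpos[of i] by (simp add: rn[of i, symmetric])
    qed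
    have "real n * mean T (\<lambda>t. \<Prod>i\<in>I. g i t / r i) \<le> real n"
      using 0 mean_cmult[of T "real n" "\<lambda>t. \<Prod>i\<in>I. g i t / r i"] I unfolding 1 2 3 by simp
    then have "mean T (\<lambda>t. \<Prod>i\<in>I. g i t / r i) \<le> 1" using I by simp
    moreover have "mean T (\<lambda>t. \<Prod>i\<in>I. g i t) = (\<Prod>i\<in>I. r i) * mean T (\<lambda>t. \<Prod>i\<in>I. g i t / r i)"
    proof -
      have "(\<Prod>i\<in>I. r i) \<noteq> 0" using False I by (auto simp: prod_zero_iff)
      then show ?thesis
        by (subst mean_cmult[symmetric]) (simp add: prod_dividef)
    qed
    moreover have "0 \<le> (\<Prod>i\<in>I. r i)" using r0 by (intro prod_nonneg) auto
    ultimately have "mean T (\<lambda>t. \<Prod>i\<in>I. g i t) \<le> (\<Prod>i\<in>I. r i)"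
      by (simp add: mult_left_le)
    then show ?thesis by (simp add: r_def)
  qed
qed

text \<open>Multiplication by a unit permutes the residues modulo \<open>M\<close>, and
  \<open>h\<close> is periodic.\<close>

lemma sum_dilate:
  fixes h :: "int \<Rightarrow> 'b::comm_monoid_add"
  assumes M: "M > 0" and c: "coprime c (int M)" and h: "\<And>n. h (n mod int M) = h n"
  shows "(\<Sum>t\<in>{0..<int M}. h (c * t)) = (\<Sum>t\<in>{0..<int M}. h t)"
proof -
  have inj: "inj_on (\<lambda>t. (c * t) mod int M) {0..<int M}"
  proof (rule inj_onI)
    fix a b assume ab: "a \<in> {0..<int M}" "b \<in> {0..<int M}" "(c * a) mod int M = (c * b) mod int M"
    then have "int M dvd c * (a - b)"
      by (simp add: mod_eq_dvd_iff algebra_simps)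
    then have "int M dvd a - b"
      using c coprime_dvd_mult_right_iff[of "int M" c] by (simp add: coprime_commute)
    then have "a mod int M = b mod int M" by (simp add: mod_eq_dvd_iff)
    then show "a = b" using ab by simp
  qed
  have "(\<lambda>t. (c * t) mod int M) ` {0..<int M} = {0..<int M}"
    using inj M by (intro endo_inj_surj) auto
  then have "(\<Sum>t\<in>{0..<int M}. h t) = (\<Sum>t\<in>{0..<int M}. h ((c * t) mod int M))"
    using sum.reindex[OF inj, of h] by simp
  then show ?thesis by (simp add: h)
qed

lemma mean_grid_dilate:
  fixes h :: "int \<Rightarrow> int \<Rightarrow> real"
  assumes M: "M > 0" and c: "coprime c (int M)"
    and h: "\<And>m n. h (m mod int M) n = h m n" "\<And>m n. h m (n mod int M) = h m n"
  shows "mean (grid M) (\<lambda>z. h (c * fst z) (c * snd z)) = mean (grid M) (\<lambda>z. h (fst z) (snd z))"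
proof -
  have "(\<Sum>z\<in>grid M. h (c * fst z) (c * snd z)) = (\<Sum>t\<in>{0..<int M}. \<Sum>u\<in>{0..<int M}. h (c * t) (c * u))"
    unfolding grid_def by (subst sum.cartesian_product) (simp add: case_prod_unfold)
  also have "\<dots> = (\<Sum>t\<in>{0..<int M}. \<Sum>u\<in>{0..<int M}. h (c * t) u)"
    using h by (intro sum.cong refl sum_dilate[OF M c]) auto
  also have "\<dots> = (\<Sum>t\<in>{0..<int M}. \<Sum>u\<in>{0..<int M}. h t u)"
    using h by (intro sum_dilate[OF M c, where h = "\<lambda>t. \<Sum>u\<in>{0..<int M}. h t u"]) auto
  also have "\<dots> = (\<Sum>z\<in>grid M. h (fst z) (snd z))"
    unfolding grid_def by (subst sum.cartesian_product) (simp add: case_prod_unfold)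
  finally show ?thesis by (simp add: mean_def)
qed

lemma ft_mod:
  assumes "M > 0"
  shows "ft M f g B (m mod int M, n) = ft M f g B (m, n)"
    and "ft M f g B (m, n mod int M) = ft M f g B (m, n)"
proof -
  have d: "int M dvd m mod int M - m" for m
    by (metis dvd_minus_mod dvd_minus_iff minus_diff_eq)
  have "int M dvd (m mod int M * f x + n * g x) - (m * f x + n * g x)"
    "int M dvd (m * f x + n mod int M * g x) - (m * f x + n * g x)" for x
    using dvd_mult2[OF d[of m], of "f x"] dvd_mult2[OF d[of n], of "g x"]
    by (simp_all add: algebra_simps)
  then show "ft M f g B (m mod int M, n) = ft M f g B (m, n)"
    "ft M f g B (m, n mod int M) = ft M f g B (m, n)"
    using assms ee_cong_mod unfolding ft_def fst_conv snd_conv by (auto intro!: sum.cong ee_cong_mod)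
qed

section \<open>Energies as moments, and the norms they define\<close>

definition energy :: "nat \<Rightarrow> nat \<Rightarrow> ('a \<Rightarrow> int) \<Rightarrow> ('a \<Rightarrow> int) \<Rightarrow> 'a set \<Rightarrow> real" where
  "energy n M f g B = mean (grid M) (\<lambda>z. cmod (ft M f g B z) ^ n)"

definition nrm :: "nat \<Rightarrow> nat \<Rightarrow> ('a \<Rightarrow> int) \<Rightarrow> ('a \<Rightarrow> int) \<Rightarrow> 'a set \<Rightarrow> real" where
  "nrm n M f g B = root n (energy n M f g B)"

lemma energy_nonneg: "0 \<le> energy n M f g B"
  unfolding energy_def by (intro mean_nonneg) auto

lemma nrm_nonneg: "0 \<le> nrm n M f g B"
  unfolding nrm_def using energy_nonneg[of n M f g B] by (cases "n = 0") auto

lemma nrm_power: "0 < n \<Longrightarrow> nrm n M f g B ^ n = energy n M f g B"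
  unfolding nrm_def using energy_nonneg[of n M f g B] by simp

text \<open>After Hoelder the coefficient \<open>c i\<close> disappears, because dilating the
  frequency by a unit does not change a moment. Hence one norm per set bounds relations with
  arbitrary unit coefficients.\<close>

lemma mean_prod_ft_le:
  assumes "M > 0" "finite I" "card I \<le> n" "0 < n" "\<And>i. i \<in> I \<Longrightarrow> coprime (c i) (int M)"
  shows "mean (grid M) (\<lambda>z. \<Prod>i\<in>I. cmod (ft M f g (B i) (c i * fst z, c i * snd z)))
    \<le> (\<Prod>i\<in>I. nrm n M f g (B i))"
proof -
  have "mean (grid M) (\<lambda>z. \<Prod>i\<in>I. cmod (ft M f g (B i) (c i * fst z, c i * snd z)))
     \<le> (\<Prod>i\<in>I. root n (mean (grid M) (\<lambda>z. cmod (ft M f g (B i) (c i * fst z, c i * snd z)) ^ n)))"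
    using assms grid_nonempty by (intro mean_prod_le_prod_root) auto
  also have "\<dots> = (\<Prod>i\<in>I. nrm n M f g (B i))"
  proof (rule prod.cong[OF refl])
    fix i assume "i \<in> I"
    then show "root n (mean (grid M) (\<lambda>z. cmod (ft M f g (B i) (c i * fst z, c i * snd z)) ^ n)) = nrm n M f g (B i)"
      using mean_grid_dilate[OF assms(1,5), of i "\<lambda>a b. cmod (ft M f g (B i) (a, b)) ^ n"] assms(1)
      by (simp add: ft_mod nrm_def energy_def)
  qed
  finally show ?thesis .
qed

lemma card_relations_le:
  assumes "M > 0" "finite I" "card I \<le> n" "0 < n" "\<And>i. i \<in> I \<Longrightarrow> coprime (c i) (int M)"
    "\<And>i. i \<in> I \<Longrightarrow> finite (B i)"
  shows "real (card (relations M I c f g B)) \<le> (\<Prod>i\<in>I. nrm n M f g (B i))"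
  using card_relations_le_mean[OF assms(1,2,6), where c = c and f = f and g = g]
    mean_prod_ft_le[OF assms(1-5), where f = f and g = g and B = B] assms(1)
  by (meson order_trans)

text \<open>An equation with \<open>k\<close> terms on each side, written as a relation on
  \<open>2 * k\<close> positions.\<close>

definition sgn2 :: "nat \<Rightarrow> nat \<Rightarrow> int" where
  "sgn2 k i = (if i < k then 1 else - 1)"

lemma ft_uminus: "ft M f g B (- a, - b) = cnj (ft M f g B (a, b))"
  by (simp add: ft_def cnj_ee)

lemma prod_sgn2:
  fixes F :: "int \<Rightarrow> 'b::comm_monoid_mult"
  shows "(\<Prod>i<2 * k. F (sgn2 k i)) = F 1 ^ k * F (- 1) ^ k"
proof -
  have eq: "{..<2 * k} = {..<k} \<union> {k..<2 * k}" by auto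
  have "(\<Prod>i<2 * k. F (sgn2 k i)) = (\<Prod>i<k. F (sgn2 k i)) * (\<Prod>i=k..<2*k. F (sgn2 k i))"
    unfolding eq by (rule prod.union_disjoint) auto
  also have "\<dots> = F 1 ^ k * F (- 1) ^ k" by (simp add: sgn2_def)
  finally show ?thesis .
qed

text \<open>|F|^(2k) is F^k times the k-th power of its conjugate, and conjugation negates the
  frequency. The count is modulo \<open>M\<close>; equality in the integers enters only once
  \<open>M\<close> is chosen large.\<close>

lemma energy_eq_card_relations:
  assumes "M > 0" "finite B"
  shows "energy (2 * k) M f g B = real (card (relations M {..<2 * k} (sgn2 k) f g (\<lambda>_. B)))"
proof -
  have "of_nat (card (relations M {..<2 * k} (sgn2 k) f g (\<lambda>_. B))) =
    mean (grid M) (\<lambda>z. complex_of_real (cmod (ft M f g B z) ^ (2 * k)))"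
    unfolding card_relations_eq_mean[OF assms(1) finite_lessThan assms(2)]
  proof (rule mean_cong)
    fix z
    have "(\<Prod>i<2 * k. ft M f g B (sgn2 k i * fst z, sgn2 k i * snd z)) =
      (ft M f g B z * cnj (ft M f g B z)) ^ k"
      using prod_sgn2[where F = "\<lambda>c. ft M f g B (c * fst z, c * snd z)"]
      by (simp add: ft_uminus power_mult_distrib)
    then show "(\<Prod>i<2 * k. ft M f g B (sgn2 k i * fst z, sgn2 k i * snd z)) =
        complex_of_real (cmod (ft M f g B z) ^ (2 * k))"
      by (simp only: power_mult complex_norm_square[symmetric] of_real_power)
  qed
  also have "\<dots> = complex_of_real (energy (2 * k) M f g B)"
    by (simp only: energy_def of_real_mean)
  finally show ?thesis
    by (metis of_real_of_nat_eq of_real_eq_iff)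
qed

lemma nrm_le_card: "0 < n \<Longrightarrow> M > 0 \<Longrightarrow> nrm n M f g B \<le> real (card B)"
proof -
  assume n: "0 < n" and M: "M > 0"
  have "energy n M f g B \<le> mean (grid M) (\<lambda>_. real (card B) ^ n)"
    unfolding energy_def by (intro mean_mono power_mono norm_ft_le) auto
  then have "energy n M f g B \<le> real (card B) ^ n"
    using mean_const[of "grid M" "real (card B) ^ n"] grid_nonempty[OF M] by simp
  then show ?thesis using n unfolding nrm_def
    by (metis of_nat_0_le_iff real_root_le_iff real_root_power_cancel)
qed

section \<open>Sidon subsets of sets with small energy\<close>

text \<open>Additive over the integers even for the multiplicative problems: there \<open>f\<close>
  will be an integer encoding of a vector of valuations.\<close>

definition sidon :: "nat \<Rightarrow> ('a \<Rightarrow> int) \<Rightarrow> 'a set \<Rightarrow> bool" where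
  "sidon s f X \<longleftrightarrow> (\<forall>xs ys. length xs = s \<and> set xs \<subseteq> X \<and> length ys = s \<and> set ys \<subseteq> X \<and>
     sum_list (map f xs) = sum_list (map f ys) \<longrightarrow> mset xs = mset ys)"

lemma sum_list_map_eq_sum_count_mset:
  fixes f :: "'a \<Rightarrow> int"
  assumes "finite X" "set xs \<subseteq> X"
  shows "sum_list (map f xs) = (\<Sum>x\<in>X. int (count (mset xs) x) * f x)"
  using assms(2)
proof (induction xs)
  case (Cons a xs)
  have "(\<Sum>x\<in>X. int (count (mset (a # xs)) x) * f x) =
      (\<Sum>x\<in>X. (if x = a then f x else 0) + int (count (mset xs) x) * f x)"
    by (intro sum.cong) (auto simp: algebra_simps)
  also have "\<dots> = f a + (\<Sum>x\<in>X. int (count (mset xs) x) * f x)"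
    using Cons assms(1) by (simp add: sum.distrib)
  finally show ?case using Cons by simp
qed simp

text \<open>Two solutions with equal sums differ by the vector of differences of multiplicities,
  which has l1-norm at most \<open>2 * s\<close> and is annihilated by \<open>f\<close>. If only the
  zero vector has these properties, the multisets agree.\<close>

lemma sidon_of_no_relation:
  fixes g :: "'i \<Rightarrow> 'a" and f :: "'a \<Rightarrow> int"
  assumes fin: "finite I" and inj: "inj_on g I"
    and nr: "\<And>c. (\<forall>i. i \<notin> I \<longrightarrow> c i = 0) \<Longrightarrow> (\<Sum>i\<in>I. \<bar>c i\<bar>) \<le> 2 * int s \<Longrightarrow>
      (\<Sum>i\<in>I. c i * f (g i)) = (0::int) \<Longrightarrow> (\<forall>i\<in>I. c i = 0)"
  shows "sidon s f (g ` I)"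
  unfolding sidon_def
proof (intro allI impI, elim conjE)
  fix xs ys
  assume xs: "length xs = s" "set xs \<subseteq> g ` I" and ys: "length ys = s" "set ys \<subseteq> g ` I"
    and eq: "sum_list (map f xs) = sum_list (map f ys)"
  define c where "c = (\<lambda>i. if i \<in> I then int (count (mset xs) (g i)) - int (count (mset ys) (g i)) else 0)"
  have one: "(\<Sum>i\<in>I. int (count (mset zs) (g i)) * h (g i)) = sum_list (map h zs)"
    if "set zs \<subseteq> g ` I" for zs and h :: "'a \<Rightarrow> int"
    using sum_list_map_eq_sum_count_mset[OF finite_imageI[OF fin] that, of h] inj
    by (simp add: sum.reindex)
  have len: "(\<Sum>i\<in>I. int (count (mset zs) (g i))) = int (length zs)" if "set zs \<subseteq> g ` I" for zs
    using one[OF that, of "\<lambda>_. 1"] by (simp add: sum_list_triv)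
  have "(\<Sum>i\<in>I. \<bar>c i\<bar>) \<le> (\<Sum>i\<in>I. int (count (mset xs) (g i)) + int (count (mset ys) (g i)))"
    by (intro sum_mono) (auto simp: c_def)
  also have "\<dots> = 2 * int s"
    using xs ys by (simp add: sum.distrib len)
  finally have "(\<Sum>i\<in>I. \<bar>c i\<bar>) \<le> 2 * int s" .
  moreover have "(\<Sum>i\<in>I. c i * f (g i)) = 0"
    using one[OF xs(2), of f] one[OF ys(2), of f] eq
    by (simp add: c_def algebra_simps sum_subtractf)
  ultimately have c0: "\<forall>i\<in>I. c i = 0" by (intro nr) (auto simp: c_def)
  have "count (mset xs) x = count (mset ys) x" for x
  proof (cases "x \<in> g ` I")
    case True
    then show ?thesis using c0 by (auto simp: c_def)
  next
    case False
    then have "x \<notin> set xs" "x \<notin> set ys" using xs ys by auto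
    then show ?thesis by (metis count_eq_zero_iff set_mset_mset)
  qed
  then show "mset xs = mset ys" by (intro multiset_eqI) auto
qed

text \<open>A random map from \<open>m\<close> points to \<open>B\<close> satisfies on average fewer than one nontrivial
  relation, hence some map satisfies none.\<close>

lemma exists_relation_free:
  fixes f :: "'a \<Rightarrow> int"
  assumes M: "prime M" "M > 2 * s" and s: "s \<ge> 1" and B: "finite B" "B \<noteq> {}"
    and m: "16 * real s * real m * nrm (2 * s) M f (\<lambda>_. 0) B \<le> real (card B)"
  obtains g where "g \<in> {..<m} \<rightarrow> B"
    "\<And>c. (\<forall>i. i \<notin> {..<m} \<longrightarrow> c i = 0) \<Longrightarrow> (\<Sum>i<m. \<bar>c i\<bar>) \<le> 2 * int s \<Longrightarrow>
      int M dvd (\<Sum>i<m. c i * f (g i)) \<Longrightarrow> (\<forall>i<m. c i = 0)"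
proof -
  define N where "N = real (card B)"
  define \<Phi> where "\<Phi> = nrm (2 * s) M f (\<lambda>_. 0) B"
  define r where "r = \<Phi> / N"
  have N: "N > 0" using B by (simp add: N_def card_gt_0_iff)
  have Phi0: "\<Phi> \<ge> 0" by (simp add: \<Phi>_def nrm_nonneg)
  then have r0: "r \<ge> 0" using N by (simp add: r_def)
  have Mpos: "M > 0" using M by (simp add: prime_gt_0_nat)
  define R where "R = PiE {..<m} (\<lambda>_. {- 2 * int s .. 2 * int s})"
  define C where "C = {c \<in> R. (\<exists>i<m. c i \<noteq> 0) \<and> (\<Sum>i<m. \<bar>c i\<bar>) \<le> 2 * int s}"
  define bad where "bad = (\<lambda>c. relations M {..<m} c f (\<lambda>_. 0) (\<lambda>_. B))"
  define w where "w = (\<lambda>c::int. if c = 0 then 1 else r)"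
  have finR: "finite R" unfolding R_def by (intro finite_PiE) auto
  have finC: "finite C" using finR by (simp add: C_def)
  \<comment> \<open>A coordinate with coefficient 0 is free and contributes a factor
    \<open>N\<close>; the at most \<open>2 * s\<close> others contribute \<Phi> each by Hoelder.
    Relative to \<open>N ^ m\<close>, each nonzero coefficient therefore weighs
    \<open>r\<close>.\<close>
  have card_bad: "real (card (bad c)) \<le> N ^ m * (\<Prod>i<m. w (c i))" if c: "c \<in> C" for c
  proof -
    define S where "S = {i. i < m \<and> c i \<noteq> 0}"
    have S: "S \<subseteq> {..<m}" "finite S" by (auto simp: S_def)
    have split: "{..<m} = ({..<m} - S) \<union> S" using S by auto
    have "int (card S) = (\<Sum>i\<in>S. 1)" by simp
    also have "\<dots> \<le> (\<Sum>i\<in>S. \<bar>c i\<bar>)" by (intro sum_mono) (auto simp: S_def)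
    also have "\<dots> \<le> (\<Sum>i<m. \<bar>c i\<bar>)" using S by (intro sum_mono2) auto
    also have "\<dots> \<le> 2 * int s" using c by (simp add: C_def)
    finally have cS: "card S \<le> 2 * s" by simp
    \<comment> \<open>Nonzero coefficients are at most \<open>2 * s < M\<close> in absolute value,
      hence units modulo the prime \<open>M\<close>.\<close>
    have cop: "coprime (c i) (int M)" if "i \<in> S" for i
    proof -
      have "i < m" "c i \<noteq> 0" using that by (auto simp: S_def)
      moreover have "c i \<in> {- 2 * int s .. 2 * int s}"
        using c \<open>i < m\<close> by (auto simp: C_def R_def PiE_iff)
      ultimately have "\<not> int M dvd c i" using M(2) by (auto dest!: zdvd_imp_le[of "int M" "\<bar>c i\<bar>", simplified])
      then show ?thesis using M(1) prime_imp_coprime[of "int M" "c i"] by (simp add: coprime_commute)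
    qed
    have "real (card (bad c)) \<le> mean (grid M) (\<lambda>z. \<Prod>i<m. cmod (ft M f (\<lambda>_. 0) B (c i * fst z, c i * snd z)))"
      unfolding bad_def using B by (intro card_relations_le_mean[OF Mpos]) auto
    also have "\<dots> = mean (grid M) (\<lambda>z. N ^ (m - card S) * (\<Prod>i\<in>S. cmod (ft M f (\<lambda>_. 0) B (c i * fst z, c i * snd z))))"
    proof (rule mean_cong)
      fix z :: "int \<times> int"
      have "(\<Prod>i\<in>{..<m} - S. cmod (ft M f (\<lambda>_. 0) B (c i * fst z, c i * snd z))) = (\<Prod>i\<in>{..<m} - S. N)"
        by (intro prod.cong) (auto simp: S_def ft_def N_def)
      also have "\<dots> = N ^ (m - card S)" using S by (simp add: card_Diff_subset)
      finally have 1: "(\<Prod>i\<in>{..<m} - S. cmod (ft M f (\<lambda>_. 0) B (c i * fst z, c i * snd z))) = N ^ (m - card S)" .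
      show "(\<Prod>i<m. cmod (ft M f (\<lambda>_. 0) B (c i * fst z, c i * snd z))) =
          N ^ (m - card S) * (\<Prod>i\<in>S. cmod (ft M f (\<lambda>_. 0) B (c i * fst z, c i * snd z)))"
        unfolding 1[symmetric] by (rule prod.subset_diff[OF S(1)]) simp
    qed
    also have "\<dots> = N ^ (m - card S) * mean (grid M) (\<lambda>z. (\<Prod>i\<in>S. cmod (ft M f (\<lambda>_. 0) B (c i * fst z, c i * snd z))))"
      by (rule mean_cmult)
    also have "\<dots> \<le> N ^ (m - card S) * (\<Prod>i\<in>S. \<Phi>)"
      using N S cS s cop unfolding \<Phi>_def by (intro mult_left_mono mean_prod_ft_le[OF Mpos]) auto
    also have "\<dots> = N ^ (m - card S) * (N * r) ^ card S"
      using N by (simp add: r_def)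
    also have "\<dots> = N ^ m * r ^ card S"
    proof -
      have "card S \<le> m" using card_mono[OF _ S(1)] by simp
      then have "N ^ (m - card S) * N ^ card S = N ^ m" by (simp flip: power_add)
      then show ?thesis by (simp add: power_mult_distrib mult.assoc[symmetric])
    qed
    also have "r ^ card S = (\<Prod>i<m. w (c i))"
    proof -
      have "(\<Prod>i<m. w (c i)) = (\<Prod>i\<in>{..<m} - S. w (c i)) * (\<Prod>i\<in>S. w (c i))"
        by (rule prod.subset_diff[OF S(1)]) simp
      moreover have "(\<Prod>i\<in>{..<m} - S. w (c i)) = 1" by (intro prod.neutral) (auto simp: w_def S_def)
      moreover have "(\<Prod>i\<in>S. w (c i)) = (\<Prod>i\<in>S. r)" by (intro prod.cong) (auto simp: w_def S_def)
      ultimately show ?thesis by simp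
    qed
    finally show ?thesis .
  qed
  \<comment> \<open>Over the whole box the weights factorise into one sum per coordinate: 1 for the
    value 0 and \<open>r\<close> for each of the 4s other values.\<close>
  have tot: "(\<Sum>c\<in>R. \<Prod>i<m. w (c i)) = (1 + 4 * real s * r) ^ m"
  proof -
    have "(\<Sum>x\<in>{- 2 * int s .. 2 * int s}. w x) = w 0 + (\<Sum>x\<in>{- 2 * int s .. 2 * int s} - {0}. w x)"
      by (rule sum.remove) auto
    also have "(\<Sum>x\<in>{- 2 * int s .. 2 * int s} - {0}. w x) = (\<Sum>x\<in>{- 2 * int s .. 2 * int s} - {0}. r)"
      by (intro sum.cong) (auto simp: w_def)
    also have "\<dots> = 4 * real s * r" by (simp add: card_Diff_singleton)
    finally have "(\<Sum>x\<in>{- 2 * int s .. 2 * int s}. w x) = 1 + 4 * real s * r" by (simp add: w_def)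
    moreover have "(\<Sum>c\<in>R. \<Prod>i<m. w (c i)) = (\<Prod>i<m. \<Sum>x\<in>{- 2 * int s .. 2 * int s}. w x)"
      unfolding R_def by (rule prod_sum_PiE[symmetric]) auto
    ultimately show ?thesis by simp
  qed
  define z where "z = restrict (\<lambda>_. 0::int) {..<m}"
  have zR: "z \<in> R" by (auto simp: z_def R_def)
  have zC: "z \<notin> C" by (auto simp: z_def C_def)
  have w0: "0 \<le> w x" for x using r0 by (simp add: w_def)
  \<comment> \<open>The zero vector has weight 1 and is no bad event; removing it leaves at most exp
    (1/4) - 1 < 1, because the hypothesis with its constant 16 says exactly that 4 s r m \<le>
    1/4.\<close>
  have "(\<Sum>c\<in>C. \<Prod>i<m. w (c i)) \<le> (\<Sum>c\<in>R - {z}. \<Prod>i<m. w (c i))"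
    using finR zC w0 by (intro sum_mono2 prod_nonneg) (auto simp: C_def)
  also have "\<dots> = (1 + 4 * real s * r) ^ m - (\<Prod>i<m. w (z i))"
    using tot sum.remove[OF finR zR, of "\<lambda>c. \<Prod>i<m. w (c i)"] by simp
  also have "(\<Prod>i<m. w (z i)) = 1" by (intro prod.neutral) (auto simp: z_def w_def)
  also have "(1 + 4 * real s * r) ^ m - 1 \<le> exp (4 * real s * r) ^ m - 1"
    using r0 by (intro diff_right_mono power_mono exp_ge_add_one_self) auto
  also have "exp (4 * real s * r) ^ m = exp (4 * real s * r * real m)"
    by (simp add: exp_of_nat_mult mult.commute)
  also have "exp (4 * real s * r * real m) - 1 \<le> exp (1/4) - 1"
    using m N by (simp add: r_def field_simps \<Phi>_def N_def)
  also have "\<dots> < 1" using exp_bound[of "1/4::real"] by (simp add: power2_eq_square)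
  finally have small: "(\<Sum>c\<in>C. \<Prod>i<m. w (c i)) < 1" .
  define G where "G = PiE {..<m} (\<lambda>_. B)"
  have cG: "real (card G) = N ^ m" by (simp add: G_def card_PiE N_def)
  have finG: "finite G" unfolding G_def using B by (intro finite_PiE) auto
  have "real (card (\<Union>c\<in>C. bad c)) \<le> real (\<Sum>c\<in>C. card (bad c))"
    using card_UN_le[OF finC] by (simp only: of_nat_le_iff)
  also have "\<dots> \<le> (\<Sum>c\<in>C. N ^ m * (\<Prod>i<m. w (c i)))"
    unfolding of_nat_sum by (intro sum_mono card_bad)
  also have "\<dots> = N ^ m * (\<Sum>c\<in>C. \<Prod>i<m. w (c i))" by (simp add: sum_distrib_left)
  also have "\<dots> < N ^ m" using small N by simp
  finally have "card (\<Union>c\<in>C. bad c) < card G" unfolding cG[symmetric] by simp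
  moreover have "finite (\<Union>c\<in>C. bad c)"
    using finG by (rule finite_subset[rotated]) (auto simp: bad_def relations_def G_def)
  ultimately have "\<not> G \<subseteq> (\<Union>c\<in>C. bad c)"
    using card_mono by (meson leD)
  then obtain g where g: "g \<in> G" "\<And>c. c \<in> C \<Longrightarrow> g \<notin> bad c" by blast
  show thesis
  proof (rule that[of g])
    show "g \<in> {..<m} \<rightarrow> B" using g(1) by (auto simp: G_def PiE_def)
  next
    fix c :: "nat \<Rightarrow> int"
    assume c: "\<forall>i. i \<notin> {..<m} \<longrightarrow> c i = 0" "(\<Sum>i<m. \<bar>c i\<bar>) \<le> 2 * int s"
      and d: "int M dvd (\<Sum>i<m. c i * f (g i))"
    define c' where "c' = restrict c {..<m}"
    have "\<bar>c i\<bar> \<le> 2 * int s" if "i < m" for i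
      using member_le_sum[of i "{..<m}" "\<lambda>i. \<bar>c i\<bar>"] that c(2) by simp
    then have "c' \<in> R" by (force simp: R_def c'_def abs_le_iff)
    moreover have "g \<in> bad c'"
      using g(1) d by (simp add: bad_def relations_def c'_def G_def)
    ultimately have "\<not> (\<exists>i<m. c' i \<noteq> 0)"
      using g(2)[of c'] c(2) unfolding C_def c'_def by (simp cong: conj_cong) blast
    then show "\<forall>i<m. c i = 0" by (auto simp: c'_def)
  qed
qed

text \<open>Take the largest number \<open>m\<close> of random points that the relation count
  allows; rounding down loses a factor 2, whence 32 instead of 16. If \<open>m\<close> is 0, a
  single point already meets the bound.\<close>

lemma exists_large_sidon:
  fixes f :: "'a \<Rightarrow> int"
  assumes M: "prime M" "M > 2 * s" and s: "s \<ge> 1" and B: "finite B" "B \<noteq> {}"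
  obtains X where "X \<subseteq> B" "sidon s f X" "X \<noteq> {}"
    "real (card B) \<le> 32 * real s * real (card X) * nrm (2 * s) M f (\<lambda>_. 0) B"
proof -
  define \<Phi> where "\<Phi> = nrm (2 * s) M f (\<lambda>_. 0) B"
  define N where "N = real (card B)"
  have N: "N > 0" using B by (simp add: N_def card_gt_0_iff)
  have Mpos: "M > 0" using M by (simp add: prime_gt_0_nat)
  \<comment> \<open>The frequency (0, 0) alone contributes \<open>N ^ (2 * s)\<close> to the
    moment.\<close>
  have Phi: "\<Phi> > 0"
  proof -
    have z: "(0, 0) \<in> grid M" using Mpos by (simp add: grid_def)
    have "0 < (\<Sum>z\<in>grid M. cmod (ft M f (\<lambda>_. 0) B z) ^ (2 * s))"
      using z N by (intro sum_pos2[OF _ z]) (auto simp: ft_def N_def)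
    then have "energy (2 * s) M f (\<lambda>_. 0) B > 0"
      using Mpos by (simp add: energy_def mean_def)
    then show ?thesis using s by (simp add: \<Phi>_def nrm_def)
  qed
  define m where "m = nat \<lfloor>N / (16 * real s * \<Phi>)\<rfloor>"
  show thesis
  proof (cases "m = 0")
    case True
    obtain b where b: "b \<in> B" using B by blast
    have "N / (16 * real s * \<Phi>) < 1" using True by (simp add: m_def)
    then have "N < 16 * real s * \<Phi>" using s Phi by (simp add: field_simps)
    then have "N \<le> 32 * real s * \<Phi>" using N by linarith
    moreover have "sidon s f {b}"
      unfolding sidon_def
    proof (intro allI impI, elim conjE)
      fix xs ys assume "length xs = s" "set xs \<subseteq> {b}" "length ys = s" "set ys \<subseteq> {b}"
      then show "mset xs = mset ys"
        by (metis (no_types, opaque_lifting) replicate_eqI subset_singleton_iff empty_iff singletonD subsetD)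
    qed
    ultimately show thesis using b by (intro that[of "{b}"]) (auto simp: N_def \<Phi>_def)
  next
    case False
    have mle: "real m \<le> N / (16 * real s * \<Phi>)"
      unfolding m_def using N s Phi by (simp add: of_nat_nat)
    have mge: "N / (16 * real s * \<Phi>) \<le> 2 * real m"
      using False unfolding m_def by linarith
    have "16 * real s * real m * \<Phi> \<le> N"
      using mle s Phi by (simp add: field_simps)
    from exists_relation_free[OF M s B this[unfolded \<Phi>_def N_def]] obtain g where
      g: "g \<in> {..<m} \<rightarrow> B" and nr: "\<And>c. (\<forall>i. i \<notin> {..<m} \<longrightarrow> c i = 0) \<Longrightarrow> (\<Sum>i<m. \<bar>c i\<bar>) \<le> 2 * int s \<Longrightarrow>
      int M dvd (\<Sum>i<m. c i * f (g i)) \<Longrightarrow> (\<forall>i<m. c i = 0)" by blast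
    \<comment> \<open>A coincidence \<open>g i = g j\<close> is itself a relation, with coefficients
      1 and -1 and total length 2 \<le> 2 s.\<close>
    have inj: "inj_on g {..<m}"
    proof (rule inj_onI, rule ccontr)
      fix i j assume ij: "i \<in> {..<m}" "j \<in> {..<m}" "g i = g j" "i \<noteq> j"
      define c :: "nat \<Rightarrow> int" where "c = (\<lambda>l. (if l = i then 1 else 0) + (if l = j then -1 else 0))"
      have "(\<Sum>l<m. \<bar>c l\<bar>) \<le> (\<Sum>l<m. (if l = i then 1 else 0) + (if l = j then 1 else 0))"
        by (intro sum_mono) (auto simp: c_def)
      also have "\<dots> = 2" using ij by (simp add: sum.distrib)
      finally have c1: "(\<Sum>l<m. \<bar>c l\<bar>) \<le> 2 * int s" using s by simp
      have "(\<Sum>l<m. c l * f (g l)) = 0"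
      proof -
        have "(\<Sum>l<m. c l * f (g l)) = (\<Sum>l<m. (if l = i then f (g i) else 0) + (if l = j then - f (g j) else 0))"
          by (intro sum.cong) (auto simp: c_def)
        also have "\<dots> = (\<Sum>l<m. if l = i then f (g i) else 0) + (\<Sum>l<m. if l = j then - f (g j) else 0)"
          by (rule sum.distrib)
        also have "\<dots> = f (g i) + - f (g j)"
          using ij(1,2) by (simp only: sum.delta finite_lessThan if_True)
        also have "\<dots> = 0" using ij(3) by simp
        finally show ?thesis .
      qed
      then have c2: "int M dvd (\<Sum>l<m. c l * f (g l))" by (simp only: dvd_0_right)
      have c3: "\<forall>l. l \<notin> {..<m} \<longrightarrow> c l = 0" using ij(1,2) by (auto simp: c_def)
      have "c i = 0" using nr[OF c3 c1 c2] ij(1) by (simp only: lessThan_iff)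
      then show False using ij(4) by (simp add: c_def)
    qed
    have "sidon s f (g ` {..<m})"
    proof (rule sidon_of_no_relation[OF _ inj])
      fix c :: "nat \<Rightarrow> int"
      assume c: "\<forall>i. i \<notin> {..<m} \<longrightarrow> c i = 0" "(\<Sum>i<m. \<bar>c i\<bar>) \<le> 2 * int s" "(\<Sum>i<m. c i * f (g i)) = 0"
      have "int M dvd (\<Sum>i<m. c i * f (g i))" unfolding c(3) by simp
      from nr[OF c(1,2) this] show "\<forall>i\<in>{..<m}. c i = 0" by blast
    qed simp
    moreover have "card (g ` {..<m}) = m" using inj by (simp add: card_image)
    moreover have "N \<le> 32 * real s * real m * \<Phi>" using mge s Phi by (simp add: field_simps)
    ultimately show thesis using g False by (intro that[of "g ` {..<m}"]) (auto simp: N_def \<Phi>_def)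
  qed
qed

section \<open>One-dimensional trigonometric sums\<close>

text \<open>A discrete form of exp (-u) I0(u), with I0 the modified Bessel function: the saving when
  an exponential with a cosine phase is averaged over a full period. Both a constant saving for
  moderate \<open>u\<close> and a power saving for large \<open>u\<close> will be needed.\<close>

definition damp :: "nat \<Rightarrow> real \<Rightarrow> real" where
  "damp M u = mean {0..<int M} (\<lambda>t. exp (- u * (1 - Re (ee M t))))"

lemma Re_ee_le: "Re (ee M n) \<le> 1"
  by (simp add: ee_def)

lemma mean_ee:
  assumes "M > 0"
  shows "mean {0..<int M} (\<lambda>t. ee M (t * n)) = (if int M dvd n then 1 else 0)"
  using sum_ee[OF assms, of n] assms by (simp add: mean_def)

lemma damp_antimono:
  assumes "u \<le> v"
  shows "damp M v \<le> damp M u"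
  unfolding damp_def using assms
  by (intro mean_mono) (auto intro!: mult_right_mono simp: Re_ee_le)

text \<open>The product of 1 + y + y^2/2 and 1 - y + y^2/2 is 1 + y^4/4 \<ge> 1, so the lower Taylor
  bound for exp y can be inverted.\<close>

lemma exp_minus_le:
  fixes y :: real
  assumes "0 \<le> y"
  shows "exp (- y) \<le> 1 - y + y\<^sup>2 / 2"
proof -
  have e: "1 + y + y\<^sup>2 / 2 \<le> exp y" using exp_lower_Taylor_quadratic[OF assms] .
  have p: "0 \<le> 1 - y + y\<^sup>2 / 2"
  proof -
    have "0 \<le> ((y - 1)\<^sup>2 + 1) / 2" by simp
    also have "\<dots> = 1 - y + y\<^sup>2 / 2" by (simp add: power2_eq_square field_simps)
    finally show ?thesis .
  qed
  have "1 \<le> 1 + (y\<^sup>2)\<^sup>2 / 4" by simp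
  also have "\<dots> = (1 + y + y\<^sup>2 / 2) * (1 - y + y\<^sup>2 / 2)" by (simp add: power2_eq_square field_simps)
  also have "\<dots> \<le> exp y * (1 - y + y\<^sup>2 / 2)" using e p by (intro mult_right_mono)
  finally show ?thesis by (simp add: exp_minus field_simps)
qed

lemma exp_le_quadratic:
  fixes y :: real
  assumes "\<bar>y\<bar> \<le> 1"
  shows "exp y \<le> 1 + y + y\<^sup>2"
proof (cases "0 \<le> y")
  case True
  then show ?thesis using exp_bound[of y] assms by simp
next
  case False
  then have "exp y \<le> 1 + y + y\<^sup>2 / 2" using exp_minus_le[of "- y"] by simp
  then show ?thesis using zero_le_power2[of y] by linarith
qed

lemma mean_Re_ee:
  assumes "M > 0" "\<not> int M dvd n"
  shows "mean {0..<int M} (\<lambda>t. Re (ee M (t * n))) = 0"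
  using mean_ee[OF assms(1), of n] assms by (simp flip: Re_mean)

text \<open>Expand to second order: the cosine has mean 0 and its square has mean 1/2, where
  \<open>M \<ge> 3\<close> keeps the frequencies 1 and 2 nonzero. This gives 1 - a + 3 a^2/4, which
  is at most 1 - a/4 for a \<le> 1.\<close>

lemma damp_le_small:
  assumes M: "M \<ge> 3" and u: "0 < a" "a \<le> 1" "a \<le> u"
  shows "damp M u \<le> 1 - a / 4"
proof -
  let ?T = "{0..<int M}"
  let ?c = "\<lambda>t. Re (ee M t)"
  have ne: "finite ?T" "?T \<noteq> {}" using M by auto
  have sq: "(?c t)\<^sup>2 = (1 + Re (ee M (t * 2))) / 2" for t
  proof -
    have "ee M (t * 2) = ee M t * ee M t"
      by (simp add: mult.commute flip: ee_add)
    moreover have "(Re (ee M t))\<^sup>2 + (Im (ee M t))\<^sup>2 = 1"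
      by (simp add: ee_def)
    ultimately show ?thesis by (simp add: power2_eq_square)
  qed
  have "damp M u \<le> damp M a" using u by (intro damp_antimono)
  also have "\<dots> \<le> mean ?T (\<lambda>t. (1 - a + 3 / 4 * a\<^sup>2) + ((a - a\<^sup>2) * Re (ee M (t * 1)) + a\<^sup>2 / 4 * Re (ee M (t * 2))))"
    unfolding damp_def
  proof (rule mean_mono)
    fix t
    have "exp (- a * (1 - ?c t)) \<le> 1 - a * (1 - ?c t) + (a * (1 - ?c t))\<^sup>2 / 2"
      using exp_minus_le[of "a * (1 - ?c t)"] u Re_ee_le[of M t] by simp
    also have "(a * (1 - ?c t))\<^sup>2 = a\<^sup>2 * (1 - 2 * ?c t + (?c t)\<^sup>2)"
      by (simp add: power2_eq_square algebra_simps)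
    finally show "exp (- a * (1 - ?c t)) \<le> (1 - a + 3 / 4 * a\<^sup>2) + ((a - a\<^sup>2) * Re (ee M (t * 1)) + a\<^sup>2 / 4 * Re (ee M (t * 2)))"
      unfolding sq by (simp add: field_simps)
  qed
  also have "\<dots> = 1 - a + 3 / 4 * a\<^sup>2"
  proof -
    have "\<not> int M dvd 1" "\<not> int M dvd 2" using M by (auto dest!: zdvd_imp_le)
    then have z: "mean ?T (\<lambda>t. Re (ee M (t * 1))) = 0" "mean ?T (\<lambda>t. Re (ee M (t * 2))) = 0"
      using M mean_Re_ee[of M 1] mean_Re_ee[of M 2] by simp_all
    have "mean ?T (\<lambda>t. (a - a\<^sup>2) * Re (ee M (t * 1)) + a\<^sup>2 / 4 * Re (ee M (t * 2))) = 0"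
      unfolding mean_add mean_cmult z by simp
    then show ?thesis unfolding mean_add
      using mean_const[OF ne, of "1 - a"] mean_const[OF ne, of "3 * a\<^sup>2 / 4"] by simp
  qed
  also have "\<dots> \<le> 1 - a / 4"
  proof -
    have "a\<^sup>2 \<le> a" using u by (simp add: power2_eq_square mult_left_le)
    then show ?thesis by simp
  qed
  finally show ?thesis .
qed

text \<open>Parseval for the Dirichlet kernel; \<open>M \<ge> L\<close> keeps the \<open>L\<close>
  frequencies distinct modulo \<open>M\<close>.\<close>

lemma mean_norm_square_dirichlet:
  assumes "M \<ge> L" "L \<ge> 1"
  shows "mean {0..<int M} (\<lambda>t. (cmod (\<Sum>n<L. ee M (t * int n)))\<^sup>2) = real L"
proof -
  let ?T = "{0..<int M}"
  have M: "M > 0" using assms by simp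
  have dv: "int M dvd int m - int n \<longleftrightarrow> m = n" if "m < L" "n < L" for m n
  proof
    assume d: "int M dvd int m - int n"
    show "m = n"
    proof (rule ccontr)
      assume "m \<noteq> n"
      then have "\<bar>int m - int n\<bar> \<ge> int M" using d zdvd_imp_le[of "int M" "\<bar>int m - int n\<bar>"] by simp
      then show False using that assms by linarith
    qed
  qed simp
  have "complex_of_real (mean ?T (\<lambda>t. (cmod (\<Sum>n<L. ee M (t * int n)))\<^sup>2)) =
     mean ?T (\<lambda>t. \<Sum>m<L. \<Sum>n<L. ee M (t * (int m - int n)))"
    unfolding of_real_mean
  proof (rule mean_cong)
    fix t
    show "complex_of_real ((cmod (\<Sum>n<L. ee M (t * int n)))\<^sup>2) = (\<Sum>m<L. \<Sum>n<L. ee M (t * (int m - int n)))"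
      unfolding complex_norm_square cnj_sum cnj_ee sum_product
      by (intro sum.cong refl) (simp add: algebra_simps flip: ee_add)
  qed
  also have "\<dots> = (\<Sum>m<L. \<Sum>n<L. if m = n then 1 else 0)"
    unfolding mean_sum mean_ee[OF M] using dv by (intro sum.cong refl) auto
  also have "\<dots> = complex_of_real (real L)" by simp
  finally show ?thesis by (simp only: of_real_eq_iff)
qed

text \<open>Where the cosine is within 1/(2 L^2) of 1, the Dirichlet kernel of length
  \<open>L\<close> is at least L/2, so by Parseval such \<open>t\<close> have density at most 4/L.
  Elsewhere the exponential is at most exp (-u/(2 L^2)) \<le> 2 L^2/u. The free length
  \<open>L\<close> will be balanced at about the cube root of \<open>u\<close>.\<close>

lemma damp_le_large:
  assumes M: "M \<ge> L" and L: "L \<ge> 1" and u: "0 < u"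
  shows "damp M u \<le> 4 / real L + 2 * (real L)\<^sup>2 / u"
proof -
  let ?T = "{0..<int M}"
  let ?D = "\<lambda>t. cmod (\<Sum>n<L. ee M (t * int n))"
  have ne: "finite ?T" "?T \<noteq> {}" using M L by auto
  have pt: "exp (- u * (1 - Re (ee M t))) \<le> 4 / (real L)\<^sup>2 * (?D t)\<^sup>2 + 2 * (real L)\<^sup>2 / u" for t
  proof (cases "1 - Re (ee M t) \<le> 1 / (2 * (real L)\<^sup>2)")
    case True
    have "(cmod (ee M t - 1))\<^sup>2 = 2 * (1 - Re (ee M t))"
    proof -
      have "(Re (ee M t))\<^sup>2 + (Im (ee M t))\<^sup>2 = 1" by (simp add: ee_def)
      then show ?thesis unfolding cmod_power2 by (simp add: power2_eq_square algebra_simps)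
    qed
    also have "\<dots> \<le> (1 / real L)\<^sup>2" using True by (simp add: power_divide)
    finally have d1: "cmod (ee M t - 1) \<le> 1 / real L"
      by (rule power2_le_imp_le) simp
    have dn: "cmod (ee M (t * int n) - 1) \<le> real n / real L" for n
    proof (induction n)
      case (Suc n)
      have "ee M (t * int (Suc n)) - 1 = ee M t * (ee M (t * int n) - 1) + (ee M t - 1)"
        by (simp add: distrib_left ee_add algebra_simps)
      then have "cmod (ee M (t * int (Suc n)) - 1) \<le> cmod (ee M t * (ee M (t * int n) - 1)) + cmod (ee M t - 1)"
        by (simp only: norm_triangle_ineq)
      also have "\<dots> \<le> real n / real L + 1 / real L"
        using Suc d1 by (simp add: norm_mult)
      finally show ?case by (simp add: add_divide_distrib)
    qed simp
    have "cmod ((\<Sum>n<L. ee M (t * int n)) - of_nat L) = cmod (\<Sum>n<L. ee M (t * int n) - 1)"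
      by (simp add: sum_subtractf)
    also have "\<dots> \<le> (\<Sum>n<L. real n / real L)" by (rule order_trans[OF norm_sum]) (intro sum_mono dn)
    also have "\<dots> = real (\<Sum>n<L. n) / real L" by (simp add: sum_divide_distrib)
    also have "\<dots> \<le> real L / 2"
    proof -
      have "2 * (\<Sum>n<L. n) \<le> L * L" by (induction L) auto
      then have "2 * real (\<Sum>n<L. n) \<le> real L * real L" by (metis of_nat_le_iff of_nat_mult of_nat_numeral)
      then show ?thesis using L by (simp add: field_simps)
    qed
    finally have "cmod ((\<Sum>n<L. ee M (t * int n)) - of_nat L) \<le> real L / 2" .
    moreover have "real L \<le> ?D t + cmod ((\<Sum>n<L. ee M (t * int n)) - of_nat L)"
      using norm_triangle_sub[of "of_nat L :: complex" "\<Sum>n<L. ee M (t * int n)"] by (simp add: norm_minus_commute)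
    ultimately have "real L / 2 \<le> ?D t" by linarith
    then have "(real L / 2)\<^sup>2 \<le> (?D t)\<^sup>2" by (intro power_mono) auto
    then have "1 \<le> 4 / (real L)\<^sup>2 * (?D t)\<^sup>2" using L by (simp add: field_simps power2_eq_square)
    moreover have "exp (- u * (1 - Re (ee M t))) \<le> 1" using u Re_ee_le[of M t] by (simp add: mult_nonneg_nonneg)
    moreover have "0 \<le> 2 * (real L)\<^sup>2 / u" using u by simp
    ultimately show ?thesis by linarith
  next
    case False
    define y where "y = u / (2 * (real L)\<^sup>2)"
    have y: "y > 0" using u L by (simp add: y_def)
    have "exp (- u * (1 - Re (ee M t))) \<le> exp (- y)"
      using False u mult_left_mono[of "1 / (2 * (real L)\<^sup>2)" "1 - Re (ee M t)" u] by (simp add: y_def)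
    also have "\<dots> \<le> 1 / y"
    proof -
      have "y \<le> exp y" using exp_ge_add_one_self[of y] by linarith
      then show ?thesis using y by (simp add: exp_minus field_simps)
    qed
    also have "\<dots> = 2 * (real L)\<^sup>2 / u" by (simp add: y_def)
    finally show ?thesis by (simp add: add_increasing)
  qed
  have "damp M u \<le> mean ?T (\<lambda>t. 4 / (real L)\<^sup>2 * (?D t)\<^sup>2 + 2 * (real L)\<^sup>2 / u)"
    unfolding damp_def by (intro mean_mono pt)
  also have "\<dots> = 4 / (real L)\<^sup>2 * real L + 2 * (real L)\<^sup>2 / u"
    using mean_add[of ?T "\<lambda>t. 4 / (real L)\<^sup>2 * (?D t)\<^sup>2" "\<lambda>_. 2 * (real L)\<^sup>2 / u"]
      mean_cmult[of ?T "4 / (real L)\<^sup>2" "\<lambda>t. (?D t)\<^sup>2"] mean_norm_square_dirichlet[OF M L]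
      mean_const[OF ne, of "2 * (real L)\<^sup>2 / u"] by simp
  also have "\<dots> = 4 / real L + 2 * (real L)\<^sup>2 / u" by (simp add: power2_eq_square)
  finally show ?thesis .
qed

definition trig :: "nat \<Rightarrow> int set \<Rightarrow> (int \<Rightarrow> real) \<Rightarrow> int \<Rightarrow> complex" where
  "trig M V N t = (\<Sum>j\<in>V. complex_of_real (N j) * ee M (t * j))"

lemma norm_trig_square:
  assumes "finite V"
  shows "(cmod (trig M V N t))\<^sup>2 = (\<Sum>i\<in>V. \<Sum>j\<in>V. N i * N j * Re (ee M (t * (i - j))))"
proof -
  have "complex_of_real ((cmod (trig M V N t))\<^sup>2) =
      (\<Sum>i\<in>V. \<Sum>j\<in>V. complex_of_real (N i * N j) * ee M (t * (i - j)))"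
    unfolding complex_norm_square trig_def cnj_sum complex_cnj_mult cnj_ee complex_cnj_complex_of_real sum_product
  proof (intro sum.cong refl)
    fix i j
    have "ee M (t * (i - j)) = ee M (t * i) * ee M (- (t * j))"
      by (simp add: algebra_simps flip: ee_add)
    then show "complex_of_real (N i) * ee M (t * i) * (complex_of_real (N j) * ee M (- (t * j))) =
         complex_of_real (N i * N j) * ee M (t * (i - j))" by simp
  qed
  from arg_cong[OF this, of Re] show ?thesis by simp
qed

text \<open>By Jensen's inequality the off-diagonal phases may be replaced by a single one.\<close>

lemma mean_trig_power_le_damp:
  assumes M: "prime M" and V: "finite V" and N: "\<And>j. j \<in> V \<Longrightarrow> 0 \<le> N j"
    and dist: "\<And>i j. i \<in> V \<Longrightarrow> j \<in> V \<Longrightarrow> i \<noteq> j \<Longrightarrow> \<not> int M dvd i - j"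
    and S: "S = (\<Sum>j\<in>V. N j)" "0 < S"
    and eps: "0 < \<epsilon>" "\<And>j. j \<in> V \<Longrightarrow> N j \<le> (1 - \<epsilon>) * S"
  shows "mean {0..<int M} (\<lambda>t. cmod (trig M V N t) ^ (2 * s)) \<le> S ^ (2 * s) * damp M (real s * \<epsilon>)"
proof -
  let ?T = "{0..<int M}"
  have Mpos: "M > 0" using M by (simp add: prime_gt_0_nat)
  define P where "P = {(i, j). i \<in> V \<and> j \<in> V \<and> i \<noteq> j}"
  have finP: "finite P" by (rule finite_subset[of _ "V \<times> V"]) (auto simp: P_def V)
  define W where "W = (\<lambda>p. N (fst p) * N (snd p))"
  have W0: "0 \<le> W p" if "p \<in> P" for p using that N by (auto simp: W_def P_def)
  define K where "K = sum W P"
  have split: "(\<Sum>i\<in>V. \<Sum>j\<in>V. h i j) = (\<Sum>i\<in>V. h i i) + (\<Sum>p\<in>P. h (fst p) (snd p))" for h :: "int \<Rightarrow> int \<Rightarrow> real"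
  proof -
    have "(\<Sum>i\<in>V. \<Sum>j\<in>V. h i j) = (\<Sum>p\<in>V \<times> V. h (fst p) (snd p))"
      by (simp add: sum.cartesian_product case_prod_unfold)
    also have "V \<times> V = (\<lambda>i. (i, i)) ` V \<union> P" by (auto simp: P_def)
    also have "(\<Sum>p\<in>(\<lambda>i. (i, i)) ` V \<union> P. h (fst p) (snd p)) =
        (\<Sum>p\<in>(\<lambda>i. (i, i)) ` V. h (fst p) (snd p)) + (\<Sum>p\<in>P. h (fst p) (snd p))"
      using V finP by (intro sum.union_disjoint) (auto simp: P_def)
    also have "(\<Sum>p\<in>(\<lambda>i. (i, i)) ` V. h (fst p) (snd p)) = (\<Sum>i\<in>V. h i i)"
      by (subst sum.reindex) (auto simp: inj_on_def)
    finally show ?thesis .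
  qed
  \<comment> \<open>\<open>K\<close> is the off-diagonal mass. No coefficient exceeds (1 -
    \<epsilon>) S, so the diagonal has at most (1 - \<epsilon>) S^2 and at least \<epsilon> S^2 lies
    off it.\<close>
  have SS: "S\<^sup>2 = (\<Sum>i\<in>V. N i * N i) + K"
    using split[of "\<lambda>i j. N i * N j"] unfolding S power2_eq_square sum_product K_def W_def by simp
  have "(\<Sum>i\<in>V. N i * N i) \<le> (\<Sum>i\<in>V. ((1 - \<epsilon>) * S) * N i)"
    using N eps by (intro sum_mono mult_right_mono) auto
  also have "\<dots> = (1 - \<epsilon>) * S\<^sup>2" by (simp add: S power2_eq_square mult.assoc flip: sum_distrib_left)
  finally have K: "\<epsilon> * S\<^sup>2 \<le> K" using SS by (simp add: algebra_simps)
  have Kpos: "0 < K" using K eps S by (smt (verit) mult_pos_pos zero_less_power)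
  define Z where "Z = (\<lambda>p t. 1 - Re (ee M (t * (fst p - snd p))))"
  define u where "u = real s * (K / S\<^sup>2)"
  \<comment> \<open>Use 1 - w \<le> exp (-w), where w is the off-diagonal sum of 1 - cos divided by
    S^2; convexity of exp then takes the average over pairs outside, and each pair of frequencies
    can be treated alone.\<close>
  have pt: "cmod (trig M V N t) ^ (2 * s) \<le> S ^ (2 * s) * (\<Sum>p\<in>P. W p / K * exp (- u * Z p t))" for t
  proof -
    have "(cmod (trig M V N t))\<^sup>2 = (\<Sum>i\<in>V. N i * N i) + (\<Sum>p\<in>P. W p * Re (ee M (t * (fst p - snd p))))"
      unfolding norm_trig_square[OF V] split W_def by simp
    also have "\<dots> = S\<^sup>2 - (\<Sum>p\<in>P. W p * Z p t)"
      using SS by (simp add: K_def Z_def right_diff_distrib sum_subtractf)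
    also have "\<dots> = S\<^sup>2 * (1 + - ((\<Sum>p\<in>P. W p * Z p t) / S\<^sup>2))"
      using S by (simp add: field_simps)
    also have "\<dots> \<le> S\<^sup>2 * exp (- ((\<Sum>p\<in>P. W p * Z p t) / S\<^sup>2))"
      by (intro mult_left_mono exp_ge_add_one_self) auto
    finally have "((cmod (trig M V N t))\<^sup>2) ^ s \<le> (S\<^sup>2 * exp (- ((\<Sum>p\<in>P. W p * Z p t) / S\<^sup>2))) ^ s"
      by (intro power_mono) auto
    then have "cmod (trig M V N t) ^ (2 * s) \<le> S ^ (2 * s) * exp (- ((\<Sum>p\<in>P. W p * Z p t) / S\<^sup>2)) ^ s"
      by (simp only: power_mult power_mult_distrib)
    also have "exp (- ((\<Sum>p\<in>P. W p * Z p t) / S\<^sup>2)) ^ s = exp (\<Sum>p\<in>P. (W p / K) *\<^sub>R (- u * Z p t))"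
    proof -
      have "(\<Sum>p\<in>P. (W p / K) *\<^sub>R (- u * Z p t)) = real s * (- ((\<Sum>p\<in>P. W p * Z p t) / S\<^sup>2))"
        unfolding sum_divide_distrib sum_negf[symmetric] sum_distrib_left
        using Kpos by (intro sum.cong) (auto simp: u_def)
      then show ?thesis by (simp only: exp_of_nat_mult)
    qed
    also have "\<dots> \<le> (\<Sum>p\<in>P. W p / K * exp (- u * Z p t))"
    proof (rule convex_on_sum[OF finP _ exp_convex])
      show "P \<noteq> {}" using Kpos by (auto simp: K_def)
      show "(\<Sum>p\<in>P. W p / K) = 1" using Kpos by (simp add: K_def flip: sum_divide_distrib)
      show "0 \<le> W p / K" if "p \<in> P" for p using W0[OF that] Kpos by simp
    qed auto
    finally show ?thesis using S by (simp add: mult_left_mono)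
  qed
  \<comment> \<open>Distinct frequencies differ by a unit modulo \<open>M\<close>, so after dilation
    every pair has the same mean.\<close>
  have dil: "mean ?T (\<lambda>t. exp (- u * Z p t)) = damp M u" if p: "p \<in> P" for p
  proof -
    have "\<not> int M dvd fst p - snd p" using p dist by (auto simp: P_def)
    then have cop: "coprime (fst p - snd p) (int M)"
      using M prime_imp_coprime[of "int M" "fst p - snd p"] by (simp add: coprime_commute)
    have "ee M (n mod int M) = ee M n" for n
    proof (rule ee_cong_mod[OF Mpos])
      show "int M dvd n mod int M - n" by (metis dvd_minus_mod dvd_minus_iff minus_diff_eq)
    qed
    then show ?thesis
      using sum_dilate[OF Mpos cop, of "\<lambda>n. exp (- u * (1 - Re (ee M n)))"]
      by (simp add: mean_def damp_def Z_def mult.commute)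
  qed
  have "mean ?T (\<lambda>t. cmod (trig M V N t) ^ (2 * s)) \<le>
      mean ?T (\<lambda>t. S ^ (2 * s) * (\<Sum>p\<in>P. W p / K * exp (- u * Z p t)))"
    by (intro mean_mono pt)
  also have "\<dots> = S ^ (2 * s) * (\<Sum>p\<in>P. W p / K * mean ?T (\<lambda>t. exp (- u * Z p t)))"
    unfolding mean_cmult mean_lincomb ..
  also have "(\<Sum>p\<in>P. W p / K * mean ?T (\<lambda>t. exp (- u * Z p t))) = (\<Sum>p\<in>P. W p / K * damp M u)"
    using dil by simp
  also have "\<dots> = damp M u"
    using Kpos by (simp add: K_def flip: sum_divide_distrib sum_distrib_right)
  also have "S ^ (2 * s) * damp M u \<le> S ^ (2 * s) * damp M (real s * \<epsilon>)"
    using S K unfolding u_def by (intro mult_left_mono damp_antimono) (auto simp: field_simps)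
  finally show ?thesis .
qed

text \<open>One dominant coefficient: the linear term of the expansion has mean zero.\<close>

lemma mean_trig_power_dominant:
  assumes M: "M > 0" and V: "finite V" "j0 \<in> V" and N: "\<And>j. j \<in> V \<Longrightarrow> 0 \<le> N j" "0 < N j0"
    and dist: "\<And>j. j \<in> V \<Longrightarrow> j \<noteq> j0 \<Longrightarrow> \<not> int M dvd j - j0"
    and x: "(\<Sum>j\<in>V - {j0}. N j) \<le> x * N j0" "0 \<le> x" "3 * real s * x \<le> 1" "x \<le> 1"
  shows "mean {0..<int M} (\<lambda>t. cmod (trig M V N t) ^ (2 * s)) \<le> N j0 ^ (2 * s) * (1 + 10 * (real s * x)\<^sup>2)"
proof (cases "s = 0")
  case True
  then show ?thesis using M mean_const[of "{0..<int M}" "1::real"] by simp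
next
  case False
  let ?T = "{0..<int M}"
  define z where "z = (\<lambda>t. \<Sum>j\<in>V - {j0}. complex_of_real (N j / N j0) * ee M (t * (j - j0)))"
  have zn: "cmod (z t) \<le> x" for t
  proof -
    have "cmod (z t) \<le> (\<Sum>j\<in>V - {j0}. N j / N j0)"
      unfolding z_def using N
      by (rule_tac order_trans[OF norm_sum]) (auto intro!: sum_mono simp: norm_mult norm_divide)
    also have "\<dots> \<le> x" using x N by (simp add: divide_simps mult.commute flip: sum_divide_distrib)
    finally show ?thesis .
  qed
  have eq: "cmod (trig M V N t) = N j0 * cmod (1 + z t)" for t
  proof -
    have "trig M V N t = complex_of_real (N j0) * ee M (t * j0) + (\<Sum>j\<in>V - {j0}. complex_of_real (N j) * ee M (t * j))"
      unfolding trig_def by (rule sum.remove[OF V])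
    also have "(\<Sum>j\<in>V - {j0}. complex_of_real (N j) * ee M (t * j)) = complex_of_real (N j0) * ee M (t * j0) * z t"
      unfolding z_def sum_distrib_left
    proof (intro sum.cong refl)
      fix j
      have "ee M (t * j) = ee M (t * j0) * ee M (t * (j - j0))"
        by (simp add: algebra_simps flip: ee_add)
      then show "complex_of_real (N j) * ee M (t * j) =
         complex_of_real (N j0) * ee M (t * j0) * (complex_of_real (N j / N j0) * ee M (t * (j - j0)))"
        using N by simp
    qed
    finally have "trig M V N t = complex_of_real (N j0) * ee M (t * j0) * (1 + z t)" by (simp add: algebra_simps)
    then show ?thesis using N by (simp add: norm_mult)
  qed
  have Rez: "mean ?T (\<lambda>t. Re (z t)) = 0"
  proof -
    have "mean ?T z = (\<Sum>j\<in>V - {j0}. complex_of_real (N j / N j0) * mean ?T (\<lambda>t. ee M (t * (j - j0))))"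
      unfolding z_def mean_lincomb ..
    also have "\<dots> = 0" using dist by (intro sum.neutral) (auto simp: mean_ee[OF M])
    finally show ?thesis by (simp flip: Re_mean)
  qed
  \<comment> \<open>The linear term \<open>Re (z t)\<close> is kept with its sign, because it
    averages to 0; everything else is of second order in s x. The condition 3 s x \<le> 1 keeps the
    exponent in the range where exp y \<le> 1 + y + y^2.\<close>
  have pt: "cmod (1 + z t) ^ (2 * s) \<le> 2 * real s * Re (z t) + (1 + 10 * (real s * x)\<^sup>2)" for t
  proof -
    define y where "y = real s * (2 * Re (z t) + (cmod (z t))\<^sup>2)"
    have sq: "(cmod (z t))\<^sup>2 \<le> x\<^sup>2" using zn[of t] by (intro power_mono) auto
    have xx: "x\<^sup>2 \<le> x" using x by (simp add: power2_eq_square mult_left_le)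
    have "\<bar>Re (z t)\<bar> \<le> x" using zn[of t] abs_Re_le_cmod[of "z t"] by linarith
    then have "\<bar>2 * Re (z t) + (cmod (z t))\<^sup>2\<bar> \<le> 3 * x" using sq xx zero_le_power2[of "cmod (z t)"] by linarith
    then have ya: "\<bar>y\<bar> \<le> 3 * real s * x" unfolding y_def abs_mult using mult_left_mono[of _ "3 * x" "real s"] by (simp add: mult.assoc mult.left_commute)
    then have "y\<^sup>2 \<le> (3 * real s * x)\<^sup>2" by (metis abs_ge_zero power2_abs power_mono)
    then have y2: "y\<^sup>2 \<le> 9 * (real s * x)\<^sup>2" by (simp add: power_mult_distrib)
    have "(cmod (1 + z t))\<^sup>2 = 1 + (2 * Re (z t) + (cmod (z t))\<^sup>2)"
      unfolding cmod_power2 by (simp add: power2_eq_square algebra_simps)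
    also have "\<dots> \<le> exp (2 * Re (z t) + (cmod (z t))\<^sup>2)" by (rule exp_ge_add_one_self)
    finally have "((cmod (1 + z t))\<^sup>2) ^ s \<le> exp (2 * Re (z t) + (cmod (z t))\<^sup>2) ^ s"
      by (intro power_mono) auto
    then have "cmod (1 + z t) ^ (2 * s) \<le> exp y"
      by (simp add: power_mult y_def exp_of_nat_mult)
    also have "\<dots> \<le> 1 + y + y\<^sup>2" using ya x by (intro exp_le_quadratic) linarith
    also have "\<dots> \<le> 1 + (2 * real s * Re (z t) + real s * x\<^sup>2) + 9 * (real s * x)\<^sup>2"
      using y2 sq mult_left_mono[OF sq, of "real s"] by (simp add: y_def distrib_left)
    also have "real s * x\<^sup>2 \<le> (real s * x)\<^sup>2"
    proof -
      have "1 * (real s * x\<^sup>2) \<le> real s * (real s * x\<^sup>2)" using False by (intro mult_right_mono) auto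
      then show ?thesis by (simp add: power_mult_distrib power2_eq_square algebra_simps)
    qed
    finally show ?thesis by simp
  qed
  have "mean ?T (\<lambda>t. cmod (trig M V N t) ^ (2 * s)) = N j0 ^ (2 * s) * mean ?T (\<lambda>t. cmod (1 + z t) ^ (2 * s))"
    unfolding eq power_mult_distrib mean_cmult ..
  also have "mean ?T (\<lambda>t. cmod (1 + z t) ^ (2 * s)) \<le> mean ?T (\<lambda>t. 2 * real s * Re (z t) + (1 + 10 * (real s * x)\<^sup>2))"
    by (intro mean_mono pt)
  also have "\<dots> = 1 + 10 * (real s * x)\<^sup>2"
    unfolding mean_add mean_cmult Rez using M mean_const[of ?T "1::real"] mean_const[of ?T "10::real"]
      mean_const[of ?T "(real s * x)\<^sup>2"]
    by (simp add: mean_def)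
  finally show ?thesis using N by (simp add: mult_left_mono)
qed

section \<open>Inequalities governing the split of a set along one valuation\<close>

lemma sum_powr_holder:
  fixes n q :: "'i \<Rightarrow> real"
  assumes V: "finite V" and pos: "\<And>j. j \<in> V \<Longrightarrow> 0 < n j" "\<And>j. j \<in> V \<Longrightarrow> 0 < q j"
    and b: "0 \<le> b" "b \<le> 1"
  shows "(\<Sum>j\<in>V. n j powr (1 - b) * q j powr b) \<le> (\<Sum>j\<in>V. n j) powr (1 - b) * (\<Sum>j\<in>V. q j) powr b"
proof (cases "V = {}")
  case False
  define A where "A = (\<Sum>j\<in>V. n j)"
  define B where "B = (\<Sum>j\<in>V. q j)"
  have A: "A > 0" and B: "B > 0" unfolding A_def B_def using V False pos by (auto intro!: sum_pos)
  have "(\<Sum>j\<in>V. n j powr (1 - b) * q j powr b) =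
      (\<Sum>j\<in>V. A powr (1 - b) * B powr b * ((n j / A) powr (1 - b) * (q j / B) powr b))"
  proof (intro sum.cong refl)
    fix j assume "j \<in> V"
    then have "n j powr (1 - b) = A powr (1 - b) * (n j / A) powr (1 - b)" "q j powr b = B powr b * (q j / B) powr b"
      using pos[of j] A B by (simp_all add: less_imp_le flip: powr_mult)
    then show "n j powr (1 - b) * q j powr b = A powr (1 - b) * B powr b * ((n j / A) powr (1 - b) * (q j / B) powr b)"
      by simp
  qed
  also have "\<dots> \<le> (\<Sum>j\<in>V. A powr (1 - b) * B powr b * ((1 - b) * (n j / A) + b * (q j / B)))"
    using A B pos b by (intro sum_mono mult_left_mono Youngs_inequality_0) auto
  also have "\<dots> = A powr (1 - b) * B powr b * (\<Sum>j\<in>V. (1 - b) * (n j / A) + b * (q j / B))"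
    by (simp only: sum_distrib_left)
  also have "(\<Sum>j\<in>V. (1 - b) * (n j / A) + b * (q j / B)) = (1 - b) * (\<Sum>j\<in>V. n j / A) + b * (\<Sum>j\<in>V. q j / B)"
    by (simp only: sum.distrib sum_distrib_left)
  also have "\<dots> = 1"
    using A B by (simp add: A_def B_def flip: sum_divide_distrib)
  finally show ?thesis by (simp add: A_def B_def)
qed simp

lemma powr_self_le_linear:
  fixes a b :: real
  assumes "0 < a" "0 \<le> b" "b \<le> 1"
  shows "a powr (1 - b) \<le> 1 - (1 - b) * (1 - a)"
  using Youngs_inequality_0[of "1 - b" b a 1] assms by (simp add: algebra_simps)

text \<open>To first order in \<open>b\<close> the left side is b e (1 + ln (l/e)), an entropy term
  of size O(b sqrt (l e)). In the application b = \<alpha>/(2s), so raising to the power 2s turns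
  the excess into O(\<alpha> sqrt (\<mu> e)), which is small as soon as \<open>e\<close> is about
  1/sqrt s.\<close>

lemma entropy_excess_le:
  fixes l e b :: real
  assumes l: "1 \<le> l" and e: "0 < e" "e \<le> 1" and b: "0 \<le> b" "b \<le> 1/4"
  shows "e powr (1 - b) * l powr b - (1 - b) * e \<le> 5 * b * sqrt (l * e)"
proof -
  define y where "y = ln (l / e)"
  have le1: "1 \<le> l / e" using l e by (simp add: field_simps)
  have y0: "0 \<le> y" using le1 by (simp add: y_def)
  have 1: "e powr (1 - b) * l powr b = e * exp (b * y)"
  proof -
    have "exp (b * y) = (l / e) powr b" using l e by (simp add: powr_def y_def)
    also have "\<dots> = l powr b / e powr b" using l e by (simp add: powr_divide)
    finally show ?thesis using e by (simp add: powr_diff)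
  qed
  have 2: "exp (b * y) - 1 \<le> b * y * exp (b * y)"
  proof -
    have "1 + - (b * y) \<le> exp (- (b * y))" by (rule exp_ge_add_one_self)
    then have "(1 - b * y) * exp (b * y) \<le> exp (- (b * y)) * exp (b * y)"
      by (intro mult_right_mono) auto
    then show ?thesis by (simp add: algebra_simps flip: exp_add)
  qed
  have 3: "y * exp (b * y) \<le> 4 * sqrt (l / e)"
  proof -
    have "y / 4 \<le> exp (y / 4)" using exp_ge_add_one_self[of "y / 4"] by linarith
    then have "y \<le> 4 * exp (y / 4)" by simp
    moreover have "exp (b * y) \<le> exp (y / 4)" using b y0 mult_right_mono[of b "1/4" y] by simp
    ultimately have "y * exp (b * y) \<le> 4 * exp (y / 4) * exp (y / 4)"
      using y0 by (intro mult_mono) auto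
    also have "\<dots> = 4 * exp (y / 2)" by (simp flip: exp_add)
    also have "exp (y / 2) = sqrt (l / e)"
    proof -
      have "exp (y / 2) ^ 2 = l / e"
        using le1 by (simp add: y_def power2_eq_square flip: exp_add)
      then show ?thesis by (metis exp_ge_zero real_sqrt_unique)
    qed
    finally show ?thesis .
  qed
  have "e * (y * exp (b * y)) \<le> e * (4 * sqrt (l / e))" using 3 e by (intro mult_left_mono) auto
  also have "\<dots> = 4 * sqrt (l * e)"
    using e l by (simp add: real_sqrt_divide real_sqrt_mult real_div_sqrt field_simps)
  finally have 4: "e * (y * exp (b * y)) \<le> 4 * sqrt (l * e)" .
  have "e \<le> sqrt (l * e)"
  proof (rule real_le_rsqrt)
    show "e\<^sup>2 \<le> l * e" using e l by (simp add: power2_eq_square mult_mono)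
  qed
  then have 5: "b * e \<le> b * sqrt (l * e)" using b by (intro mult_left_mono) auto
  have "e * exp (b * y) - (1 - b) * e = e * (exp (b * y) - 1) + b * e" by (simp add: algebra_simps)
  also have "\<dots> \<le> e * (b * y * exp (b * y)) + b * e" using 2 e by (simp add: mult_left_mono)
  also have "\<dots> = b * (e * (y * exp (b * y))) + b * e" by simp
  also have "\<dots> \<le> b * (4 * sqrt (l * e)) + b * sqrt (l * e)"
    using mult_left_mono[OF 4, of b] 5 b by linarith
  finally show ?thesis unfolding 1 by simp
qed

text \<open>\<mu> is the price of one query, \<alpha> the power of the structure weight that enters
  the energy bound. \<open>small\<close> serves splittings in which the relative mass off the
  heaviest fibre is at most 1/sqrt s, \<open>big\<close> those with more. In 2400 = 5 * 2 * 240 the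
  5 is the constant of the entropy bound and 1/240 the saving of \<open>damp\<close>; 12 = 4 + 8
  comes from the decay of \<open>damp\<close>.\<close>

locale tree_params =
  fixes s :: nat and \<alpha> \<mu> :: real
  assumes s: "s \<ge> 1" and alpha: "0 < \<alpha>" and lam: "1 \<le> \<mu>"
    and small: "2400 * \<alpha> * sqrt \<mu> \<le> real s powr (1/4)"
    and big: "12 * \<mu> powr \<alpha> \<le> real s powr (1/6)"
begin

text \<open>The exponent \<alpha> spread evenly over the 2s factors of the energy.\<close>

definition \<beta> :: real where "\<beta> = \<alpha> / (2 * real s)"

lemma s_powr: "real s powr (1/4) \<le> sqrt (real s)"
  using s by (simp add: powr_half_sqrt[symmetric] powr_mono)

lemma alpha_le: "2400 * \<alpha> * sqrt \<mu> \<le> sqrt (real s)"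
  using small s_powr by linarith

lemma alpha_le': "2400 * \<alpha> \<le> sqrt (real s)"
proof -
  have "\<alpha> * 1 \<le> \<alpha> * sqrt \<mu>" using alpha lam by (intro mult_left_mono) auto
  then show ?thesis using alpha_le by linarith
qed

lemma sqrt_s_le: "sqrt (real s) \<le> real s"
proof (rule real_le_lsqrt)
  show "real s \<le> (real s)\<^sup>2" using s by (simp add: power2_eq_square)
qed auto

lemma beta: "0 < \<beta>" "\<beta> \<le> 1/4" "\<beta> < 1"
proof -
  show "0 < \<beta>" using alpha s by (simp add: \<beta>_def)
  have "2400 * \<alpha> \<le> real s" using alpha_le' sqrt_s_le by linarith
  then have "2 * \<alpha> \<le> real s" using alpha by linarith
  then show "\<beta> \<le> 1/4" using s by (simp add: \<beta>_def field_simps)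
  then show "\<beta> < 1" by simp
qed

lemma two_s_beta: "2 * real s * \<beta> = \<alpha>"
  using s by (simp add: \<beta>_def)

text \<open>The exponent 2 \<beta> is \<alpha>/s, small enough to absorb ln z \<le> 2 sqrt z at z =
  90 \<mu> s. The number 1/(90 s) is the light mass at which the dominant case changes its
  argument.\<close>

lemma powr_le_two: "(90 * \<mu> * real s) powr (2 * \<beta>) \<le> 2"
proof -
  define z where "z = 90 * \<mu> * real s"
  have "1 * 1 \<le> \<mu> * real s" using lam s by (intro mult_mono) auto
  then have z: "z \<ge> 1" by (simp add: z_def)
  have sz: "sqrt z \<le> 10 * sqrt \<mu> * sqrt (real s)"
  proof -
    have "sqrt 90 \<le> 10" by (rule real_le_lsqrt) auto
    then have "sqrt 90 * (sqrt \<mu> * sqrt (real s)) \<le> 10 * (sqrt \<mu> * sqrt (real s))"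
      using lam by (intro mult_right_mono) auto
    then show ?thesis by (simp add: z_def real_sqrt_mult mult.assoc)
  qed
  have "ln z = 2 * ln (sqrt z)" using z by (simp add: ln_sqrt)
  also have "\<dots> \<le> 2 * sqrt z" using z ln_le_minus_one[of "sqrt z"] by simp
  finally have "2 * \<beta> * ln z \<le> 2 * \<beta> * (2 * sqrt z)" using beta by (intro mult_left_mono) auto
  also have "\<dots> = 2 * \<alpha> * sqrt z / real s" using s by (simp add: \<beta>_def)
  also have "\<dots> \<le> 2 * \<alpha> * (10 * sqrt \<mu> * sqrt (real s)) / real s"
    using alpha sz by (intro divide_right_mono mult_left_mono) auto
  also have "\<dots> = (20 * \<alpha> * sqrt \<mu>) * (sqrt (real s) / real s)" by simp
  also have "\<dots> \<le> (sqrt (real s) / 120) * (sqrt (real s) / real s)"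
    using alpha_le by (intro mult_right_mono) auto
  also have "\<dots> = 1 / 120" using s by (simp add: field_simps)
  finally have "2 * \<beta> * ln z \<le> 1/2" by simp
  then have "exp (2 * \<beta> * ln z) \<le> exp (1/2)" by simp
  also have "exp (1/2 :: real) \<le> 2" using exp_bound[of "1/2::real"] by (simp add: power2_eq_square)
  finally show ?thesis using z by (simp add: powr_def z_def)
qed

lemma lam_powr_beta: "\<mu> powr (2 * \<beta>) \<le> 2" "\<mu> powr \<beta> \<le> 2"
proof -
  have "\<mu> * 1 \<le> \<mu> * (90 * real s)" using lam s by (intro mult_left_mono) auto
  then have "\<mu> \<le> 90 * \<mu> * real s" by simp
  then have "\<mu> powr (2 * \<beta>) \<le> (90 * \<mu> * real s) powr (2 * \<beta>)"
    using lam beta by (intro powr_mono2) auto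
  then show a: "\<mu> powr (2 * \<beta>) \<le> 2" using powr_le_two by linarith
  have "\<mu> powr \<beta> \<le> \<mu> powr (2 * \<beta>)" using lam beta by (intro powr_mono) auto
  then show "\<mu> powr \<beta> \<le> 2" using a by linarith
qed

text \<open>The one-query inequality, normalised so that fibre sizes sum to 1 and weights are at
  most 1. If the heaviest coefficient outweighs the rest by a factor 30 s, the other terms enter
  only to second order, and the shortfall e of the heaviest fibre pays for them. Otherwise the
  phases oscillate: for relative light mass at most 1/sqrt s the constant saving 1/240 beats the
  small excess of the total over 1, and beyond that the saving s^(-1/6) beats
  \<mu>^\<alpha>.\<close>

lemma mean_trig_le_one:
  assumes M: "prime M" "M \<ge> s" "M \<ge> 3" and V: "finite V" "V \<noteq> {}"
    and dist: "\<And>i j. i \<in> V \<Longrightarrow> j \<in> V \<Longrightarrow> i \<noteq> j \<Longrightarrow> \<not> int M dvd i - j"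
    and pos: "\<And>j. j \<in> V \<Longrightarrow> 0 < n j" "\<And>j. j \<in> V \<Longrightarrow> 0 < q j"
    and n: "(\<Sum>j\<in>V. n j) = 1" and q: "\<And>j. j \<in> V \<Longrightarrow> q j \<le> 1" "(\<Sum>j\<in>V. q j) \<le> \<mu>"
    and N: "\<And>j. j \<in> V \<Longrightarrow> 0 \<le> N j" "\<And>j. j \<in> V \<Longrightarrow> N j \<le> n j powr (1 - \<beta>) * q j powr \<beta>"
  shows "mean {0..<int M} (\<lambda>t. cmod (trig M V N t) ^ (2 * s)) \<le> 1"
proof -
  let ?W = "mean {0..<int M} (\<lambda>t. cmod (trig M V N t) ^ (2 * s))"
  let ?s = "real s"
  have Mpos: "M > 0" using M by simp
  have spos: "?s \<ge> 1" using s by simp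
  obtain j0 where j0: "j0 \<in> V" "\<And>i. i \<in> V \<Longrightarrow> N i \<le> N j0"
    using Max_in[of "N ` V"] V Max_ge[of "N ` V"] by (metis (no_types, lifting) finite_imageI imageE imageI image_is_empty)
  define T where "T = (\<Sum>j\<in>V - {j0}. N j)"
  define e where "e = (\<Sum>j\<in>V - {j0}. n j)"
  have n0: "n j0 = 1 - e" using n sum.remove[OF V(1) j0(1), of n] by (simp add: e_def)
  have e0: "0 \<le> e" unfolding e_def using pos by (intro sum_nonneg) (auto simp: less_imp_le)
  have e1: "e < 1" using n0 pos(1)[OF j0(1)] by simp
  have T0: "0 \<le> T" unfolding T_def using N by (intro sum_nonneg) auto
  have T_le: "T \<le> e powr (1 - \<beta>) * \<mu> powr \<beta>"
  proof -
    have "T \<le> (\<Sum>j\<in>V - {j0}. n j powr (1 - \<beta>) * q j powr \<beta>)"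
      unfolding T_def using N by (intro sum_mono) auto
    also have "\<dots> \<le> e powr (1 - \<beta>) * (\<Sum>j\<in>V - {j0}. q j) powr \<beta>"
      unfolding e_def using V pos beta by (intro sum_powr_holder) auto
    also have "\<dots> \<le> e powr (1 - \<beta>) * \<mu> powr \<beta>"
    proof (intro mult_left_mono powr_mono2)
      have "(\<Sum>j\<in>V - {j0}. q j) \<le> (\<Sum>j\<in>V. q j)"
        using V pos by (intro sum_mono2) (auto simp: less_imp_le)
      then show "(\<Sum>j\<in>V - {j0}. q j) \<le> \<mu>" using q by linarith
      show "0 \<le> (\<Sum>j\<in>V - {j0}. q j)" using pos by (intro sum_nonneg) (auto simp: less_imp_le)
    qed (use beta in auto)
    finally show ?thesis .
  qed
  define Nb where "Nb = n j0 powr (1 - \<beta>)"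
  have N0_le: "N j0 \<le> Nb"
  proof -
    have "q j0 powr \<beta> \<le> 1" using q(1)[OF j0(1)] pos(2)[OF j0(1)] beta by (simp add: powr_le1)
    then have "n j0 powr (1 - \<beta>) * q j0 powr \<beta> \<le> n j0 powr (1 - \<beta>) * 1" by (intro mult_left_mono) auto
    then show ?thesis using N(2)[OF j0(1)] by (simp add: Nb_def)
  qed
  have Nb_pos: "0 < Nb" using pos(1)[OF j0(1)] by (simp add: Nb_def)
  define S where "S = N j0 + T"
  have S_sum: "S = (\<Sum>j\<in>V. N j)" unfolding S_def T_def by (rule sum.remove[OF V(1) j0(1), symmetric])
  show ?thesis
  proof (cases "N j0 = 0")
    case True
    then have "N j = 0" if "j \<in> V" for j using j0(2)[OF that] N(1)[OF that] by simp
    then have "trig M V N t = 0" for t by (simp add: trig_def)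
    then show ?thesis using s by (simp add: mean_def zero_power)
  next
    case False
    then have N0: "0 < N j0" using N(1)[OF j0(1)] by simp
    have S0: "0 < S" using N0 T0 by (simp add: S_def)
    show ?thesis
    proof (cases "30 * ?s * T \<le> N j0")
      case True
      define x where "x = T / N j0"
      have x0: "0 \<le> x" using T0 N0 by (simp add: x_def)
      have xs: "30 * ?s * x \<le> 1" using True N0 by (simp add: x_def field_simps)
      have x1: "x \<le> 1" using xs spos x0 by (smt (verit) mult_le_cancel_right1 mult.assoc mult_nonneg_nonneg)
      have "?W \<le> N j0 ^ (2 * s) * (1 + 10 * (?s * x)\<^sup>2)"
        using V j0 N N0 dist xs x0 x1 Mpos
        by (intro mean_trig_power_dominant) (auto simp: x_def T_def mult.assoc)
      also have "\<dots> = N j0 ^ (2 * s - 2) * ((N j0)\<^sup>2 + 10 * ?s\<^sup>2 * T\<^sup>2)"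
      proof -
        have "2 * s = (2 * s - 2) + 2" using s by simp
        then have "N j0 ^ (2 * s) = N j0 ^ (2 * s - 2) * (N j0)\<^sup>2"
          by (metis power_add)
        then show ?thesis using N0 by (simp add: x_def power_mult_distrib power_divide distrib_left mult.assoc)
      qed
      also have "\<dots> \<le> Nb ^ (2 * s - 2) * (Nb\<^sup>2 + 10 * ?s\<^sup>2 * T\<^sup>2)"
        using N0 N0_le by (intro mult_mono power_mono add_right_mono) auto
      also have "\<dots> = Nb ^ (2 * s) * (1 + 10 * ?s\<^sup>2 * (T / Nb)\<^sup>2)"
      proof -
        have "2 * s = (2 * s - 2) + 2" using s by simp
        then have "Nb ^ (2 * s) = Nb ^ (2 * s - 2) * Nb\<^sup>2"
          by (metis power_add)
        then show ?thesis using Nb_pos by (simp add: power_divide distrib_left mult.assoc)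
      qed
      finally have W1: "?W \<le> Nb ^ (2 * s) * (1 + 10 * ?s\<^sup>2 * (T / Nb)\<^sup>2)" .
      have xb: "T / Nb \<le> x" using N0 N0_le T0 Nb_pos by (simp add: x_def frac_le)
      have xb0: "0 \<le> T / Nb" using T0 Nb_pos by simp
      \<comment> \<open>With x = T / Nb this says that the second-order gain 10 (s x)^2 is at most s
        e, the exponent lost through \<open>n j0 = 1 - e\<close>. For e \<ge> 1/(90 s) it follows
        from x \<le> 1/(30 s); for smaller e the mass \<open>T\<close> is itself small in terms of
        e.\<close>
      have key: "10 * ?s * (T / Nb)\<^sup>2 \<le> e"
      proof (cases "1 / (90 * ?s) \<le> e")
        case True
        have "x \<le> 1 / (30 * ?s)" using xs spos by (simp add: field_simps)
        then have "T / Nb \<le> 1 / (30 * ?s)" using xb by linarith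
        then have "(T / Nb)\<^sup>2 \<le> (1 / (30 * ?s))\<^sup>2" using xb0 by (intro power_mono) auto
        then have "10 * ?s * (T / Nb)\<^sup>2 \<le> 10 * ?s * (1 / (30 * ?s))\<^sup>2" by (intro mult_left_mono) auto
        also have "\<dots> = 1 / (90 * ?s)" using spos by (simp add: power2_eq_square field_simps)
        finally show ?thesis using True by linarith
      next
        case False
        show ?thesis
        proof (cases "e = 0")
          case True
          then show ?thesis using T_le T0 by simp
        next
          case e_ne: False
          then have epos: "0 < e" using e0 by simp
          have "e < 1 / (90 * ?s)" using False by simp
          also have "\<dots> \<le> 1/2" using spos by (simp add: field_simps)
          finally have eh: "e \<le> 1/2" by simp
          have "(1 - e) powr 1 \<le> (1 - e) powr (1 - \<beta>)" using eh e0 beta by (intro powr_mono') auto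
          then have "1/2 \<le> Nb" using eh by (simp add: Nb_def n0)
          then have "T / Nb \<le> T / (1/2)" using T0 by (intro divide_left_mono) auto
          then have "T / Nb \<le> 2 * (e powr (1 - \<beta>) * \<mu> powr \<beta>)" using T_le by simp
          then have "(T / Nb)\<^sup>2 \<le> (2 * (e powr (1 - \<beta>) * \<mu> powr \<beta>))\<^sup>2" using xb0 by (intro power_mono) auto
          also have "\<dots> = 4 * e * (e powr (1 - 2 * \<beta>) * \<mu> powr (2 * \<beta>))"
          proof -
            have "e powr (1 - \<beta>) * e powr (1 - \<beta>) = e powr (1 + (1 - 2 * \<beta>))" by (simp flip: powr_add)
            also have "\<dots> = e * e powr (1 - 2 * \<beta>)" using epos by (simp only: powr_add) simp
            finally have a: "e powr (1 - \<beta>) * e powr (1 - \<beta>) = e * e powr (1 - 2 * \<beta>)" .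
            have b: "\<mu> powr \<beta> * \<mu> powr \<beta> = \<mu> powr (2 * \<beta>)" by (simp flip: powr_add)
            have "(2 * (e powr (1 - \<beta>) * \<mu> powr \<beta>))\<^sup>2 = 4 * (e powr (1 - \<beta>) * e powr (1 - \<beta>)) * (\<mu> powr \<beta> * \<mu> powr \<beta>)"
              by (simp add: power2_eq_square)
            then show ?thesis unfolding a b by simp
          qed
          also have "e powr (1 - 2 * \<beta>) * \<mu> powr (2 * \<beta>) \<le> 2 / (90 * ?s)"
          proof -
            have "e powr (1 - 2 * \<beta>) \<le> (1 / (90 * ?s)) powr (1 - 2 * \<beta>)"
              using False epos beta by (intro powr_mono2) auto
            also have "\<dots> = (1 / (90 * ?s)) * (90 * ?s) powr (2 * \<beta>)"
              using spos by (simp add: powr_diff powr_divide)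
            finally have "e powr (1 - 2 * \<beta>) * \<mu> powr (2 * \<beta>) \<le> (1 / (90 * ?s)) * (90 * ?s) powr (2 * \<beta>) * \<mu> powr (2 * \<beta>)"
              by (intro mult_right_mono) auto
            also have "\<dots> = (1 / (90 * ?s)) * (90 * \<mu> * ?s) powr (2 * \<beta>)"
              using spos lam by (simp add: powr_mult)
            also have "\<dots> \<le> (1 / (90 * ?s)) * 2" using powr_le_two spos by (intro mult_left_mono) auto
            finally show ?thesis by simp
          qed
          finally have "(T / Nb)\<^sup>2 \<le> 4 * e * (2 / (90 * ?s))" using epos by simp
          then have "10 * ?s * (T / Nb)\<^sup>2 \<le> 10 * ?s * (4 * e * (2 / (90 * ?s)))"
            by (intro mult_left_mono) auto
          also have "\<dots> = 8 / 9 * e" using spos by simp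
          finally show ?thesis using epos by simp
        qed
      qed
      have "Nb ^ (2 * s) = (1 - e) powr ((1 - \<beta>) * real (2 * s))"
        using e1 by (simp add: Nb_def n0 powr_powr flip: powr_realpow)
      also have "\<dots> \<le> exp (- e) powr ((1 - \<beta>) * real (2 * s))"
        using e1 e0 beta exp_ge_add_one_self[of "- e"] by (intro powr_mono2) auto
      also have "\<dots> \<le> exp (- e * ?s)"
      proof -
        have "?s * 1 \<le> ?s * (2 * (1 - \<beta>))" using beta spos by (intro mult_left_mono) auto
        then have "e * ?s \<le> e * ((1 - \<beta>) * real (2 * s))" using e0 by (intro mult_left_mono) (auto simp: algebra_simps)
        then show ?thesis by (simp add: powr_def mult.commute)
      qed
      finally have "Nb ^ (2 * s) \<le> exp (- e * ?s)" .
      moreover have "1 + 10 * ?s\<^sup>2 * (T / Nb)\<^sup>2 \<le> exp (e * ?s)"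
      proof -
        have "10 * ?s\<^sup>2 * (T / Nb)\<^sup>2 = ?s * (10 * ?s * (T / Nb)\<^sup>2)" by (simp add: power2_eq_square)
        also have "\<dots> \<le> ?s * e" using key by (intro mult_left_mono) auto
        finally show ?thesis using exp_ge_add_one_self[of "e * ?s"] by (simp only: mult.commute[of e])
      qed
      ultimately have "Nb ^ (2 * s) * (1 + 10 * ?s\<^sup>2 * (T / Nb)\<^sup>2) \<le> exp (- e * ?s) * exp (e * ?s)"
        using Nb_pos by (intro mult_mono) auto
      then show ?thesis using W1 by (simp flip: exp_add)
    next
      case False
      then have Tpos: "0 < T" using N0 spos by (smt (verit) mult_nonneg_nonpos mult_nonneg_nonneg T0)
      define \<epsilon> where "\<epsilon> = T / S"
      have eps: "0 < \<epsilon>" using Tpos S0 by (simp add: \<epsilon>_def)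
      have "N j0 = (1 - \<epsilon>) * S" using S0 by (simp add: \<epsilon>_def S_def field_simps)
      then have W2: "?W \<le> S ^ (2 * s) * damp M (?s * \<epsilon>)"
        using V N dist M(1) S_sum S0 eps j0 by (intro mean_trig_power_le_damp) auto
      have S_le: "S \<le> \<mu> powr \<beta>"
      proof -
        have "S \<le> (\<Sum>j\<in>V. n j powr (1 - \<beta>) * q j powr \<beta>)"
          unfolding S_sum using N by (intro sum_mono) auto
        also have "\<dots> \<le> (\<Sum>j\<in>V. n j) powr (1 - \<beta>) * (\<Sum>j\<in>V. q j) powr \<beta>"
          using V pos beta by (intro sum_powr_holder) auto
        also have "\<dots> = (\<Sum>j\<in>V. q j) powr \<beta>" by (simp add: n)
        also have "\<dots> \<le> \<mu> powr \<beta>"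
          using q beta pos by (intro powr_mono2 sum_nonneg) (auto simp: less_imp_le)
        finally show ?thesis .
      qed
      have damp0: "0 \<le> damp M u" for u unfolding damp_def by (intro mean_nonneg) auto
      show ?thesis
      proof (cases "\<epsilon> * sqrt ?s \<le> 1")
        case True
        \<comment> \<open>Failure of dominance, 30 s T > N j0, gives S \<le> 60 s T. With a = 1/60
          the damping factor is then at most 1 - 1/240.\<close>
        have "1 / 60 \<le> ?s * \<epsilon>"
        proof (cases "T \<le> N j0")
          case True
          have "S \<le> 2 * N j0" using True by (simp add: S_def)
          also have "\<dots> \<le> 60 * ?s * T" using False by linarith
          finally show ?thesis using S0 by (simp add: \<epsilon>_def field_simps)
        next
          case False
          then have "S \<le> 2 * T" by (simp add: S_def)
          also have "\<dots> \<le> 60 * ?s * T" using spos Tpos by (intro mult_right_mono) auto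
          finally show ?thesis using S0 by (simp add: \<epsilon>_def field_simps)
        qed
        then have dmp: "damp M (?s * \<epsilon>) \<le> 1 - 1 / 240"
          using damp_le_small[OF M(3), of "1/60" "?s * \<epsilon>"] by simp
        have "S ^ (2 * s) \<le> exp (1 / 240)"
        proof (cases "S \<le> 1")
          case True
          then have "S ^ (2 * s) \<le> 1" using S0 by (simp add: power_le_one)
          then show ?thesis using exp_ge_add_one_self[of "1/240::real"] by linarith
        next
          case S1: False
          have "T = \<epsilon> * S" using S0 by (simp add: \<epsilon>_def)
          then have "T * sqrt ?s = (\<epsilon> * sqrt ?s) * S" by simp
          also have "\<dots> \<le> 1 * S" using True S0 by (intro mult_right_mono) auto
          finally have "T * sqrt ?s \<le> 2" using S_le lam_powr_beta by linarith
          have N0b: "N j0 \<le> 1 - (1 - \<beta>) * e"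
            using N0_le powr_self_le_linear[of "n j0" \<beta>] pos(1)[OF j0(1)] beta by (simp add: Nb_def n0)
          then have "(1 - \<beta>) * e < T" using S1 by (simp add: S_def)
          then have "e \<le> 2 * T" using beta e0 mult_right_mono[of "1/2" "1 - \<beta>" e] by linarith
          then have "e * sqrt ?s \<le> 2 * T * sqrt ?s" by (intro mult_right_mono) auto
          then have es: "e * sqrt ?s \<le> 4" using \<open>T * sqrt ?s \<le> 2\<close> by linarith
          have epos: "0 < e" using T_le Tpos e0 by (cases "e = 0") auto
          have "S - 1 \<le> e powr (1 - \<beta>) * \<mu> powr \<beta> - (1 - \<beta>) * e"
            using N0b T_le by (simp add: S_def)
          also have "\<dots> \<le> 5 * \<beta> * sqrt (\<mu> * e)"
            using lam epos e1 beta by (intro entropy_excess_le) auto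
          finally have S1b: "S - 1 \<le> 5 * \<beta> * sqrt (\<mu> * e)" .
          have "S ^ (2 * s) \<le> exp (S - 1) ^ (2 * s)"
            using S0 exp_ge_add_one_self[of "S - 1"] by (intro power_mono) auto
          also have "\<dots> = exp (real (2 * s) * (S - 1))" by (simp only: exp_of_nat_mult)
          also have "\<dots> \<le> exp (1 / 240)"
          proof -
            have "real (2 * s) * (S - 1) \<le> real (2 * s) * (5 * \<beta> * sqrt (\<mu> * e))"
              using S1b by (intro mult_left_mono) auto
            also have "\<dots> = 5 * \<alpha> * sqrt \<mu> * sqrt e"
              using two_s_beta by (simp add: real_sqrt_mult)
            also have "sqrt e \<le> 2 / ?s powr (1/4)"
            proof (rule real_le_lsqrt)
              have "(?s powr (1/4))\<^sup>2 = sqrt ?s"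
                using spos by (simp add: power2_eq_square powr_half_sqrt flip: powr_add)
              then have "(2 / ?s powr (1/4))\<^sup>2 = 4 / sqrt ?s" by (simp add: power_divide)
              then show "e \<le> (2 / ?s powr (1/4))\<^sup>2" using es spos by (simp add: field_simps)
            qed (use spos in auto)
            then have "5 * \<alpha> * sqrt \<mu> * sqrt e \<le> 5 * \<alpha> * sqrt \<mu> * (2 / ?s powr (1/4))"
              using alpha lam by (intro mult_left_mono) auto
            also have "\<dots> \<le> 1 / 240" using small spos by (simp add: field_simps)
            finally show ?thesis by simp
          qed
          finally show ?thesis .
        qed
        then have "S ^ (2 * s) * damp M (?s * \<epsilon>) \<le> exp (1 / 240) * (1 - 1 / 240)"
          using dmp damp0 S0 by (intro mult_mono) auto
        also have "\<dots> \<le> exp (1 / 240) * exp (- (1 / 240))"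
          using exp_ge_add_one_self[of "- (1/240)::real"] by (intro mult_left_mono) auto
        also have "\<dots> = 1" by (simp flip: exp_add)
        finally show ?thesis using W2 by linarith
      next
        case False
        \<comment> \<open>The length s^(1/6) balances 4/L against 2 L^2/sqrt s; together they are at
          most 12 s^(-1/6).\<close>
        define L where "L = nat \<lceil>?s powr (1/6)\<rceil>"
        have p1: "1 \<le> ?s powr (1/6)" using spos by (simp add: ge_one_powr_ge_zero)
        have L1: "?s powr (1/6) \<le> real L" unfolding L_def by linarith
        have L2: "real L \<le> 2 * ?s powr (1/6)" unfolding L_def using p1 by linarith
        have Lge: "L \<ge> 1" using L1 p1 by (metis of_nat_1 of_nat_le_iff order_trans)
        have "?s powr (1/6) \<le> ?s powr 1" using spos by (intro powr_mono) auto
        then have "L \<le> s" unfolding L_def using spos by (simp add: nat_le_iff ceiling_le_iff)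
        then have M_ge_L: "M \<ge> L" using M by simp
        have "sqrt ?s \<le> ?s * \<epsilon>"
        proof -
          have "sqrt ?s * 1 \<le> sqrt ?s * (\<epsilon> * sqrt ?s)" using False by (intro mult_left_mono) auto
          then show ?thesis by (simp add: mult.commute mult.left_commute)
        qed
        then have "damp M (?s * \<epsilon>) \<le> damp M (sqrt ?s)" by (rule damp_antimono)
        also have "\<dots> \<le> 4 / real L + 2 * (real L)\<^sup>2 / sqrt ?s"
          using spos by (intro damp_le_large[OF M_ge_L Lge]) auto
        also have "\<dots> \<le> 4 / ?s powr (1/6) + 8 / ?s powr (1/6)"
        proof (intro add_mono)
          show "4 / real L \<le> 4 / ?s powr (1/6)" using L1 p1 by (intro divide_left_mono mult_pos_pos) linarith+
          have "2 * (real L)\<^sup>2 / sqrt ?s \<le> 2 * (2 * ?s powr (1/6))\<^sup>2 / sqrt ?s"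
            using L2 by (intro divide_right_mono mult_left_mono power_mono) auto
          also have "\<dots> = 8 * (?s powr (1/3) / ?s powr (1/2))"
            using spos by (simp add: power_mult_distrib powr_half_sqrt power2_eq_square flip: powr_add)
          also have "?s powr (1/3) / ?s powr (1/2) = 1 / ?s powr (1/6)"
            using spos by (simp add: powr_minus_divide flip: powr_diff)
          finally show "2 * (real L)\<^sup>2 / sqrt ?s \<le> 8 / ?s powr (1/6)" by simp
        qed
        finally have d: "damp M (?s * \<epsilon>) \<le> 12 / ?s powr (1/6)" by simp
        have "S ^ (2 * s) \<le> (\<mu> powr \<beta>) ^ (2 * s)" using S_le S0 by (intro power_mono) auto
        also have "\<dots> = \<mu> powr \<alpha>"
          using lam two_s_beta by (simp add: powr_powr mult.commute mult.left_commute flip: powr_realpow)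
        finally have "S ^ (2 * s) * damp M (?s * \<epsilon>) \<le> \<mu> powr \<alpha> * (12 / ?s powr (1/6))"
          using d damp0 by (intro mult_mono) auto
        also have "\<dots> \<le> 1"
        proof -
          have "0 < ?s powr (1/6)" using p1 by linarith
          then show ?thesis using big by (simp add: field_simps)
        qed
        finally show ?thesis using W2 by linarith
      qed
    qed
  qed
qed

end

section \<open>Structured subsets of sets with large energy\<close>

lemma trig_scale: "trig M V (\<lambda>j. c * N j) t = complex_of_real c * trig M V N t"
  by (simp add: trig_def sum_distrib_left mult.assoc)

lemma norm_trig_power:
  assumes "finite V"
  shows "complex_of_real (cmod (trig M V N t) ^ (2 * s)) =
    (\<Prod>i<2 * s. \<Sum>j\<in>V. complex_of_real (N j) * ee M (sgn2 s i * (t * j)))"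
proof -
  have "(\<Sum>j\<in>V. complex_of_real (N j) * ee M ((- 1) * (t * j))) = cnj (trig M V N t)"
    by (simp add: trig_def cnj_ee)
  moreover have "(\<Sum>j\<in>V. complex_of_real (N j) * ee M (1 * (t * j))) = trig M V N t"
    by (simp add: trig_def)
  ultimately have "(\<Prod>i<2 * s. \<Sum>j\<in>V. complex_of_real (N j) * ee M (sgn2 s i * (t * j))) =
      (trig M V N t * cnj (trig M V N t)) ^ s"
    using prod_sgn2[where F = "\<lambda>c. \<Sum>j\<in>V. complex_of_real (N j) * ee M (c * (t * j))" and k = s]
    by (simp only: power_mult_distrib)
  then show ?thesis by (simp only: power_mult complex_norm_square[symmetric] of_real_power)
qed

text \<open>Expand the moment; the terms whose frequencies sum to zero only modulo \<open>M\<close>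
  are nonnegative and may be dropped.\<close>

lemma mean_trig_power_ge:
  assumes M: "M > 0" and V: "finite V" and N: "\<And>j. j \<in> V \<Longrightarrow> 0 \<le> N j"
  shows "(\<Sum>j\<in>{j \<in> PiE {..<2 * s} (\<lambda>_. V). (\<Sum>i<2 * s. sgn2 s i * j i) = 0}. \<Prod>i<2 * s. N (j i))
    \<le> mean {0..<int M} (\<lambda>t. cmod (trig M V N t) ^ (2 * s))"
proof -
  define R where "R = {j \<in> PiE {..<2 * s} (\<lambda>_. V). int M dvd (\<Sum>i<2 * s. sgn2 s i * j i)}"
  have "complex_of_real (mean {0..<int M} (\<lambda>t. cmod (trig M V N t) ^ (2 * s))) =
      mean (grid M) (\<lambda>z. complex_of_real (cmod (trig M V N (fst z)) ^ (2 * s)))"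
    unfolding of_real_mean
    using mean_grid_fst[OF M, of "\<lambda>t. complex_of_real (cmod (trig M V N t) ^ (2 * s))"] by simp
  also have "\<dots> = mean (grid M) (\<lambda>z. \<Prod>i<2 * s. \<Sum>j\<in>V. complex_of_real (N j) * ee M (sgn2 s i * (fst z * j + snd z * 0)))"
    unfolding norm_trig_power[OF V] by simp
  also have "\<dots> = (\<Sum>j\<in>R. \<Prod>i<2 * s. complex_of_real (N (j i)))"
    using mean_prod_eq_relation_sum[OF M finite_lessThan[of "2 * s"], where B = "\<lambda>_. V"
        and w = "\<lambda>_ j. complex_of_real (N j)" and c = "sgn2 s" and f = "\<lambda>j. j" and g = "\<lambda>_. 0"] V
    by (simp add: R_def)
  also have "\<dots> = complex_of_real (\<Sum>j\<in>R. \<Prod>i<2 * s. N (j i))" by simp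
  finally have eq: "mean {0..<int M} (\<lambda>t. cmod (trig M V N t) ^ (2 * s)) = (\<Sum>j\<in>R. \<Prod>i<2 * s. N (j i))"
    by (simp only: of_real_eq_iff)
  have finR: "finite R"
    by (rule finite_subset[of _ "PiE {..<2 * s} (\<lambda>_. V)"]) (auto simp: R_def intro!: finite_PiE V)
  show ?thesis
    unfolding eq using finR N
    by (intro sum_mono2) (auto simp: R_def intro!: prod_nonneg)
qed

text \<open>Relations of \<open>f\<close> are sorted by the labels \<open>v (x i)\<close>, which
  satisfy the same signed equation, and each sort is counted by Hoelder. What results is a moment of
  a one-dimensional trigonometric sum whose coefficients are the norms of the fibres.\<close>

lemma energy_fibre_le:
  assumes M: "M > 0" and B: "finite B" and s: "s \<ge> 1"
    and v: "\<And>x. x \<in> relations M {..<2 * s} (sgn2 s) f (\<lambda>_. 0) (\<lambda>_. B) \<Longrightarrow> (\<Sum>i<2 * s. sgn2 s i * v (x i)) = 0"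
  shows "energy (2 * s) M f (\<lambda>_. 0) B \<le>
    mean {0..<int M} (\<lambda>t. cmod (trig M (v ` B) (\<lambda>j. nrm (2 * s) M f (\<lambda>_. 0) {x \<in> B. v x = j}) t) ^ (2 * s))"
proof -
  let ?I = "{..<2 * s}"
  define J where "J = {j \<in> PiE ?I (\<lambda>_. v ` B). (\<Sum>i<2 * s. sgn2 s i * j i) = 0}"
  define R where "R = (\<lambda>j. relations M ?I (sgn2 s) f (\<lambda>_. 0) (\<lambda>i. {x \<in> B. v x = j i}))"
  have finJ: "finite J"
    by (rule finite_subset[of _ "PiE ?I (\<lambda>_. v ` B)"]) (auto simp: J_def intro!: finite_PiE B)
  have finR: "finite (R j)" for j
    by (rule finite_subset[of _ "PiE ?I (\<lambda>i. {x \<in> B. v x = j i})"]) (auto simp: R_def relations_def B intro!: finite_PiE)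
  have sub: "relations M ?I (sgn2 s) f (\<lambda>_. 0) (\<lambda>_. B) \<subseteq> (\<Union>j\<in>J. R j)"
  proof
    fix x assume x: "x \<in> relations M ?I (sgn2 s) f (\<lambda>_. 0) (\<lambda>_. B)"
    define j where "j = restrict (\<lambda>i. v (x i)) ?I"
    have xB: "x i \<in> B" if "i < 2 * s" for i using x that by (auto simp: relations_def PiE_iff)
    have "(\<Sum>i<2 * s. sgn2 s i * j i) = (\<Sum>i<2 * s. sgn2 s i * v (x i))"
      by (intro sum.cong) (auto simp: j_def)
    then have "j \<in> J" using v[OF x] xB by (auto simp: J_def j_def)
    moreover have "x \<in> R j" using x xB by (auto simp: R_def relations_def j_def PiE_iff)
    ultimately show "x \<in> (\<Union>j\<in>J. R j)" by blast
  qed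
  have "energy (2 * s) M f (\<lambda>_. 0) B = real (card (relations M ?I (sgn2 s) f (\<lambda>_. 0) (\<lambda>_. B)))"
    by (rule energy_eq_card_relations[OF M B])
  also have "\<dots> \<le> real (card (\<Union>j\<in>J. R j))"
    using sub finJ finR by (intro of_nat_mono card_mono) auto
  also have "\<dots> \<le> (\<Sum>j\<in>J. real (card (R j)))"
    using card_UN_le[OF finJ, of R] by (simp only: of_nat_sum[symmetric] of_nat_le_iff)
  also have "\<dots> \<le> (\<Sum>j\<in>J. \<Prod>i<2 * s. nrm (2 * s) M f (\<lambda>_. 0) {x \<in> B. v x = j i})"
  proof (rule sum_mono)
    fix j
    show "real (card (R j)) \<le> (\<Prod>i<2 * s. nrm (2 * s) M f (\<lambda>_. 0) {x \<in> B. v x = j i})"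
      unfolding R_def using B s by (intro card_relations_le[OF M]) (auto simp: sgn2_def)
  qed
  also have "\<dots> \<le> mean {0..<int M} (\<lambda>t. cmod (trig M (v ` B) (\<lambda>j. nrm (2 * s) M f (\<lambda>_. 0) {x \<in> B. v x = j}) t) ^ (2 * s))"
    unfolding J_def using B by (intro mean_trig_power_ge[OF M]) (auto simp: nrm_nonneg)
  finally show ?thesis .
qed

context tree_params
begin

text \<open>The normalised inequality after division by c = nn^(1 - \<beta>) qq^\<beta>, where nn is
  the sum of the \<open>n j\<close>; the 2s-th power of c is the right-hand side.\<close>

lemma mean_trig_le:
  assumes M: "prime M" "M \<ge> s" "M \<ge> 3" and V: "finite V" "V \<noteq> {}"
    and dist: "\<And>i j. i \<in> V \<Longrightarrow> j \<in> V \<Longrightarrow> i \<noteq> j \<Longrightarrow> \<not> int M dvd i - j"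
    and pos: "\<And>j. j \<in> V \<Longrightarrow> 0 < n j" "\<And>j. j \<in> V \<Longrightarrow> 0 < q j"
    and q: "\<And>j. j \<in> V \<Longrightarrow> q j \<le> qq" "(\<Sum>j\<in>V. q j) \<le> \<mu> * qq"
    and N: "\<And>j. j \<in> V \<Longrightarrow> 0 \<le> N j" "\<And>j. j \<in> V \<Longrightarrow> N j \<le> n j powr (1 - \<beta>) * q j powr \<beta>"
  shows "mean {0..<int M} (\<lambda>t. cmod (trig M V N t) ^ (2 * s)) \<le>
    (\<Sum>j\<in>V. n j) powr (2 * real s - \<alpha>) * qq powr \<alpha>"
proof -
  define nn where "nn = (\<Sum>j\<in>V. n j)"
  have nn: "0 < nn" unfolding nn_def using V pos by (intro sum_pos) auto
  obtain j where "j \<in> V" using V by blast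
  then have qq: "0 < qq" using pos(2)[of j] q(1)[of j] by linarith
  define c where "c = nn powr (1 - \<beta>) * qq powr \<beta>"
  have c: "0 < c" using nn qq by (simp add: c_def)
  have "mean {0..<int M} (\<lambda>t. cmod (trig M V (\<lambda>j. N j / c) t) ^ (2 * s)) \<le> 1"
  proof (rule mean_trig_le_one[OF M V dist, where n = "\<lambda>j. n j / nn" and q = "\<lambda>j. q j / qq"])
    show "(\<Sum>j\<in>V. n j / nn) = 1" using nn by (simp add: nn_def flip: sum_divide_distrib)
    show "(\<Sum>j\<in>V. q j / qq) \<le> \<mu>" using q qq by (simp add: field_simps flip: sum_divide_distrib)
    show "N j / c \<le> (n j / nn) powr (1 - \<beta>) * (q j / qq) powr \<beta>" if "j \<in> V" for j
    proof -
      have "(n j / nn) powr (1 - \<beta>) * (q j / qq) powr \<beta> = n j powr (1 - \<beta>) * q j powr \<beta> / c"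
        using pos[OF that] nn qq by (simp add: powr_divide c_def)
      then show ?thesis using N(2)[OF that] c by (simp add: divide_right_mono)
    qed
  qed (use pos nn qq q N c in auto)
  then have "c ^ (2 * s) * mean {0..<int M} (\<lambda>t. cmod (trig M V (\<lambda>j. N j / c) t) ^ (2 * s)) \<le> c ^ (2 * s) * 1"
    using c by (intro mult_left_mono) auto
  also have "c ^ (2 * s) * mean {0..<int M} (\<lambda>t. cmod (trig M V (\<lambda>j. N j / c) t) ^ (2 * s)) =
      mean {0..<int M} (\<lambda>t. cmod (trig M V N t) ^ (2 * s))"
  proof -
    have "trig M V N t = complex_of_real c * trig M V (\<lambda>j. N j / c) t" for t
      using trig_scale[of M V c "\<lambda>j. N j / c" t] c by simp
    then have "cmod (trig M V N t) ^ (2 * s) = c ^ (2 * s) * cmod (trig M V (\<lambda>j. N j / c) t) ^ (2 * s)" for t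
      using c by (simp add: norm_mult power_mult_distrib)
    then show ?thesis by (simp only: mean_cmult)
  qed
  also have "c ^ (2 * s) * 1 = nn powr (2 * real s - \<alpha>) * qq powr \<alpha>"
  proof -
    have "(nn powr (1 - \<beta>)) ^ (2 * s) = nn powr ((1 - \<beta>) * real (2 * s))"
      using nn by (simp add: powr_powr flip: powr_realpow)
    also have "(1 - \<beta>) * real (2 * s) = 2 * real s - \<alpha>" using two_s_beta by (simp add: algebra_simps)
    finally have a: "(nn powr (1 - \<beta>)) ^ (2 * s) = nn powr (2 * real s - \<alpha>)" .
    have "(qq powr \<beta>) ^ (2 * s) = qq powr (\<beta> * real (2 * s))"
      using qq by (simp add: powr_powr flip: powr_realpow)
    also have "\<beta> * real (2 * s) = \<alpha>" using two_s_beta by (simp add: algebra_simps)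
    finally show ?thesis unfolding c_def power_mult_distrib a by simp
  qed
  finally show ?thesis by (simp add: nn_def)
qed

text \<open>Coordinates are processed one by one: a coordinate on which the set is spread out is kept,
  at the price of a factor \<open>\<mu>\<close>; otherwise one passes to the best fibre for free.\<close>

lemma exists_tree_subset:
  fixes J :: "'a set \<Rightarrow> real" and D :: real and f :: "'a \<Rightarrow> int"
  assumes M: "prime M" "M \<ge> s" "M \<ge> 3" and D: "0 \<le> D"
    and J: "J {} \<le> 0" "\<And>x. J {x} \<le> 1"
    and A: "finite A" and vs: "\<And>v. v \<in> set vs \<Longrightarrow>
        (\<forall>x\<in>relations M {..<2 * s} (sgn2 s) f (\<lambda>_. 0) (\<lambda>_. A). (\<Sum>i<2 * s. sgn2 s i * v (x i)) = 0) \<and>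
        (\<forall>x\<in>A. \<forall>y\<in>A. v x \<noteq> v y \<longrightarrow> \<not> int M dvd v x - v y) \<and>
        (\<forall>B\<subseteq>A. J B \<le> D * (\<Sum>j\<in>v ` B. J {x \<in> B. v x = j}))"
    and B: "B \<subseteq> A" "B \<noteq> {}" "\<And>x y. x \<in> B \<Longrightarrow> y \<in> B \<Longrightarrow> (\<forall>v\<in>set vs. v x = v y) \<Longrightarrow> x = y"
  shows "\<exists>B' h. B' \<subseteq> B \<and> B' \<noteq> {} \<and> (\<forall>C\<subseteq>B'. J C \<le> (\<Sum>x\<in>C. D ^ h x)) \<and>
    energy (2 * s) M f (\<lambda>_. 0) B \<le> real (card B) powr (2 * real s - \<alpha>) * (\<Sum>x\<in>B'. (1 / \<mu>) ^ h x) powr \<alpha>"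
  using vs B
proof (induction vs arbitrary: B)
  case Nil
  \<comment> \<open>No coordinate is left to separate points, so \<open>B\<close> is a single point,
    at depth 0.\<close>
  obtain b where b: "b \<in> B" using Nil by blast
  have Bb: "B = {b}" using Nil(4) b by auto
  have Mpos: "M > 0" using M by simp
  have "nrm (2 * s) M f (\<lambda>_. 0) B ^ (2 * s) \<le> 1"
    using nrm_le_card[of "2 * s" M f "\<lambda>_. 0" B] s Mpos Bb
    by (intro power_le_one nrm_nonneg) auto
  then have "energy (2 * s) M f (\<lambda>_. 0) B \<le> 1" using nrm_power[of "2 * s" M f "\<lambda>_. 0" B] s by simp
  moreover have "J C \<le> (\<Sum>x\<in>C. D ^ 0)" if "C \<subseteq> B" for C
    using J that unfolding Bb by (auto simp: subset_singleton_iff)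
  ultimately show ?case using Bb by (intro exI[of _ B] exI[of _ "\<lambda>_. 0"]) auto
next
  case (Cons v vs)
  have Mpos: "M > 0" using M by simp
  note BA = Cons.prems(2) and Bne = Cons.prems(3) and Binj = Cons.prems(4)
  have finB: "finite B" using BA A finite_subset by blast
  have v: "\<And>x. x\<in>relations M {..<2 * s} (sgn2 s) f (\<lambda>_. 0) (\<lambda>_. A) \<Longrightarrow> (\<Sum>i<2 * s. sgn2 s i * v (x i)) = 0"
    and vd: "\<And>x y. x \<in> A \<Longrightarrow> y \<in> A \<Longrightarrow> v x \<noteq> v y \<Longrightarrow> \<not> int M dvd v x - v y"
    and vJ: "\<And>B. B \<subseteq> A \<Longrightarrow> J B \<le> D * (\<Sum>j\<in>v ` B. J {x \<in> B. v x = j})"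
    using Cons.prems(1)[of v] by auto
  define F where "F = (\<lambda>j. {x \<in> B. v x = j})"
  define V where "V = v ` B"
  have finV: "finite V" and Vne: "V \<noteq> {}" using finB Bne by (auto simp: V_def)
  have finF: "finite (F j)" for j using finB by (simp add: F_def)
  have "\<forall>j\<in>V. \<exists>p. fst p \<subseteq> F j \<and> fst p \<noteq> {} \<and> (\<forall>C\<subseteq>fst p. J C \<le> (\<Sum>x\<in>C. D ^ snd p x)) \<and>
    energy (2 * s) M f (\<lambda>_. 0) (F j) \<le> real (card (F j)) powr (2 * real s - \<alpha>) * (\<Sum>x\<in>fst p. (1 / \<mu>) ^ snd p x) powr \<alpha>"
  proof
    fix j assume j: "j \<in> V"
    have "\<exists>B' h. B' \<subseteq> F j \<and> B' \<noteq> {} \<and> (\<forall>C\<subseteq>B'. J C \<le> (\<Sum>x\<in>C. D ^ h x)) \<and>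
      energy (2 * s) M f (\<lambda>_. 0) (F j) \<le> real (card (F j)) powr (2 * real s - \<alpha>) * (\<Sum>x\<in>B'. (1 / \<mu>) ^ h x) powr \<alpha>"
    proof (rule Cons.IH)
      show "F j \<subseteq> A" "F j \<noteq> {}" using BA j by (auto simp: F_def V_def)
      show "x = y" if "x \<in> F j" "y \<in> F j" "\<forall>v\<in>set vs. v x = v y" for x y
        using that by (intro Binj) (auto simp: F_def)
    qed (use Cons.prems(1) in auto)
    then show "\<exists>p. fst p \<subseteq> F j \<and> fst p \<noteq> {} \<and> (\<forall>C\<subseteq>fst p. J C \<le> (\<Sum>x\<in>C. D ^ snd p x)) \<and>
      energy (2 * s) M f (\<lambda>_. 0) (F j) \<le> real (card (F j)) powr (2 * real s - \<alpha>) * (\<Sum>x\<in>fst p. (1 / \<mu>) ^ snd p x) powr \<alpha>"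
      by (metis fst_conv snd_conv)
  qed
  from bchoice[OF this] obtain p where P: "\<forall>j\<in>V. fst (p j) \<subseteq> F j \<and> fst (p j) \<noteq> {} \<and> (\<forall>C\<subseteq>fst (p j). J C \<le> (\<Sum>x\<in>C. D ^ snd (p j) x)) \<and>
    energy (2 * s) M f (\<lambda>_. 0) (F j) \<le> real (card (F j)) powr (2 * real s - \<alpha>) * (\<Sum>x\<in>fst (p j). (1 / \<mu>) ^ snd (p j) x) powr \<alpha>"
    by blast
  have p: "\<And>j. j \<in> V \<Longrightarrow> fst (p j) \<subseteq> F j" "\<And>j. j \<in> V \<Longrightarrow> fst (p j) \<noteq> {}"
    "\<And>j C. j \<in> V \<Longrightarrow> C \<subseteq> fst (p j) \<Longrightarrow> J C \<le> (\<Sum>x\<in>C. D ^ snd (p j) x)"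
    "\<And>j. j \<in> V \<Longrightarrow> energy (2 * s) M f (\<lambda>_. 0) (F j) \<le> real (card (F j)) powr (2 * real s - \<alpha>) * (\<Sum>x\<in>fst (p j). (1 / \<mu>) ^ snd (p j) x) powr \<alpha>"
    using P by blast+
  \<comment> \<open>Effective size of the structured part of a fibre: a point reached by h kept
    queries counts \<mu>^(-h). The energy bound carries the \<alpha>-th power of this
    weight.\<close>
  define q where "q = (\<lambda>j. \<Sum>x\<in>fst (p j). (1 / \<mu>) ^ snd (p j) x)"
  define n where "n = (\<lambda>j. real (card (F j)))"
  have finp: "finite (fst (p j))" if "j \<in> V" for j using p(1)[OF that] finF finite_subset by blast
  have qpos: "0 < q j" if "j \<in> V" for j
    unfolding q_def using p(2)[OF that] finp[OF that] lam by (intro sum_pos) auto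
  have npos: "0 < n j" if "j \<in> V" for j
    using that finF[of j] by (auto simp: n_def F_def V_def card_gt_0_iff)
  have nsum: "(\<Sum>j\<in>V. n j) = real (card B)"
  proof -
    have "card B = (\<Sum>j\<in>V. card (F j))"
      unfolding V_def F_def using finB sum.image_gen[OF finB, of "\<lambda>_. 1::nat" v] by simp
    then show ?thesis by (simp add: n_def)
  qed
  define N where "N = (\<lambda>j. nrm (2 * s) M f (\<lambda>_. 0) (F j))"
  have N: "N j \<le> n j powr (1 - \<beta>) * q j powr \<beta>" if j: "j \<in> V" for j
  proof -
    have "N j ^ (2 * s) \<le> n j powr (2 * real s - \<alpha>) * q j powr \<alpha>"
      unfolding N_def using nrm_power[of "2 * s" M f "\<lambda>_. 0" "F j"] s p(4)[OF j] by (simp add: n_def q_def)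
    also have "\<dots> = (n j powr (1 - \<beta>) * q j powr \<beta>) ^ (2 * s)"
    proof -
      have "(n j powr (1 - \<beta>)) ^ (2 * s) = n j powr ((1 - \<beta>) * real (2 * s))"
        using npos[OF j] by (simp add: powr_powr flip: powr_realpow)
      also have "(1 - \<beta>) * real (2 * s) = 2 * real s - \<alpha>" using two_s_beta by (simp add: algebra_simps)
      finally have a: "(n j powr (1 - \<beta>)) ^ (2 * s) = n j powr (2 * real s - \<alpha>)" .
      have "(q j powr \<beta>) ^ (2 * s) = q j powr (\<beta> * real (2 * s))"
        using qpos[OF j] by (simp add: powr_powr flip: powr_realpow)
      also have "\<beta> * real (2 * s) = \<alpha>" using two_s_beta by (simp add: algebra_simps)
      finally show ?thesis unfolding power_mult_distrib a by simp
    qed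
    finally show ?thesis
      using s by (simp add: power_mono_iff N_def nrm_nonneg)
  qed
  \<comment> \<open>Any \<open>qq\<close> that dominates each fibre weight and, up to the factor
    \<mu>, their sum will do. The cases below take for it the largest fibre weight, or the sum
    divided by \<mu>.\<close>
  have step: "energy (2 * s) M f (\<lambda>_. 0) B \<le> real (card B) powr (2 * real s - \<alpha>) * qq powr \<alpha>"
    if "\<And>j. j \<in> V \<Longrightarrow> q j \<le> qq" "(\<Sum>j\<in>V. q j) \<le> \<mu> * qq" for qq
  proof -
    have "energy (2 * s) M f (\<lambda>_. 0) B \<le> mean {0..<int M} (\<lambda>t. cmod (trig M V N t) ^ (2 * s))"
      unfolding V_def N_def F_def
    proof (rule energy_fibre_le[OF Mpos finB s])
      fix x assume "x \<in> relations M {..<2 * s} (sgn2 s) f (\<lambda>_. 0) (\<lambda>_. B)"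
      then have "x \<in> relations M {..<2 * s} (sgn2 s) f (\<lambda>_. 0) (\<lambda>_. A)"
        using BA by (auto simp: relations_def PiE_iff)
      then show "(\<Sum>i<2 * s. sgn2 s i * v (x i)) = 0" by (rule v)
    qed
    also have "\<dots> \<le> (\<Sum>j\<in>V. n j) powr (2 * real s - \<alpha>) * qq powr \<alpha>"
    proof (rule mean_trig_le[OF M finV Vne])
      show "\<not> int M dvd i - j" if "i \<in> V" "j \<in> V" "i \<noteq> j" for i j
        using that vd BA by (auto simp: V_def)
    qed (use npos qpos that N in \<open>auto simp: N_def nrm_nonneg\<close>)
    finally show ?thesis by (simp add: nsum)
  qed
  obtain j0 where j0: "j0 \<in> V" "\<And>j. j \<in> V \<Longrightarrow> q j \<le> q j0"
    using Max_in[of "q ` V"] finV Vne Max_ge[of "q ` V"] by (metis (no_types, lifting) finite_imageI imageE imageI image_is_empty)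
  show ?case
  proof (cases "(\<Sum>j\<in>V. q j) \<le> \<mu> * q j0")
    case True
    have "fst (p j0) \<subseteq> B" using p(1)[OF j0(1)] by (auto simp: F_def)
    then show ?thesis
      using p(2,3)[OF j0(1)] step[of "q j0"] j0(2) True
      by (intro exI[of _ "fst (p j0)"] exI[of _ "snd (p j0)"]) (auto simp: q_def)
  next
    case False
    define B' where "B' = (\<Union>j\<in>V. fst (p j))"
    \<comment> \<open>Keeping the query raises every depth by one: each point costs another factor
      \<open>D\<close> in \<open>J\<close>, and the total weight is divided by \<mu>.\<close>
    define h where "h = (\<lambda>x. Suc (snd (p (v x)) x))"
    have pv: "v x = j" if "j \<in> V" "x \<in> fst (p j)" for x j
      using p(1)[OF that(1)] that by (auto simp: F_def)
    have "B' \<subseteq> B" using p(1) by (auto simp: B'_def F_def)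
    moreover have "B' \<noteq> {}" using p(2) Vne by (auto simp: B'_def)
    moreover have "J C \<le> (\<Sum>x\<in>C. D ^ h x)" if C: "C \<subseteq> B'" for C
    proof -
      have CB: "C \<subseteq> B" using C \<open>B' \<subseteq> B\<close> by blast
      have finC: "finite C" using CB finB finite_subset by blast
      have "J C \<le> D * (\<Sum>j\<in>v ` C. J {x \<in> C. v x = j})" using CB BA by (intro vJ) auto
      also have "\<dots> \<le> D * (\<Sum>j\<in>v ` C. \<Sum>x\<in>{x \<in> C. v x = j}. D ^ snd (p j) x)"
      proof (intro mult_left_mono sum_mono D)
        fix j assume "j \<in> v ` C"
        then have j: "j \<in> V" using CB by (auto simp: V_def)
        have "{x \<in> C. v x = j} \<subseteq> fst (p j)"
          using C pv by (auto simp: B'_def)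
        then show "J {x \<in> C. v x = j} \<le> (\<Sum>x\<in>{x \<in> C. v x = j}. D ^ snd (p j) x)" by (rule p(3)[OF j])
      qed
      also have "\<dots> = (\<Sum>j\<in>v ` C. \<Sum>x\<in>{x \<in> C. v x = j}. D ^ h x)"
        unfolding sum_distrib_left by (intro sum.cong refl) (auto simp: h_def)
      also have "\<dots> = (\<Sum>x\<in>C. D ^ h x)" by (rule sum.image_gen[OF finC, symmetric])
      finally show ?thesis .
    qed
    moreover have "(\<Sum>x\<in>B'. (1 / \<mu>) ^ h x) = (\<Sum>j\<in>V. q j) / \<mu>"
    proof -
      have "(\<Sum>x\<in>B'. (1 / \<mu>) ^ h x) = (\<Sum>j\<in>V. \<Sum>x\<in>fst (p j). (1 / \<mu>) ^ h x)"
        unfolding B'_def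
      proof (rule sum.UNION_disjoint[OF finV])
        show "\<forall>i\<in>V. \<forall>j\<in>V. i \<noteq> j \<longrightarrow> fst (p i) \<inter> fst (p j) = {}" using pv by blast
      qed (use finp in blast)
      also have "\<dots> = (\<Sum>j\<in>V. (1 / \<mu>) * q j)"
        unfolding q_def sum_distrib_left using pv by (intro sum.cong refl) (auto simp: h_def)
      finally show ?thesis by (simp add: sum_divide_distrib)
    qed
    moreover have "energy (2 * s) M f (\<lambda>_. 0) B \<le> real (card B) powr (2 * real s - \<alpha>) * ((\<Sum>j\<in>V. q j) / \<mu>) powr \<alpha>"
    proof (rule step)
      show "q j \<le> (\<Sum>j\<in>V. q j) / \<mu>" if "j \<in> V" for j
        using j0(2)[OF that] False lam by (simp add: field_simps) (smt (verit) mult_left_mono)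
    qed (use lam in auto)
    ultimately show ?thesis by (intro exI[of _ B'] exI[of _ h]) auto
  qed
qed

end

section \<open>Decoupling and joint energy\<close>

lemma finite_obtains_max:
  fixes h :: "'i \<Rightarrow> real"
  assumes "finite K" "K \<noteq> {}"
  obtains c where "c \<in> K" "\<And>i. i \<in> K \<Longrightarrow> h i \<le> h c"
proof -
  have "Max (h ` K) \<in> h ` K" using assms by (intro Max_in) auto
  then obtain c where "c \<in> K" "h c = Max (h ` K)" by auto
  then show thesis using assms by (intro that[of c]) auto
qed

lemma nrm_empty: "0 < n \<Longrightarrow> nrm n M f g {} = 0"
  by (simp add: nrm_def energy_def ft_def mean_def zero_power)

text \<open>Chang's argument: if in every relation two entries share a label, then relations are
  counted by choosing these two positions first, which decouples the labels.\<close>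

lemma nrm_decouple_labels:
  assumes M: "M > 0" and B: "finite B" and k: "k \<ge> 1"
    and rel: "\<And>x. x \<in> relations M {..<2 * k} (sgn2 k) f g (\<lambda>_. B) \<Longrightarrow>
      \<exists>a<2 * k. \<exists>b<2 * k. a \<noteq> b \<and> v (x a) = v (x b)"
  shows "(nrm (2 * k) M f g B)\<^sup>2 \<le> 4 * (real k)\<^sup>2 * (\<Sum>j\<in>v ` B. (nrm (2 * k) M f g {x \<in> B. v x = j})\<^sup>2)"
proof -
  let ?I = "{..<2 * k}"
  define n where "n = nrm (2 * k) M f g B"
  define F where "F = (\<lambda>j. {x \<in> B. v x = j})"
  define P where "P = {(a, b). a < 2 * k \<and> b < 2 * k \<and> a \<noteq> b}"
  have Psub: "P \<subseteq> ?I \<times> ?I" by (auto simp: P_def)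
  have finP: "finite P" by (rule finite_subset[OF Psub]) simp
  have cardP: "real (card P) \<le> 4 * (real k)\<^sup>2"
  proof -
    have "card P \<le> card (?I \<times> ?I)" using Psub by (intro card_mono) auto
    then have "real (card P) \<le> real (2 * k * (2 * k))" by (simp only: of_nat_le_iff card_cartesian_product card_lessThan)
    then show ?thesis by (simp add: power2_eq_square)
  qed
  \<comment> \<open>The two positions in \<open>p\<close> are confined to one fibre while the other
    2k - 2 range over \<open>B\<close>. Hoelder then yields the squared fibre norm times n^(2k - 2),
    and this power of n cancels at the end.\<close>
  define C where "C = (\<lambda>(p :: nat \<times> nat) j i. if i = fst p \<or> i = snd p then F j else B)"
  define X where "X = (\<lambda>p j. relations M ?I (sgn2 k) f g (C p j))"
  have finC: "finite (C p j i)" for p j i using B by (simp add: C_def F_def)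
  have finX: "finite (X p j)" for p j
    by (rule finite_subset[of _ "PiE ?I (C p j)"]) (auto simp: X_def relations_def finC intro!: finite_PiE)
  have sub: "relations M ?I (sgn2 k) f g (\<lambda>_. B) \<subseteq> (\<Union>(p, j)\<in>P \<times> v ` B. X p j)"
  proof
    fix x assume x: "x \<in> relations M ?I (sgn2 k) f g (\<lambda>_. B)"
    then obtain a b where ab: "a < 2 * k" "b < 2 * k" "a \<noteq> b" "v (x a) = v (x b)" using rel by blast
    have xB: "x i \<in> B" if "i < 2 * k" for i using x that by (auto simp: relations_def PiE_iff)
    have "x \<in> X (a, b) (v (x a))"
      using x xB ab by (auto simp: X_def relations_def PiE_iff C_def F_def)
    moreover have "(a, b) \<in> P" "v (x a) \<in> v ` B" using ab xB by (auto simp: P_def)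
    ultimately show "x \<in> (\<Union>(p, j)\<in>P \<times> v ` B. X p j)" by blast
  qed
  have cardX: "real (card (X p j)) \<le> (nrm (2 * k) M f g (F j))\<^sup>2 * n ^ (2 * k - 2)" if p: "p \<in> P" for p j
  proof -
    have ab: "fst p \<in> ?I" "snd p \<in> ?I - {fst p}" using p by (auto simp: P_def)
    have "real (card (X p j)) \<le> (\<Prod>i\<in>?I. nrm (2 * k) M f g (C p j i))"
      unfolding X_def using finC k by (intro card_relations_le[OF M]) (auto simp: sgn2_def)
    also have "\<dots> = nrm (2 * k) M f g (C p j (fst p)) * (nrm (2 * k) M f g (C p j (snd p)) *
        (\<Prod>i\<in>?I - {fst p} - {snd p}. nrm (2 * k) M f g (C p j i)))"
      using ab by (subst prod.remove[OF _ ab(1)], simp, subst prod.remove[OF _ ab(2)]) auto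
    also have "(\<Prod>i\<in>?I - {fst p} - {snd p}. nrm (2 * k) M f g (C p j i)) = (\<Prod>i\<in>?I - {fst p} - {snd p}. n)"
      by (intro prod.cong) (auto simp: C_def n_def)
    also have "\<dots> = n ^ (2 * k - 2)"
      using ab by (simp add: card_Diff_singleton numeral_2_eq_2)
    finally show ?thesis by (simp add: C_def power2_eq_square mult.assoc)
  qed
  have "n ^ (2 * k) = energy (2 * k) M f g B" unfolding n_def using k by (intro nrm_power) auto
  also have "\<dots> = real (card (relations M ?I (sgn2 k) f g (\<lambda>_. B)))" by (rule energy_eq_card_relations[OF M B])
  also have "\<dots> \<le> real (card (\<Union>(p, j)\<in>P \<times> v ` B. X p j))"
    using sub finP B finX by (intro of_nat_mono card_mono) auto
  also have "\<dots> \<le> (\<Sum>(p, j)\<in>P \<times> v ` B. real (card (X p j)))"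
    using card_UN_le[of "P \<times> v ` B" "\<lambda>(p, j). X p j"] finP B
    by (simp only: of_nat_sum[symmetric] of_nat_le_iff case_prod_unfold) simp
  also have "\<dots> = (\<Sum>p\<in>P. \<Sum>j\<in>v ` B. real (card (X p j)))" by (rule sum.cartesian_product[symmetric])
  also have "\<dots> \<le> (\<Sum>p\<in>P. \<Sum>j\<in>v ` B. (nrm (2 * k) M f g (F j))\<^sup>2 * n ^ (2 * k - 2))"
    by (intro sum_mono cardX)
  also have "\<dots> = real (card P) * ((\<Sum>j\<in>v ` B. (nrm (2 * k) M f g (F j))\<^sup>2) * n ^ (2 * k - 2))"
    by (simp add: sum_distrib_right)
  also have "\<dots> \<le> 4 * (real k)\<^sup>2 * ((\<Sum>j\<in>v ` B. (nrm (2 * k) M f g (F j))\<^sup>2) * n ^ (2 * k - 2))"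
    using cardP by (intro mult_right_mono mult_nonneg_nonneg sum_nonneg) (auto simp: n_def nrm_nonneg)
  finally have main: "n ^ (2 * k) \<le> (4 * (real k)\<^sup>2 * (\<Sum>j\<in>v ` B. (nrm (2 * k) M f g (F j))\<^sup>2)) * n ^ (2 * k - 2)"
    by simp
  show ?thesis
  proof (cases "n = 0")
    case True
    then show ?thesis unfolding n_def by (simp add: sum_nonneg)
  next
    case False
    then have n: "0 < n" using nrm_nonneg[of "2 * k" M f g B] by (simp add: n_def)
    have "2 * k = 2 + (2 * k - 2)" using k by simp
    then have "n ^ (2 * k) = n\<^sup>2 * n ^ (2 * k - 2)" by (metis power_add)
    then show ?thesis using main n by (simp add: n_def F_def)
  qed
qed

lemma sum_power_le_power_sum:
  fixes a :: "'i \<Rightarrow> real"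
  assumes "finite I" "\<And>i. i \<in> I \<Longrightarrow> 0 \<le> a i" "k \<ge> 1"
  shows "(\<Sum>i\<in>I. a i ^ k) \<le> (\<Sum>i\<in>I. a i) ^ k"
proof -
  define S where "S = (\<Sum>i\<in>I. a i)"
  obtain m where m: "k = Suc m" using assms(3) by (cases k) auto
  have "(\<Sum>i\<in>I. a i ^ k) \<le> (\<Sum>i\<in>I. a i * S ^ m)"
  proof (rule sum_mono)
    fix i assume i: "i \<in> I"
    have "a i \<le> S" unfolding S_def using assms i by (intro member_le_sum) auto
    then show "a i ^ k \<le> a i * S ^ m" using assms(2)[OF i] by (simp add: m mult_left_mono power_mono)
  qed
  also have "\<dots> = S ^ k" by (simp add: m S_def sum_distrib_right)
  finally show ?thesis by (simp add: S_def)
qed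

text \<open>Pointwise the transform of \<open>B\<close> is at most \<open>R\<close> times that of
  its largest class; bound the largest by the sum of all 2k-th powers, and pass from the l^k to the
  l^1 norm of the squared norms. The loss R^2 is affordable because in the application
  \<open>R\<close> depends only on the degree.\<close>

lemma nrm_decouple_classes:
  fixes cl :: "'a \<Rightarrow> 'c"
  assumes M: "M > 0" and B: "finite B" and k: "k \<ge> 1" and R: "card (cl ` B) \<le> R"
  shows "(nrm (2 * k) M f g B)\<^sup>2 \<le> (real R)\<^sup>2 * (\<Sum>c\<in>cl ` B. (nrm (2 * k) M f g {x \<in> B. cl x = c})\<^sup>2)"
proof (cases "B = {}")
  case True
  then show ?thesis using k by (simp add: nrm_empty)
next
  case False
  define G where "G = (\<lambda>c. {x \<in> B. cl x = c})"
  define K where "K = cl ` B"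
  have finK: "finite K" and Kne: "K \<noteq> {}" using B False by (auto simp: K_def)
  have pt: "cmod (ft M f g B z) ^ (2 * k) \<le> real R ^ (2 * k) * (\<Sum>c\<in>K. cmod (ft M f g (G c) z) ^ (2 * k))" for z
  proof -
    have "ft M f g B z = (\<Sum>c\<in>K. ft M f g (G c) z)"
      unfolding ft_def K_def G_def by (rule sum.image_gen[OF B])
    then have 1: "cmod (ft M f g B z) \<le> (\<Sum>c\<in>K. cmod (ft M f g (G c) z))" by (simp add: norm_sum)
    obtain c0 where c0: "c0 \<in> K" "\<And>c. c \<in> K \<Longrightarrow> cmod (ft M f g (G c) z) \<le> cmod (ft M f g (G c0) z)"
      using finite_obtains_max[OF finK Kne, of "\<lambda>c. cmod (ft M f g (G c) z)"] by blast
    have "(\<Sum>c\<in>K. cmod (ft M f g (G c) z)) \<le> real (card K) * cmod (ft M f g (G c0) z)"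
      using c0 by (intro sum_bounded_above) auto
    also have "\<dots> \<le> real R * cmod (ft M f g (G c0) z)" using R by (intro mult_right_mono) (auto simp: K_def)
    finally have "cmod (ft M f g B z) ^ (2 * k) \<le> (real R * cmod (ft M f g (G c0) z)) ^ (2 * k)"
      using 1 by (intro power_mono) auto
    also have "\<dots> = real R ^ (2 * k) * cmod (ft M f g (G c0) z) ^ (2 * k)" by (rule power_mult_distrib)
    also have "\<dots> \<le> real R ^ (2 * k) * (\<Sum>c\<in>K. cmod (ft M f g (G c) z) ^ (2 * k))"
      using finK c0 by (intro mult_left_mono member_le_sum) auto
    finally show ?thesis .
  qed
  have "energy (2 * k) M f g B \<le> mean (grid M) (\<lambda>z. real R ^ (2 * k) * (\<Sum>c\<in>K. cmod (ft M f g (G c) z) ^ (2 * k)))"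
    unfolding energy_def by (intro mean_mono pt)
  also have "\<dots> = real R ^ (2 * k) * (\<Sum>c\<in>K. energy (2 * k) M f g (G c))"
    unfolding mean_cmult mean_sum energy_def ..
  finally have "nrm (2 * k) M f g B ^ (2 * k) \<le> real R ^ (2 * k) * (\<Sum>c\<in>K. nrm (2 * k) M f g (G c) ^ (2 * k))"
    using k by (simp add: nrm_power)
  also have "\<dots> \<le> real R ^ (2 * k) * (\<Sum>c\<in>K. (nrm (2 * k) M f g (G c))\<^sup>2) ^ k"
    using sum_power_le_power_sum[OF finK, of "\<lambda>c. (nrm (2 * k) M f g (G c))\<^sup>2" k] k
    by (intro mult_left_mono) (auto simp: power_mult)
  also have "\<dots> = ((real R)\<^sup>2 * (\<Sum>c\<in>K. (nrm (2 * k) M f g (G c))\<^sup>2)) ^ k"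
    by (simp add: power_mult_distrib power_mult)
  finally have "((nrm (2 * k) M f g B)\<^sup>2) ^ k \<le> ((real R)\<^sup>2 * (\<Sum>c\<in>K. (nrm (2 * k) M f g (G c))\<^sup>2)) ^ k"
    by (simp add: power_mult)
  then have "(nrm (2 * k) M f g B)\<^sup>2 \<le> (real R)\<^sup>2 * (\<Sum>c\<in>K. (nrm (2 * k) M f g (G c))\<^sup>2)"
    using k by (subst (asm) power_mono_iff) (auto intro!: mult_nonneg_nonneg sum_nonneg)
  then show ?thesis by (simp add: K_def G_def)
qed

text \<open>Split into classes, then decouple the labels within each class: only a relation with all
  entries in one class is guaranteed to repeat a label.\<close>

lemma nrm_decouple:
  fixes cl :: "int \<Rightarrow> 'c"
  assumes M: "M > 0" and B: "finite B" and k: "k \<ge> 1" and R: "card (cl ` v ` B) \<le> R"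
    and rel: "\<And>x c. x \<in> relations M {..<2 * k} (sgn2 k) f g (\<lambda>_. {y \<in> B. cl (v y) = c}) \<Longrightarrow>
      \<exists>a<2 * k. \<exists>b<2 * k. a \<noteq> b \<and> v (x a) = v (x b)"
  shows "(nrm (2 * k) M f g B)\<^sup>2 \<le>
    4 * (real R)\<^sup>2 * (real k)\<^sup>2 * (\<Sum>j\<in>v ` B. (nrm (2 * k) M f g {x \<in> B. v x = j})\<^sup>2)"
proof -
  let ?n = "\<lambda>C. (nrm (2 * k) M f g C)\<^sup>2"
  have "?n B \<le> (real R)\<^sup>2 * (\<Sum>c\<in>(cl \<circ> v) ` B. ?n {x \<in> B. (cl \<circ> v) x = c})"
    using R by (intro nrm_decouple_classes[OF M B k]) (simp add: image_comp)
  also have "\<dots> \<le> (real R)\<^sup>2 * (\<Sum>c\<in>(cl \<circ> v) ` B. 4 * (real k)\<^sup>2 * (\<Sum>j\<in>{j \<in> v ` B. cl j = c}. ?n {x \<in> B. v x = j}))"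
  proof (intro mult_left_mono sum_mono)
    fix c
    define G where "G = {x \<in> B. (cl \<circ> v) x = c}"
    have vG: "v ` G = {j \<in> v ` B. cl j = c}" by (auto simp: G_def)
    have "?n G \<le> 4 * (real k)\<^sup>2 * (\<Sum>j\<in>v ` G. ?n {x \<in> G. v x = j})"
      using B rel[of _ c] by (intro nrm_decouple_labels[OF M _ k]) (auto simp: G_def)
    also have "(\<Sum>j\<in>v ` G. ?n {x \<in> G. v x = j}) = (\<Sum>j\<in>{j \<in> v ` B. cl j = c}. ?n {x \<in> B. v x = j})"
      unfolding vG
    proof (rule sum.cong[OF refl])
      fix j assume "j \<in> {j \<in> v ` B. cl j = c}"
      then have "{x \<in> G. v x = j} = {x \<in> B. v x = j}" by (auto simp: G_def)
      then show "?n {x \<in> G. v x = j} = ?n {x \<in> B. v x = j}" by simp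
    qed
    finally show "?n {x \<in> B. (cl \<circ> v) x = c} \<le> 4 * (real k)\<^sup>2 * (\<Sum>j\<in>{j \<in> v ` B. cl j = c}. ?n {x \<in> B. v x = j})"
      by (simp add: G_def)
  qed auto
  also have "\<dots> = (real R)\<^sup>2 * (4 * (real k)\<^sup>2 * (\<Sum>c\<in>cl ` v ` B. \<Sum>j\<in>{j \<in> v ` B. cl j = c}. ?n {x \<in> B. v x = j}))"
    by (simp add: sum_distrib_left image_comp)
  also have "(\<Sum>c\<in>cl ` v ` B. \<Sum>j\<in>{j \<in> v ` B. cl j = c}. ?n {x \<in> B. v x = j}) = (\<Sum>j\<in>v ` B. ?n {x \<in> B. v x = j})"
    using B by (intro sum.image_gen[symmetric]) auto
  finally show ?thesis by (simp add: algebra_simps)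
qed

section \<open>Large spectra and simultaneous correlation\<close>

text \<open>The frequencies at which the transform is at least \<tau> |B|/2 have density at least
  \<tau>^(2s)/2, since the remaining ones contribute at most half of the 2s-th moment. Weighted by
  conjugate phases they form a sum whose modulus averages at least \<tau> |S|/2 over
  \<open>B\<close>, so it reaches \<tau> |S|/4 on a proportion \<tau>/4 of \<open>B\<close>.\<close>

lemma exists_large_spectrum:
  fixes h :: "'a \<Rightarrow> int"
  assumes M: "M > 0" and s: "s \<ge> 1" and B: "finite B" "B \<noteq> {}" and \<tau>: "0 < \<tau>"
    and large: "\<tau> * real (card B) \<le> nrm (2 * s) M h (\<lambda>_. 0) B"
  obtains S a where "S \<subseteq> {0..<int M}" "S \<noteq> {}" "\<forall>t. cmod (a t) \<le> 1"
    "\<tau> ^ (2 * s) * real M \<le> 2 * real (card S)"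
    "\<tau> * real (card B) \<le> 4 * real (card {x \<in> B. \<tau> / 4 * real (card S) \<le> cmod (\<Sum>t\<in>S. a t * ee M (t * h x))})"
proof -
  let ?T = "{0..<int M}"
  define N where "N = real (card B)"
  have N: "N > 0" using B by (simp add: N_def card_gt_0_iff)
  define F where "F = (\<lambda>t. \<Sum>x\<in>B. ee M (t * h x))"
  have FN: "cmod (F t) \<le> N" for t
    unfolding F_def N_def by (rule order_trans[OF norm_sum]) simp
  have "energy (2 * s) M h (\<lambda>_. 0) B = mean (grid M) (\<lambda>z. cmod (F (fst z)) ^ (2 * s))"
    by (simp add: energy_def ft_def F_def)
  then have en: "energy (2 * s) M h (\<lambda>_. 0) B = mean ?T (\<lambda>t. cmod (F t) ^ (2 * s))"
    using mean_grid_fst[OF M, of "\<lambda>t. cmod (F t) ^ (2 * s)"] by simp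
  define S where "S = {t \<in> ?T. \<tau> / 2 * N \<le> cmod (F t)}"
  define a where "a = (\<lambda>t. cnj (sgn (F t)))"
  have finS: "finite S" by (rule finite_subset[of _ ?T]) (auto simp: S_def)
  have tN: "0 \<le> \<tau> * N" using \<tau> N by simp
  have "(\<tau> * N) ^ (2 * s) \<le> nrm (2 * s) M h (\<lambda>_. 0) B ^ (2 * s)"
    using large tN by (intro power_mono) (auto simp: N_def)
  also have "\<dots> = mean ?T (\<lambda>t. cmod (F t) ^ (2 * s))" using s en by (simp add: nrm_power)
  also have "\<dots> \<le> (real (card S) * N ^ (2 * s) + real M * (\<tau> / 2 * N) ^ (2 * s)) / real M"
  proof -
    have "(\<Sum>t\<in>?T. cmod (F t) ^ (2 * s)) \<le> (\<Sum>t\<in>?T. (if t \<in> S then N ^ (2 * s) else 0) + (\<tau> / 2 * N) ^ (2 * s))"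
    proof (rule sum_mono)
      fix t assume t: "t \<in> ?T"
      have p: "0 \<le> (\<tau> / 2 * N) ^ (2 * s)" using tN by (intro zero_le_power) auto
      show "cmod (F t) ^ (2 * s) \<le> (if t \<in> S then N ^ (2 * s) else 0) + (\<tau> / 2 * N) ^ (2 * s)"
      proof (cases "t \<in> S")
        case True
        have "cmod (F t) ^ (2 * s) \<le> N ^ (2 * s)" by (intro power_mono FN) auto
        then show ?thesis using True p by (simp only: if_True)
      next
        case False
        then have "cmod (F t) \<le> \<tau> / 2 * N" using t by (simp add: S_def)
        then have "cmod (F t) ^ (2 * s) \<le> (\<tau> / 2 * N) ^ (2 * s)" by (intro power_mono) auto
        then show ?thesis using False by simp
      qed
    qed
    also have "\<dots> = (\<Sum>t\<in>?T. if t \<in> S then N ^ (2 * s) else 0) + real M * (\<tau> / 2 * N) ^ (2 * s)"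
      by (simp add: sum.distrib)
    also have "(\<Sum>t\<in>?T. if t \<in> S then N ^ (2 * s) else 0) = real (card S) * N ^ (2 * s)"
    proof -
      have "?T \<inter> S = S" by (auto simp: S_def)
      then show ?thesis by (simp add: sum.If_cases)
    qed
    finally show ?thesis by (simp add: mean_def divide_right_mono)
  qed
  finally have "(\<tau> * N) ^ (2 * s) * real M \<le> real (card S) * N ^ (2 * s) + real M * (\<tau> / 2 * N) ^ (2 * s)"
    using M by (simp add: field_simps)
  then have "N ^ (2 * s) * (\<tau> ^ (2 * s) * real M) \<le> N ^ (2 * s) * (real (card S) + real M * (\<tau> / 2) ^ (2 * s))"
    unfolding power_mult_distrib by (simp add: algebra_simps)
  then have 1: "\<tau> ^ (2 * s) * real M \<le> real (card S) + real M * (\<tau> / 2) ^ (2 * s)"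
    using N by simp
  have "(1/2 :: real) ^ (2 * s) \<le> (1/2) ^ 1" using s by (intro power_decreasing) auto
  then have "\<tau> ^ (2 * s) * (1/2) ^ (2 * s) \<le> \<tau> ^ (2 * s) * (1/2)" using \<tau> by (intro mult_left_mono) auto
  then have "(\<tau> / 2) ^ (2 * s) \<le> \<tau> ^ (2 * s) / 2" by (simp add: power_divide)
  then have "real M * (\<tau> / 2) ^ (2 * s) \<le> real M * (\<tau> ^ (2 * s) / 2)" by (intro mult_left_mono) auto
  moreover have "real M * (\<tau> ^ (2 * s) / 2) = \<tau> ^ (2 * s) * real M / 2" by simp
  ultimately have cardS: "\<tau> ^ (2 * s) * real M \<le> 2 * real (card S)" using 1 by linarith
  have "0 < \<tau> ^ (2 * s) * real M" using \<tau> M by simp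
  then have cS: "0 < real (card S)" using cardS by linarith
  then have Sne: "S \<noteq> {}" by auto
  have a1: "cmod (a t) \<le> 1" for t by (simp add: a_def norm_sgn)
  define G where "G = (\<lambda>x. \<Sum>t\<in>S. a t * ee M (t * h x))"
  have Gle: "cmod (G x) \<le> real (card S)" for x
  proof -
    have "cmod (G x) \<le> (\<Sum>t\<in>S. 1)" unfolding G_def
      by (rule order_trans[OF norm_sum]) (intro sum_mono, simp add: norm_mult a1)
    then show ?thesis by simp
  qed
  have aF: "a t * F t = complex_of_real (cmod (F t))" for t
    by (cases "F t = 0") (simp_all add: a_def sgn_eq divide_simps complex_norm_square[symmetric] power2_eq_square mult.commute)
  have "(\<Sum>x\<in>B. G x) = (\<Sum>t\<in>S. a t * F t)"
    unfolding G_def F_def sum_distrib_left by (rule sum.swap)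
  also have "\<dots> = complex_of_real (\<Sum>t\<in>S. cmod (F t))" by (simp add: aF)
  finally have sumG: "(\<Sum>x\<in>B. G x) = complex_of_real (\<Sum>t\<in>S. cmod (F t))" .
  have "cmod (\<Sum>x\<in>B. G x) = (\<Sum>t\<in>S. cmod (F t))"
    unfolding sumG norm_of_real by (simp add: sum_nonneg)
  moreover have "(\<Sum>t\<in>S. \<tau> / 2 * N) \<le> (\<Sum>t\<in>S. cmod (F t))" by (intro sum_mono) (auto simp: S_def)
  ultimately have 2: "real (card S) * (\<tau> / 2 * N) \<le> (\<Sum>x\<in>B. cmod (G x))"
    using norm_sum[of G B] by simp
  define B1 where "B1 = {x \<in> B. \<tau> / 4 * real (card S) \<le> cmod (G x)}"
  have "(\<Sum>x\<in>B. cmod (G x)) \<le> (\<Sum>x\<in>B. (if x \<in> B1 then real (card S) else 0) + \<tau> / 4 * real (card S))"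
    using Gle \<tau> by (intro sum_mono) (auto simp: B1_def add_increasing2)
  also have "\<dots> = (\<Sum>x\<in>B. if x \<in> B1 then real (card S) else 0) + N * (\<tau> / 4 * real (card S))"
    by (simp add: sum.distrib N_def)
  also have "(\<Sum>x\<in>B. if x \<in> B1 then real (card S) else 0) = real (card B1) * real (card S)"
  proof -
    have "B \<inter> B1 = B1" by (auto simp: B1_def)
    then show ?thesis using B by (simp add: sum.If_cases)
  qed
  finally have "real (card S) * (\<tau> / 2 * N) \<le> real (card B1) * real (card S) + N * (\<tau> / 4 * real (card S))"
    using 2 by linarith
  then have "real (card S) * (\<tau> * N) \<le> real (card S) * (4 * real (card B1))" by (simp add: algebra_simps)
  then have "\<tau> * N \<le> 4 * real (card B1)" using cS by simp
  then show thesis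
    using Sne a1 cardS by (intro that[of S a]) (auto simp: S_def B1_def G_def N_def)
qed

lemma sum_shift:
  fixes h :: "int \<Rightarrow> 'b::comm_monoid_add"
  assumes M: "M > 0" and h: "\<And>n. h (n mod int M) = h n"
  shows "(\<Sum>t\<in>{0..<int M}. h (t - c)) = (\<Sum>t\<in>{0..<int M}. h t)"
proof -
  have inj: "inj_on (\<lambda>t. (t - c) mod int M) {0..<int M}"
  proof (rule inj_onI)
    fix a b assume ab: "a \<in> {0..<int M}" "b \<in> {0..<int M}" "(a - c) mod int M = (b - c) mod int M"
    then have "int M dvd a - b" by (simp add: mod_eq_dvd_iff)
    then have "a mod int M = b mod int M" by (simp add: mod_eq_dvd_iff)
    then show "a = b" using ab by simp
  qed
  have "(\<lambda>t. (t - c) mod int M) ` {0..<int M} = {0..<int M}"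
    using inj M by (intro endo_inj_surj) auto
  then have "(\<Sum>t\<in>{0..<int M}. h t) = (\<Sum>t\<in>{0..<int M}. h ((t - c) mod int M))"
    using sum.reindex[OF inj, of h] by simp
  then show ?thesis by (simp add: h)
qed

lemma sum_grid_shift:
  fixes h :: "int \<times> int \<Rightarrow> real"
  assumes M: "M > 0" and h: "\<And>m n. h (m mod int M, n) = h (m, n)" "\<And>m n. h (m, n mod int M) = h (m, n)"
  shows "(\<Sum>z\<in>grid M. h (fst z - c, snd z - d)) = (\<Sum>z\<in>grid M. h z)"
proof -
  have "(\<Sum>z\<in>grid M. h (fst z - c, snd z - d)) = (\<Sum>t\<in>{0..<int M}. \<Sum>u\<in>{0..<int M}. h (t - c, u - d))"
    unfolding grid_def by (subst sum.cartesian_product) (simp add: case_prod_unfold)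
  also have "\<dots> = (\<Sum>t\<in>{0..<int M}. \<Sum>u\<in>{0..<int M}. h (t - c, u))"
    using h by (intro sum.cong refl sum_shift[OF M, where h = "\<lambda>u. h (_, u)"]) auto
  also have "\<dots> = (\<Sum>t\<in>{0..<int M}. \<Sum>u\<in>{0..<int M}. h (t, u))"
    using h by (intro sum_shift[OF M, where h = "\<lambda>t. \<Sum>u\<in>{0..<int M}. h (t, u)"]) auto
  also have "\<dots> = (\<Sum>z\<in>grid M. h z)"
    unfolding grid_def by (subst sum.cartesian_product) (simp add: case_prod_unfold)
  finally show ?thesis .
qed

text \<open>If every subset has large energy with respect to \<open>f\<close> and to \<open>g\<close> separately, then some
  large subset correlates with many characters of both kinds simultaneously, so that its
  joint energy is large as well.\<close>

lemma joint_energy_lower: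
  fixes f g :: "'a \<Rightarrow> int"
  assumes M: "M > 0" and s: "s \<ge> 1" and k: "k \<ge> 1" and A: "finite A" "A \<noteq> {}" and \<tau>: "0 < \<tau>"
    and hf: "\<And>B. B \<subseteq> A \<Longrightarrow> B \<noteq> {} \<Longrightarrow> \<tau> * real (card B) \<le> nrm (2 * s) M f (\<lambda>_. 0) B"
    and hg: "\<And>B. B \<subseteq> A \<Longrightarrow> B \<noteq> {} \<Longrightarrow> \<tau> * real (card B) \<le> nrm (2 * s) M g (\<lambda>_. 0) B"
  obtains B where "B \<subseteq> A" "\<tau>\<^sup>2 * real (card A) \<le> 16 * real (card B)"
    "\<tau> ^ (4 * s) * ((\<tau> / 4) ^ 4 * real (card B)) ^ (2 * k) \<le> 4 * energy (2 * k) M f g B"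
proof -
  obtain S a where S: "S \<subseteq> {0..<int M}" "S \<noteq> {}" "\<forall>t. cmod (a t) \<le> 1"
    "\<tau> ^ (2 * s) * real M \<le> 2 * real (card S)"
    "\<tau> * real (card A) \<le> 4 * real (card {x \<in> A. \<tau> / 4 * real (card S) \<le> cmod (\<Sum>t\<in>S. a t * ee M (t * f x))})"
    by (rule exists_large_spectrum[OF M s A \<tau> hf[OF order_refl A(2)]])
  define B1 where "B1 = {x \<in> A. \<tau> / 4 * real (card S) \<le> cmod (\<Sum>t\<in>S. a t * ee M (t * f x))}"
  have B1: "B1 \<subseteq> A" "finite B1" "\<tau> * real (card A) \<le> 4 * real (card B1)" using A S(5) by (auto simp: B1_def)
  have "0 < \<tau> * real (card A)" using \<tau> A by (simp add: card_gt_0_iff)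
  then have "0 < real (card B1)" using B1(3) by linarith
  then have B1ne: "B1 \<noteq> {}" by auto
  obtain S' b where S': "S' \<subseteq> {0..<int M}" "S' \<noteq> {}" "\<forall>t. cmod (b t) \<le> 1"
    "\<tau> ^ (2 * s) * real M \<le> 2 * real (card S')"
    "\<tau> * real (card B1) \<le> 4 * real (card {x \<in> B1. \<tau> / 4 * real (card S') \<le> cmod (\<Sum>t\<in>S'. b t * ee M (t * g x))})"
    by (rule exists_large_spectrum[OF M s B1(2) B1ne \<tau> hg[OF B1(1) B1ne]])
  define B where "B = {x \<in> B1. \<tau> / 4 * real (card S') \<le> cmod (\<Sum>t\<in>S'. b t * ee M (t * g x))}"
  have BA: "B \<subseteq> A" using B1 by (auto simp: B_def)
  have finB: "finite B" using BA A finite_subset by blast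
  have Bcard: "\<tau> * real (card B1) \<le> 4 * real (card B)" using S'(5) by (simp add: B_def)
  have "\<tau> * (\<tau> * real (card A)) \<le> \<tau> * (4 * real (card B1))" using B1(3) \<tau> by (intro mult_left_mono) auto
  then have size: "\<tau>\<^sup>2 * real (card A) \<le> 16 * real (card B)" using Bcard by (simp add: power2_eq_square)
  have finS: "finite S" "finite S'" using finite_subset[OF S(1)] finite_subset[OF S'(1)] by simp_all
  \<comment> \<open>On the product of the two spectra, with product phases, \<open>H\<close> factors
    into the two correlations, both of which are large on \<open>B\<close>.\<close>
  define P where "P = S \<times> S'"
  have P: "finite P" "P \<noteq> {}" "P \<subseteq> grid M" using finS S S' by (auto simp: P_def grid_def)
  have cP: "real (card P) = real (card S) * real (card S')" by (simp add: P_def card_cartesian_product)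
  have cPpos: "0 < real (card P)" using P by (simp add: card_gt_0_iff)
  define c where "c = (\<lambda>w. a (fst w) * b (snd w))"
  have c1: "cmod (c w) \<le> 1" for w
    unfolding c_def norm_mult using S(3) S'(3) by (intro mult_le_one) auto
  define H where "H = (\<lambda>x. \<Sum>w\<in>P. c w * ee M (fst w * f x + snd w * g x))"
  have Hlow: "(\<tau> / 4)\<^sup>2 * real (card P) \<le> cmod (H x)" if x: "x \<in> B" for x
  proof -
    have "H x = (\<Sum>t\<in>S. a t * ee M (t * f x)) * (\<Sum>u\<in>S'. b u * ee M (u * g x))"
      unfolding H_def P_def sum_product
      by (subst sum.cartesian_product) (auto intro!: sum.cong simp: c_def ee_add)
    moreover have "(\<tau> / 4 * real (card S)) * (\<tau> / 4 * real (card S')) \<le>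
        cmod (\<Sum>t\<in>S. a t * ee M (t * f x)) * cmod (\<Sum>u\<in>S'. b u * ee M (u * g x))"
      using x \<tau> by (intro mult_mono) (auto simp: B_def B1_def)
    ultimately show ?thesis by (simp add: norm_mult cP power2_eq_square mult_ac)
  qed
  define h where "h = (\<lambda>w1 w2. cmod (ft M f g B (fst w1 - fst w2, snd w1 - snd w2)))"
  \<comment> \<open>Opening the square and summing over x first leaves the joint transform of
    \<open>B\<close> at differences of frequencies from \<open>P\<close>, so the transform is large
    on average over these differences.\<close>
  have "(\<Sum>x\<in>B. ((\<tau> / 4)\<^sup>2 * real (card P))\<^sup>2) \<le> (\<Sum>x\<in>B. (cmod (H x))\<^sup>2)"
    using Hlow \<tau> by (intro sum_mono power_mono) auto
  also have "\<dots> \<le> (\<Sum>q\<in>P \<times> P. h (fst q) (snd q))"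
  proof -
    have sq: "complex_of_real ((cmod (H x))\<^sup>2) =
        (\<Sum>w1\<in>P. \<Sum>w2\<in>P. c w1 * cnj (c w2) * ee M ((fst w1 - fst w2) * f x + (snd w1 - snd w2) * g x))" for x
      unfolding complex_norm_square H_def cnj_sum complex_cnj_mult cnj_ee sum_product
    proof (intro sum.cong refl)
      fix w1 w2 :: "int \<times> int"
      have "ee M ((fst w1 - fst w2) * f x + (snd w1 - snd w2) * g x) =
          ee M (fst w1 * f x + snd w1 * g x) * ee M (- (fst w2 * f x + snd w2 * g x))"
        unfolding ee_add[symmetric] by (rule arg_cong[where f = "ee M"]) (simp add: algebra_simps)
      then show "c w1 * ee M (fst w1 * f x + snd w1 * g x) * (cnj (c w2) * ee M (- (fst w2 * f x + snd w2 * g x))) =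
        c w1 * cnj (c w2) * ee M ((fst w1 - fst w2) * f x + (snd w1 - snd w2) * g x)" by simp
    qed
    have "complex_of_real (\<Sum>x\<in>B. (cmod (H x))\<^sup>2) =
        (\<Sum>x\<in>B. \<Sum>w1\<in>P. \<Sum>w2\<in>P. c w1 * cnj (c w2) * ee M ((fst w1 - fst w2) * f x + (snd w1 - snd w2) * g x))"
      unfolding of_real_sum sq ..
    also have "\<dots> = (\<Sum>w1\<in>P. \<Sum>w2\<in>P. \<Sum>x\<in>B. c w1 * cnj (c w2) * ee M ((fst w1 - fst w2) * f x + (snd w1 - snd w2) * g x))"
      by (subst sum.swap, rule sum.cong[OF refl], rule sum.swap)
    also have "\<dots> = (\<Sum>w1\<in>P. \<Sum>w2\<in>P. c w1 * cnj (c w2) * ft M f g B (fst w1 - fst w2, snd w1 - snd w2))"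
      by (simp add: ft_def sum_distrib_left)
    also have "\<dots> = (\<Sum>q\<in>P \<times> P. c (fst q) * cnj (c (snd q)) * ft M f g B (fst (fst q) - fst (snd q), snd (fst q) - snd (snd q)))"
      by (subst sum.cartesian_product) (simp add: case_prod_unfold)
    finally have "cmod (complex_of_real (\<Sum>x\<in>B. (cmod (H x))\<^sup>2)) \<le>
       (\<Sum>q\<in>P \<times> P. cmod (c (fst q) * cnj (c (snd q)) * ft M f g B (fst (fst q) - fst (snd q), snd (fst q) - snd (snd q))))"
      by (simp only: norm_sum)
    also have "\<dots> \<le> (\<Sum>q\<in>P \<times> P. h (fst q) (snd q))"
    proof (rule sum_mono)
      fix q :: "(int \<times> int) \<times> (int \<times> int)"
      have "cmod (c (fst q)) * cmod (c (snd q)) * h (fst q) (snd q) \<le> 1 * h (fst q) (snd q)"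
        using c1 by (intro mult_right_mono mult_le_one) (auto simp: h_def)
      then show "cmod (c (fst q) * cnj (c (snd q)) * ft M f g B (fst (fst q) - fst (snd q), snd (fst q) - snd (snd q)))
          \<le> h (fst q) (snd q)" by (simp add: norm_mult h_def)
    qed
    finally show ?thesis unfolding norm_of_real by linarith
  qed
  finally have 1: "real (card B) * ((\<tau> / 4)\<^sup>2 * real (card P))\<^sup>2 \<le> (\<Sum>q\<in>P \<times> P. h (fst q) (snd q))" by simp
  have "(\<tau> / 4) ^ 4 * real (card B) \<le> mean (P \<times> P) (\<lambda>q. h (fst q) (snd q))"
  proof -
    have eq: "(\<tau> / 4) ^ 4 * real (card B) * (real (card P) * real (card P)) = real (card B) * ((\<tau> / 4)\<^sup>2 * real (card P))\<^sup>2"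
      by (simp only: power_mult_distrib power2_eq_square power4_eq_xxxx mult_ac)
    have "(\<tau> / 4) ^ 4 * real (card B) * (real (card P) * real (card P)) \<le> (\<Sum>q\<in>P \<times> P. h (fst q) (snd q))"
      unfolding eq by (rule 1)
    moreover have "0 < real (card P) * real (card P)" using cPpos by simp
    ultimately have "(\<tau> / 4) ^ 4 * real (card B) \<le> (\<Sum>q\<in>P \<times> P. h (fst q) (snd q)) / (real (card P) * real (card P))"
      by (simp only: pos_le_divide_eq)
    then show ?thesis by (simp only: mean_def card_cartesian_product of_nat_mult)
  qed
  also have "\<dots> \<le> root (2 * k) (mean (P \<times> P) (\<lambda>q. h (fst q) (snd q) ^ (2 * k)))"
    using mean_prod_le_prod_root[of "P \<times> P" "{0::nat}" "2 * k" "\<lambda>_ q. h (fst q) (snd q)"] P k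
    by (simp add: h_def)
  finally have 2: "((\<tau> / 4) ^ 4 * real (card B)) ^ (2 * k) \<le> mean (P \<times> P) (\<lambda>q. h (fst q) (snd q) ^ (2 * k))"
  proof -
    assume r: "(\<tau> / 4) ^ 4 * real (card B) \<le> root (2 * k) (mean (P \<times> P) (\<lambda>q. h (fst q) (snd q) ^ (2 * k)))"
    have m0: "0 \<le> mean (P \<times> P) (\<lambda>q. h (fst q) (snd q) ^ (2 * k))" by (intro mean_nonneg) (auto simp: h_def)
    have "((\<tau> / 4) ^ 4 * real (card B)) ^ (2 * k) \<le> root (2 * k) (mean (P \<times> P) (\<lambda>q. h (fst q) (snd q) ^ (2 * k))) ^ (2 * k)"
      using r \<tau> by (intro power_mono) auto
    then show ?thesis using m0 k by simp
  qed
  define E where "E = energy (2 * k) M f g B"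
  have E0: "0 \<le> E" by (simp add: E_def energy_nonneg)
  have gridE: "(\<Sum>z\<in>grid M. cmod (ft M f g B z) ^ (2 * k)) = (real M)\<^sup>2 * E"
    using M by (simp add: E_def energy_def mean_def power2_eq_square)
  \<comment> \<open>For fixed \<open>w2\<close> the differences run injectively through residues of
    the grid, so each inner sum is at most the full moment M^2 E. After division by (card P)^2 only
    the density of \<open>P\<close> is lost.\<close>
  have "(\<Sum>q\<in>P \<times> P. h (fst q) (snd q) ^ (2 * k)) = (\<Sum>w1\<in>P. \<Sum>w2\<in>P. h w1 w2 ^ (2 * k))"
    by (subst sum.cartesian_product) (simp add: case_prod_unfold)
  also have "\<dots> = (\<Sum>w2\<in>P. \<Sum>w1\<in>P. h w1 w2 ^ (2 * k))" by (rule sum.swap)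
  also have "\<dots> \<le> (\<Sum>w2\<in>P. (real M)\<^sup>2 * E)"
  proof (rule sum_mono)
    fix w2
    have "(\<Sum>w1\<in>P. h w1 w2 ^ (2 * k)) \<le> (\<Sum>w1\<in>grid M. h w1 w2 ^ (2 * k))"
      using P by (intro sum_mono2) (auto simp: h_def)
    also have "\<dots> = (\<Sum>z\<in>grid M. cmod (ft M f g B z) ^ (2 * k))"
      unfolding h_def using sum_grid_shift[OF M, of "\<lambda>z. cmod (ft M f g B z) ^ (2 * k)" "fst w2" "snd w2"] M
      by (simp add: ft_mod)
    finally show "(\<Sum>w1\<in>P. h w1 w2 ^ (2 * k)) \<le> (real M)\<^sup>2 * E" unfolding gridE .
  qed
  also have "\<dots> = real (card P) * ((real M)\<^sup>2 * E)" by simp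
  finally have "mean (P \<times> P) (\<lambda>q. h (fst q) (snd q) ^ (2 * k)) \<le> real (card P) * ((real M)\<^sup>2 * E) / (real (card P) * real (card P))"
    unfolding mean_def card_cartesian_product of_nat_mult by (rule divide_right_mono) simp
  also have "\<dots> = (real M)\<^sup>2 * E / real (card P)" using cPpos by simp
  finally have 3: "((\<tau> / 4) ^ 4 * real (card B)) ^ (2 * k) * real (card P) \<le> (real M)\<^sup>2 * E"
    using 2 cPpos by (simp add: pos_le_divide_eq[symmetric])
  have "(\<tau> ^ (2 * s) * real M) * (\<tau> ^ (2 * s) * real M) \<le> (2 * real (card S)) * (2 * real (card S'))"
    by (rule mult_mono[OF S(4) S'(4)]) (use \<tau> in auto)
  then have 4: "\<tau> ^ (4 * s) * (real M)\<^sup>2 \<le> 4 * real (card P)"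
  proof -
    have "\<tau> ^ (4 * s) = \<tau> ^ (2 * s) * \<tau> ^ (2 * s)" by (simp flip: power_add)
    then show ?thesis using \<open>_ \<le> (2 * real (card S)) * (2 * real (card S'))\<close>
      by (simp add: cP power2_eq_square algebra_simps)
  qed
  let ?Y = "((\<tau> / 4) ^ 4 * real (card B)) ^ (2 * k)"
  have Y0: "0 \<le> ?Y" using \<tau> by (intro zero_le_power) auto
  have "?Y * (\<tau> ^ (4 * s) * (real M)\<^sup>2) \<le> ?Y * (4 * real (card P))" using 4 Y0 by (intro mult_left_mono)
  also have "\<dots> \<le> 4 * ((real M)\<^sup>2 * E)" using 3 by simp
  finally have "(real M)\<^sup>2 * (\<tau> ^ (4 * s) * ?Y) \<le> (real M)\<^sup>2 * (4 * E)" by (simp only: mult_ac)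
  then have "\<tau> ^ (4 * s) * ?Y \<le> 4 * E" using M by (simp only: mult_le_cancel_left_pos zero_less_power of_nat_0_less_iff)
  then show thesis using BA size by (intro that[of B]) (auto simp: E_def)
qed

section \<open>The dichotomy between Sidon sets for two functions\<close>

lemma sidon_singleton: "sidon s f {b}"
  unfolding sidon_def
proof (intro allI impI, elim conjE)
  fix xs ys assume "length xs = s" "set xs \<subseteq> {b}" "length ys = s" "set ys \<subseteq> {b}"
  then have "xs = replicate s b" "ys = replicate s b"
    by (auto intro!: replicate_eqI)
  then show "mset xs = mset ys" by simp
qed

text \<open>\<open>f\<close> supplies the tree, since the coordinates \<open>vs\<close> respect its
  relations, and by \<open>cls\<close> each coordinate decouples the joint 2k-norm at the price D =
  4 R^2 k^2. As \<mu> is the fourth power of D, tree points that carry a total weight of about sqrt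
  n cost only about n^(1/8) in the joint norm, too little for the correlation forced by small Sidon
  sets.\<close>

lemma (in tree_params) sidon_dichotomy:
  fixes f g :: "'a \<Rightarrow> int" and cl :: "('a \<Rightarrow> int) \<Rightarrow> int \<Rightarrow> 'c"
  assumes k: "k \<ge> 1" and R: "R \<ge> 1" and alpha_eq: "\<alpha> = real k / 5" and mu_eq: "\<mu> = (4 * (real R)\<^sup>2 * (real k)\<^sup>2) ^ 4"
    and A: "finite A" "A \<noteq> {}" and M: "prime M" "M > 2 * s"
    and rel: "\<And>v x. v \<in> set vs \<Longrightarrow> x \<in> relations M {..<2 * s} (sgn2 s) f (\<lambda>_. 0) (\<lambda>_. A) \<Longrightarrow>
        (\<Sum>i<2 * s. sgn2 s i * v (x i)) = 0"
    and dist: "\<And>v x y. v \<in> set vs \<Longrightarrow> x \<in> A \<Longrightarrow> y \<in> A \<Longrightarrow> v x \<noteq> v y \<Longrightarrow> \<not> int M dvd v x - v y"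
    and cls: "\<And>v. v \<in> set vs \<Longrightarrow> card (cl v ` v ` A) \<le> R"
      "\<And>v x c. v \<in> set vs \<Longrightarrow> x \<in> relations M {..<2 * k} (sgn2 k) f g (\<lambda>_. {y \<in> A. cl v (v y) = c}) \<Longrightarrow>
        \<exists>a<2 * k. \<exists>b<2 * k. a \<noteq> b \<and> v (x a) = v (x b)"
    and inj: "\<And>x y. x \<in> A \<Longrightarrow> y \<in> A \<Longrightarrow> (\<forall>v\<in>set vs. v x = v y) \<Longrightarrow> x = y"
  shows "\<exists>X\<subseteq>A. X \<noteq> {} \<and> (sidon s f X \<or> sidon s g X) \<and>
    1 / (32 * real s * 2 ^ 160) * real (card A) powr (real k / 20 / real s) \<le> real (card X)"
proof (rule ccontr)
  assume contra: "\<not> ?thesis"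
  define n where "n = real (card A)"
  define p where "p = real k / 20 / real s"
  define c where "c = 1 / (32 * real s * (2 ^ 160 :: real))"
  have n1: "1 \<le> n" using A by (simp add: n_def Suc_le_eq card_gt_0_iff)
  have Mpos: "M > 0" using M by simp
  have s1: "real s \<ge> 1" using s by simp
  have k1: "real k \<ge> 1" using k by simp
  have small_X: "real (card X) < c * n powr p" if "X \<subseteq> A" "X \<noteq> {}" "sidon s f X \<or> sidon s g X" for X
    using contra that unfolding c_def n_def p_def by (meson not_le)
  \<comment> \<open>Hence p = k/(20 s) \<le> 1/400, and the ten factors \<tau> lost below cost at
    most n^(1/40).\<close>
  have sk: "20 * real k \<le> real s"
    using alpha_le' sqrt_s_le k1 unfolding alpha_eq by linarith
  have p0: "0 < p" and p40: "10 * p \<le> 1/40"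
    using sk s1 k1 by (simp_all add: p_def field_simps)
  \<comment> \<open>Up to n = 2^160 the constant makes the claimed bound at most 1, which a
    singleton meets.\<close>
  have nbig: "2 ^ 160 < n"
  proof (rule ccontr)
    assume "\<not> 2 ^ 160 < n"
    then have "n \<le> 2 ^ 160" by simp
    moreover have "n powr p \<le> n powr 1" using n1 p40 by (intro powr_mono) linarith+
    ultimately have "n powr p \<le> 2 ^ 160" using n1 by simp
    then have "c * n powr p \<le> c * 2 ^ 160" using s1 by (intro mult_left_mono) (auto simp: c_def)
    also have "\<dots> \<le> 1" using s1 by (simp add: c_def)
    finally have "c * n powr p \<le> 1" .
    moreover obtain b where "b \<in> A" using A by blast
    ultimately show False using small_X[of "{b}"] sidon_singleton[of s f b] by simp
  qed
  define \<tau> where "\<tau> = n powr (- p)"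
  have tau: "0 < \<tau>" using n1 by (simp add: \<tau>_def)
  have large: "\<tau> * real (card B) \<le> nrm (2 * s) M h (\<lambda>_. 0) B"
    if B: "B \<subseteq> A" "B \<noteq> {}" and h: "h = f \<or> h = g" for B h
  proof -
    have finB: "finite B" using B A finite_subset by blast
    obtain X where X: "X \<subseteq> B" "sidon s h X" "X \<noteq> {}"
      "real (card B) \<le> 32 * real s * real (card X) * nrm (2 * s) M h (\<lambda>_. 0) B"
      by (rule exists_large_sidon[OF M s finB B(2)])
    have "real (card X) < c * n powr p" using X B h by (intro small_X) auto
    then have "32 * real s * real (card X) \<le> 32 * real s * (c * n powr p)" using s1 by (intro mult_left_mono) auto
    also have "\<dots> = n powr p / 2 ^ 160" using s1 by (simp add: c_def)
    also have "\<dots> \<le> n powr p" by simp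
    finally have "32 * real s * real (card X) * nrm (2 * s) M h (\<lambda>_. 0) B \<le> n powr p * nrm (2 * s) M h (\<lambda>_. 0) B"
      by (intro mult_right_mono nrm_nonneg)
    then have "real (card B) \<le> n powr p * nrm (2 * s) M h (\<lambda>_. 0) B" using X(4) by linarith
    then have "\<tau> * real (card B) \<le> \<tau> * (n powr p * nrm (2 * s) M h (\<lambda>_. 0) B)" using tau by (intro mult_left_mono) auto
    also have "\<dots> = (\<tau> * n powr p) * nrm (2 * s) M h (\<lambda>_. 0) B" by simp
    also have "\<tau> * n powr p = 1" using n1 by (simp add: \<tau>_def flip: powr_add)
    finally show ?thesis by simp
  qed
  define D where "D = 4 * (real R)\<^sup>2 * (real k)\<^sup>2"
  have D4: "4 \<le> D"
  proof -
    have "1 * 1 \<le> (real R)\<^sup>2 * (real k)\<^sup>2" using R k by (intro mult_mono) auto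
    then show ?thesis by (simp add: D_def)
  qed
  define J where "J = (\<lambda>C. (nrm (2 * k) M f g C)\<^sup>2)"
  have "\<exists>B' h. B' \<subseteq> A \<and> B' \<noteq> {} \<and> (\<forall>C\<subseteq>B'. J C \<le> (\<Sum>x\<in>C. D ^ h x)) \<and>
    energy (2 * s) M f (\<lambda>_. 0) A \<le> real (card A) powr (2 * real s - \<alpha>) * (\<Sum>x\<in>B'. (1 / \<mu>) ^ h x) powr \<alpha>"
  proof (rule exists_tree_subset[OF M(1) _ _ _ _ _ A(1) _ order_refl A(2) inj])
    show "M \<ge> s" "M \<ge> 3" using M s by auto
    show "0 \<le> D" using D4 by simp
    show "J {} \<le> 0" using k by (simp add: J_def nrm_empty)
    show "J {x} \<le> 1" for x
    proof -
      have "nrm (2 * k) M f g {x} \<le> 1" using nrm_le_card[of "2 * k" M f g "{x}"] k Mpos by simp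
      then show ?thesis unfolding J_def by (intro power_le_one nrm_nonneg)
    qed
    fix v assume v: "v \<in> set vs"
    have "J B \<le> D * (\<Sum>j\<in>v ` B. J {x \<in> B. v x = j})" if B: "B \<subseteq> A" for B
      unfolding J_def D_def
    proof (rule nrm_decouple[OF Mpos _ k])
      show finB: "finite B" using B A finite_subset by blast
      have "card (cl v ` v ` B) \<le> card (cl v ` v ` A)" using A B by (intro card_mono) auto
      then show "card (cl v ` v ` B) \<le> R" using cls(1)[OF v] by simp
      fix x c assume "x \<in> relations M {..<2 * k} (sgn2 k) f g (\<lambda>_. {y \<in> B. cl v (v y) = c})"
      then have "x \<in> relations M {..<2 * k} (sgn2 k) f g (\<lambda>_. {y \<in> A. cl v (v y) = c})"
        using B by (auto simp: relations_def PiE_iff)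
      then show "\<exists>a<2 * k. \<exists>b<2 * k. a \<noteq> b \<and> v (x a) = v (x b)" by (rule cls(2)[OF v])
    qed
    then show "(\<forall>x\<in>relations M {..<2 * s} (sgn2 s) f (\<lambda>_. 0) (\<lambda>_. A). (\<Sum>i<2 * s. sgn2 s i * v (x i)) = 0) \<and>
        (\<forall>x\<in>A. \<forall>y\<in>A. v x \<noteq> v y \<longrightarrow> \<not> int M dvd v x - v y) \<and>
        (\<forall>B\<subseteq>A. J B \<le> D * (\<Sum>j\<in>v ` B. J {x \<in> B. v x = j}))"
      using rel[OF v] dist[OF v] by blast
  qed auto
  then obtain B' h where B': "B' \<subseteq> A" "B' \<noteq> {}" "\<forall>C\<subseteq>B'. J C \<le> (\<Sum>x\<in>C. D ^ h x)"
    and en: "energy (2 * s) M f (\<lambda>_. 0) A \<le> n powr (2 * real s - \<alpha>) * (\<Sum>x\<in>B'. (1 / \<mu>) ^ h x) powr \<alpha>"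
    unfolding n_def by blast
  define q where "q = (\<Sum>x\<in>B'. (1 / \<mu>) ^ h x)"
  have mu: "\<mu> = D ^ 4" by (simp add: mu_eq D_def)
  have mu2: "2 \<le> \<mu>"
  proof -
    have "(4::real) ^ 4 \<le> D ^ 4" using D4 by (intro power_mono) auto
    then show ?thesis by (simp add: mu)
  qed
  have finB': "finite B'" using B'(1) A finite_subset by blast
  have qpos: "0 < q" unfolding q_def using finB' B'(2) mu2 by (intro sum_pos) auto
  \<comment> \<open>Since 2 s p = k/10 = \<alpha>/2, the lower bound for the energy is n^(2s -
    \<alpha>) n^(\<alpha>/2); comparison with the tree bound leaves n^(\<alpha>/2) \<le>
    q^\<alpha>.\<close>
  have q_ge: "sqrt n \<le> q"
  proof -
    have "(\<tau> * n) ^ (2 * s) \<le> nrm (2 * s) M f (\<lambda>_. 0) A ^ (2 * s)"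
      using large[of A f] A tau n1 unfolding n_def by (intro power_mono) auto
    also have "\<dots> \<le> n powr (2 * real s - \<alpha>) * q powr \<alpha>" using en s by (simp add: nrm_power q_def)
    finally have 1: "(\<tau> * n) ^ (2 * s) \<le> n powr (2 * real s - \<alpha>) * q powr \<alpha>" .
    have "\<tau> * n = n powr (1 - p)" using n1 by (simp add: \<tau>_def powr_diff powr_minus field_simps)
    then have "(\<tau> * n) ^ (2 * s) = n powr ((1 - p) * real (2 * s))"
      using n1 by (simp add: powr_powr flip: powr_realpow)
    also have "(1 - p) * real (2 * s) = (2 * real s - \<alpha>) + \<alpha> / 2"
      using s1 by (simp add: p_def alpha_eq field_simps)
    also have "n powr ((2 * real s - \<alpha>) + \<alpha> / 2) = n powr (2 * real s - \<alpha>) * n powr (\<alpha> / 2)" by (rule powr_add)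
    finally have "n powr (2 * real s - \<alpha>) * n powr (\<alpha> / 2) \<le> n powr (2 * real s - \<alpha>) * q powr \<alpha>" using 1 by simp
    then have "n powr (\<alpha> / 2) \<le> q powr \<alpha>" using n1 by simp
    moreover have "n powr (\<alpha> / 2) = sqrt n powr \<alpha>" using n1 by (simp add: powr_powr flip: powr_half_sqrt)
    ultimately have "sqrt n powr \<alpha> \<le> q powr \<alpha>" by simp
    then show ?thesis using alpha qpos n1 by (meson not_le powr_less_mono2 real_sqrt_ge_zero less_imp_le order_trans zero_le_one)
  qed
  \<comment> \<open>Points deeper than \<open>H\<close> weigh less than 1/(2 sqrt n) each, hence at
    most (sqrt n)/2 together, so at least (sqrt n)/2 points have depth at most
    \<open>H\<close>.\<close>
  obtain H where H: "\<mu> ^ H \<le> 2 * sqrt n" "2 * sqrt n < \<mu> ^ Suc H"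
  proof -
    have ex: "\<exists>m. 2 * sqrt n < \<mu> ^ m" using mu2 by (intro real_arch_pow) simp
    define m where "m = (LEAST m. 2 * sqrt n < \<mu> ^ m)"
    have m: "2 * sqrt n < \<mu> ^ m" unfolding m_def using ex by (rule LeastI_ex)
    have sq1: "1 \<le> sqrt n" using n1 by simp
    have "m \<noteq> 0"
    proof
      assume "m = 0"
      then have "2 * sqrt n < 1" using m by simp
      then show False using sq1 by linarith
    qed
    then obtain H where mH: "m = Suc H" by (cases m) auto
    have "\<not> 2 * sqrt n < \<mu> ^ H" using not_less_Least[of H "\<lambda>m. 2 * sqrt n < \<mu> ^ m"] mH by (simp add: m_def)
    then show thesis using that[of H] m mH by simp
  qed
  define A2 where "A2 = {x \<in> B'. h x \<le> H}"
  have A2: "A2 \<subseteq> B'" "finite A2" using finB' by (auto simp: A2_def)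
  have sqrtn: "0 < sqrt n" "sqrt n * sqrt n = n" using n1 by auto
  have cA2: "sqrt n \<le> 2 * real (card A2)"
  proof -
    have "q = (\<Sum>x\<in>A2. (1 / \<mu>) ^ h x) + (\<Sum>x\<in>B' - A2. (1 / \<mu>) ^ h x)"
      unfolding q_def using finB' A2 by (subst sum.subset_diff[OF A2(1)]) auto
    also have "(\<Sum>x\<in>A2. (1 / \<mu>) ^ h x) \<le> (\<Sum>x\<in>A2. 1)"
      using mu2 by (intro sum_mono power_le_one) auto
    also have "(\<Sum>x\<in>B' - A2. (1 / \<mu>) ^ h x) \<le> (\<Sum>x\<in>B' - A2. 1 / (2 * sqrt n))"
    proof (rule sum_mono)
      fix x assume "x \<in> B' - A2"
      then have "Suc H \<le> h x" by (auto simp: A2_def)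
      then have "(1 / \<mu>) ^ h x \<le> (1 / \<mu>) ^ Suc H" using mu2 by (intro power_decreasing) auto
      also have "\<dots> = 1 / \<mu> ^ Suc H" by (simp only: power_divide power_one)
      also have "\<dots> \<le> 1 / (2 * sqrt n)" using H(2) sqrtn mu2 by (intro divide_left_mono) (auto intro!: mult_pos_pos)
      finally show "(1 / \<mu>) ^ h x \<le> 1 / (2 * sqrt n)" .
    qed
    also have "\<dots> = real (card (B' - A2)) / (2 * sqrt n)" by simp
    also have "\<dots> \<le> n / (2 * sqrt n)"
    proof -
      have "card (B' - A2) \<le> card A" using A B'(1) by (intro card_mono) auto
      then show ?thesis using sqrtn by (intro divide_right_mono) (auto simp: n_def)
    qed
    also have "n / (2 * sqrt n) = sqrt n / 2" using sqrtn n1 by (simp add: field_simps)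
    finally have "q \<le> real (card A2) + sqrt n / 2" by simp
    then show ?thesis using q_ge by linarith
  qed
  have A2ne: "A2 \<noteq> {}" using cA2 sqrtn by auto
  have A2A: "A2 \<subseteq> A" using A2 B' by blast
  have hf: "\<tau> * real (card C) \<le> nrm (2 * s) M f (\<lambda>_. 0) C" if "C \<subseteq> A2" "C \<noteq> {}" for C
    using that A2A by (intro large) auto
  have hg: "\<tau> * real (card C) \<le> nrm (2 * s) M g (\<lambda>_. 0) C" if "C \<subseteq> A2" "C \<noteq> {}" for C
    using that A2A by (intro large) auto
  obtain B where B: "B \<subseteq> A2" "\<tau>\<^sup>2 * real (card A2) \<le> 16 * real (card B)"
    "\<tau> ^ (4 * s) * ((\<tau> / 4) ^ 4 * real (card B)) ^ (2 * k) \<le> 4 * energy (2 * k) M f g B"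
    by (rule joint_energy_lower[OF Mpos s k A2(2) A2ne tau hf hg])
  define m where "m = real (card B)"
  have "0 < \<tau>\<^sup>2 * real (card A2)" using tau A2ne A2 by (simp add: card_gt_0_iff)
  then have m0: "0 < m" using B(2) by (simp add: m_def)
  \<comment> \<open>The largest price of a point of \<open>A2\<close>; because \<mu> = D^4, its
    fourth power is only \<mu>^H \<le> 2 sqrt n.\<close>
  define U where "U = D ^ H"
  have U: "0 < U" "U ^ 4 \<le> 2 * sqrt n"
  proof -
    show "0 < U" using D4 by (simp add: U_def)
    have "U ^ 4 = \<mu> ^ H" by (simp add: U_def mu power_mult[symmetric] mult.commute)
    then show "U ^ 4 \<le> 2 * sqrt n" using H(1) by simp
  qed
  have "J B \<le> (\<Sum>x\<in>B. D ^ h x)" using B'(3) B(1) A2(1) by blast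
  also have "\<dots> \<le> (\<Sum>x\<in>B. U)"
    unfolding U_def using B(1) D4 by (intro sum_mono power_increasing) (auto simp: A2_def)
  finally have "J B \<le> U * m" by (simp add: m_def mult.commute)
  then have "J B ^ k \<le> (U * m) ^ k" by (intro power_mono) (auto simp: J_def)
  moreover have "J B ^ k = energy (2 * k) M f g B"
    unfolding J_def using nrm_power[of "2 * k" M f g B] k by (simp flip: power_mult)
  ultimately have "\<tau> ^ (4 * s) * ((\<tau> / 4) ^ 4 * m) ^ (2 * k) \<le> 4 * (U * m) ^ k"
    using B(3) unfolding m_def by linarith
  \<comment> \<open>Here 4 s p = k/5, so the loss from both spectra is a k-th power and shrinks to
    n^(-1/5) when k-th roots are taken.\<close>
  moreover have "\<tau> ^ (4 * s) = (n powr (- (1/5))) ^ k"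
  proof -
    have "\<tau> ^ (4 * s) = n powr (- p * real (4 * s))" using n1 unfolding \<tau>_def by (simp add: powr_powr flip: powr_realpow)
    also have "- p * real (4 * s) = - (1/5) * real k" using s1 by (simp add: p_def field_simps)
    also have "n powr (- (1/5) * real k) = (n powr (- (1/5))) ^ k" using n1 by (simp add: powr_powr flip: powr_realpow)
    finally show ?thesis .
  qed
  moreover have "(4::real) \<le> 4 ^ k" using k self_le_power[of "4::real" k] by simp
  then have "4 * (U * m) ^ k \<le> 4 ^ k * (U * m) ^ k" using U m0 by (intro mult_right_mono) auto
  ultimately have "(n powr (- (1/5)) * ((\<tau> / 4) ^ 4 * m)\<^sup>2) ^ k \<le> (4 * (U * m)) ^ k"
    by (simp add: power_mult_distrib power_mult)
  then have "n powr (- (1/5)) * ((\<tau> / 4) ^ 4 * m)\<^sup>2 \<le> 4 * (U * m)"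
    using k U m0 by (subst (asm) power_mono_iff) auto
  then have "m * (n powr (- (1/5)) * (\<tau> / 4) ^ 8 * m) \<le> m * (4 * U)"
    by (simp add: power_mult_distrib power2_eq_square algebra_simps flip: power_add)
  then have 1: "n powr (- (1/5)) * (\<tau> / 4) ^ 8 * m \<le> 4 * U" using m0 by simp
  have mlow: "\<tau>\<^sup>2 * sqrt n / 32 \<le> m"
  proof -
    have "\<tau>\<^sup>2 * sqrt n \<le> \<tau>\<^sup>2 * (2 * real (card A2))" using cA2 by (intro mult_left_mono) auto
    then show ?thesis using B(2) by (simp add: m_def)
  qed
  have "n powr (- (1/5)) * (\<tau> / 4) ^ 8 * (\<tau>\<^sup>2 * sqrt n / 32) \<le> n powr (- (1/5)) * (\<tau> / 4) ^ 8 * m"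
    using mlow tau by (intro mult_left_mono) auto
  also have "\<dots> \<le> 4 * U" by (rule 1)
  also have "\<dots> \<le> 4 * (2 * n powr (1/8))"
  proof -
    have "U ^ 4 \<le> (2 * n powr (1/8)) ^ 4"
    proof -
      have "(2 * n powr (1/8)) ^ 4 = 16 * sqrt n"
        using n1 by (simp add: power_mult_distrib powr_half_sqrt powr_powr flip: powr_realpow)
      then show ?thesis using U sqrtn by linarith
    qed
    then have "U \<le> 2 * n powr (1/8)" using U by (subst (asm) power_mono_iff) auto
    then show ?thesis by simp
  qed
  finally have 2: "n powr (- (1/5)) * (\<tau> / 4) ^ 8 * (\<tau>\<^sup>2 * sqrt n / 32) \<le> 8 * n powr (1/8)" by simp
  have "n powr (- (1/5)) * (\<tau> / 4) ^ 8 * (\<tau>\<^sup>2 * sqrt n / 32) = (n powr (- (1/5)) * \<tau> ^ 10 * n powr (1/2)) / 2 ^ 21"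
    using n1 by (simp add: power_divide powr_half_sqrt flip: power_add)
  also have "n powr (- (1/5)) * \<tau> ^ 10 * n powr (1/2) = n powr (3/10 - 10 * p)"
  proof -
    have "\<tau> ^ 10 = n powr (- (10 * p))" using n1 unfolding \<tau>_def by (simp add: powr_powr mult.commute flip: powr_realpow)
    then have "n powr (- (1/5)) * \<tau> ^ 10 * n powr (1/2) = n powr (- (1/5) + - (10 * p) + 1/2)"
      by (simp only: powr_add)
    also have "- (1/5) + - (10 * p) + 1/2 = 3/10 - 10 * p" by simp
    finally show ?thesis .
  qed
  finally have "n powr (3/10 - 10 * p) / 2 ^ 21 \<le> 8 * n powr (1/8)" using 2 by (simp only:)
  \<comment> \<open>3/10 is 1/2 - 1/5, and 3/10 - 1/40 - 1/8 = 3/20. Thus n^(3/20) \<le> 2^24, and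
    24 * 20/3 = 160 is the threshold excluded at the start.\<close>
  then have "n powr (3/10 - 10 * p) \<le> 2 ^ 24 * n powr (1/8)" by simp
  moreover have "n powr (3/10 - 1/40) \<le> n powr (3/10 - 10 * p)" using p40 n1 by (intro powr_mono) auto
  moreover have "n powr (3/10 - 1/40) = n powr (3/20) * n powr (1/8)" by (simp flip: powr_add)
  ultimately have "n powr (3/20) * n powr (1/8) \<le> 2 ^ 24 * n powr (1/8)" by linarith
  then have "n powr (3/20) \<le> 2 ^ 24" using n1 by simp
  then have "(n powr (3/20)) powr (20/3) \<le> (2 ^ 24) powr (20/3)" by (intro powr_mono2) auto
  also have "(n powr (3/20)) powr (20/3) = n" using n1 by (simp add: powr_powr)
  also have "((2::real) ^ 24) powr (20/3) = 2 ^ 160"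
  proof -
    have "((2::real) ^ 24) powr (20/3) = (2 powr 24) powr (20/3)" by simp
    also have "\<dots> = 2 powr 160" by (simp only: powr_powr) simp
    finally show ?thesis by simp
  qed
  finally show False using nbig by simp
qed

section \<open>Integer encodings of valuation vectors\<close>

lemma sum_sgn2:
  fixes h :: "nat \<Rightarrow> int"
  shows "(\<Sum>i<2 * k. sgn2 k i * h i) = (\<Sum>i<k. h i) - (\<Sum>i=k..<2*k. h i)"
proof -
  have eq: "{..<2 * k} = {..<k} \<union> {k..<2 * k}" by auto
  have "(\<Sum>i<2 * k. sgn2 k i * h i) = (\<Sum>i<k. sgn2 k i * h i) + (\<Sum>i=k..<2*k. sgn2 k i * h i)"
    unfolding eq by (rule sum.union_disjoint) auto
  also have "(\<Sum>i<k. sgn2 k i * h i) = (\<Sum>i<k. h i)" by (intro sum.cong) (auto simp: sgn2_def)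
  also have "(\<Sum>i=k..<2*k. sgn2 k i * h i) = (\<Sum>i=k..<2*k. - h i)" by (intro sum.cong) (auto simp: sgn2_def)
  finally show ?thesis by (simp add: sum_negf)
qed

lemma abs_sum_sgn2_le:
  fixes h :: "nat \<Rightarrow> int"
  assumes "\<And>i. i < 2 * m \<Longrightarrow> \<bar>h i\<bar> \<le> b"
  shows "\<bar>\<Sum>i<2 * m. sgn2 m i * h i\<bar> \<le> 2 * int m * b"
proof -
  have "\<bar>\<Sum>i<2 * m. sgn2 m i * h i\<bar> \<le> (\<Sum>i<2 * m. \<bar>sgn2 m i * h i\<bar>)" by (rule sum_abs)
  also have "\<dots> \<le> (\<Sum>i<2 * m. b)" using assms by (intro sum_mono) (auto simp: sgn2_def abs_mult)
  finally show ?thesis by simp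
qed

lemma int_dvd_small_imp_zero: "\<bar>a\<bar> < b \<Longrightarrow> b dvd a \<Longrightarrow> a = (0::int)"
  using dvd_imp_le_int[of a b] by linarith

lemma exists_abs_bound:
  fixes h :: "'a \<Rightarrow> int"
  assumes "finite A"
  obtains b where "b \<ge> 0" "\<forall>x\<in>A. \<bar>h x\<bar> \<le> b"
proof
  show "(\<Sum>x\<in>A. \<bar>h x\<bar>) \<ge> 0" by (intro sum_nonneg) auto
  show "\<forall>x\<in>A. \<bar>h x\<bar> \<le> (\<Sum>x\<in>A. \<bar>h x\<bar>)" using assms by (auto intro!: member_le_sum)
qed

lemma exists_encoding:
  fixes vs :: "('a \<Rightarrow> int) list"
  assumes "finite A"
  shows "\<exists>f::'a \<Rightarrow> int. (\<forall>xs ys. (\<forall>v\<in>set vs. sum_list (map v xs) = sum_list (map v ys)) \<longrightarrow>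
      sum_list (map f xs) = sum_list (map f ys)) \<and>
    (\<forall>m\<le>s. \<forall>x. (\<forall>i<2 * m. x i \<in> A) \<longrightarrow> (\<Sum>i<2 * m. sgn2 m i * f (x i)) = 0 \<longrightarrow>
      (\<forall>v\<in>set vs. (\<Sum>i<2 * m. sgn2 m i * v (x i)) = 0))"
proof (induction vs)
  case Nil
  then show ?case by (intro exI[of _ "\<lambda>_. 0"]) auto
next
  case (Cons v vs)
  then obtain f where f: "\<forall>xs ys. (\<forall>v\<in>set vs. sum_list (map v xs) = sum_list (map v ys)) \<longrightarrow>
      sum_list (map f xs) = sum_list (map f ys)"
    "\<forall>m\<le>s. \<forall>x. (\<forall>i<2 * m. x i \<in> A) \<longrightarrow> (\<Sum>i<2 * m. sgn2 m i * f (x i)) = 0 \<longrightarrow>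
      (\<forall>v\<in>set vs. (\<Sum>i<2 * m. sgn2 m i * v (x i)) = 0)" by blast
  obtain b where b: "b \<ge> 0" "\<forall>x\<in>A. \<bar>v x\<bar> \<le> b" by (rule exists_abs_bound[OF assms])
  define C where "C = 2 * int s * b + 1"
  have C: "C > 0" using b by (simp add: C_def add_nonneg_pos)
  define f' where "f' = (\<lambda>x. v x + C * f x)"
  have "sum_list (map f' xs) = sum_list (map v xs) + C * sum_list (map f xs)" for xs
    by (induction xs) (auto simp: f'_def algebra_simps)
  then have 1: "\<forall>xs ys. (\<forall>v\<in>set (v # vs). sum_list (map v xs) = sum_list (map v ys)) \<longrightarrow>
      sum_list (map f' xs) = sum_list (map f' ys)" using f(1) by auto
  have 2: "\<forall>v\<in>set (v # vs). (\<Sum>i<2 * m. sgn2 m i * v (x i)) = 0"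
    if m: "m \<le> s" and x: "\<forall>i<2 * m. x i \<in> A" and z: "(\<Sum>i<2 * m. sgn2 m i * f' (x i)) = 0" for m x
  proof -
    define a where "a = (\<Sum>i<2 * m. sgn2 m i * v (x i))"
    have eq: "a + C * (\<Sum>i<2 * m. sgn2 m i * f (x i)) = 0"
      using z by (simp add: f'_def a_def sum_distrib_left sum.distrib algebra_simps)
    have "\<bar>a\<bar> \<le> 2 * int m * b" unfolding a_def using x b by (intro abs_sum_sgn2_le) auto
    also have "\<dots> \<le> 2 * int s * b" using m b by (intro mult_right_mono) auto
    finally have "\<bar>a\<bar> < C" by (simp add: C_def)
    moreover have "C dvd a" using eq by (metis dvd_triv_left dvd_add_left_iff dvd_0_right)
    ultimately have a0: "a = 0" by (rule int_dvd_small_imp_zero)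
    then have "(\<Sum>i<2 * m. sgn2 m i * f (x i)) = 0" using eq C by simp
    then have "\<forall>v\<in>set vs. (\<Sum>i<2 * m. sgn2 m i * v (x i)) = 0" using f(2) m x by blast
    then show ?thesis using a0 by (simp add: a_def)
  qed
  show ?case using 1 2 by (intro exI[of _ f'] conjI) blast+
qed

text \<open>A signed sum of at most 2s values is smaller than \<open>M\<close> in absolute value, so
  divisibility by \<open>M\<close> will mean that it is 0.\<close>

lemma exists_large_prime:
  fixes hs :: "('a \<Rightarrow> int) list"
  assumes "finite A"
  obtains M b where "prime M" "M > 2 * s" "0 \<le> b" "\<forall>h\<in>set hs. \<forall>x\<in>A. \<bar>h x\<bar> \<le> b" "2 * int s * b < int M"
proof -
  define b where "b = (\<Sum>h\<in>set hs. \<Sum>x\<in>A. \<bar>h x\<bar>)"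
  obtain M where M: "prime M" "M > nat (2 * int s * b) + 2 * s" using bigger_prime by blast
  show thesis
  proof (rule that[OF M(1)])
    show "M > 2 * s" using M by simp
    show "0 \<le> b" unfolding b_def by (intro sum_nonneg) auto
    show "2 * int s * b < int M" using M(2) by linarith
    show "\<forall>h\<in>set hs. \<forall>x\<in>A. \<bar>h x\<bar> \<le> b"
    proof (intro ballI)
      fix h x assume h: "h \<in> set hs" and x: "x \<in> A"
      have "\<bar>h x\<bar> \<le> (\<Sum>x\<in>A. \<bar>h x\<bar>)" using assms x by (intro member_le_sum) auto
      also have "\<dots> \<le> b" unfolding b_def using h by (intro member_le_sum) (auto intro!: sum_nonneg)
      finally show "\<bar>h x\<bar> \<le> b" .
    qed
  qed
qed

text \<open>Trades congruences for integer relations. The first function becomes an encoding of all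
  coordinates, so the class condition may assume a relation for every coordinate at once together
  with one for \<open>g\<close>; this joint form is what the multiplicative decoupling
  needs.\<close>

lemma (in tree_params) sidon_dichotomy_encoded:
  fixes g :: "'a \<Rightarrow> int" and vs :: "('a \<Rightarrow> int) list"
  assumes k: "k \<ge> 1" and R: "R \<ge> 1" and alpha_eq: "\<alpha> = real k / 5" and mu_eq: "\<mu> = (4 * (real R)\<^sup>2 * (real k)\<^sup>2) ^ 4"
    and A: "finite A" "A \<noteq> {}"
    and cls: "\<And>v. v \<in> set vs \<Longrightarrow> \<exists>cl::int \<Rightarrow> nat \<times> nat \<times> int. card (cl ` v ` A) \<le> R \<and>
      (\<forall>x c. (\<forall>i<2 * k. x i \<in> A \<and> cl (v (x i)) = c) \<longrightarrow> (\<forall>w\<in>set vs. (\<Sum>i<2 * k. sgn2 k i * w (x i)) = 0) \<longrightarrow>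
        (\<Sum>i<2 * k. sgn2 k i * g (x i)) = 0 \<longrightarrow> (\<exists>a<2 * k. \<exists>b<2 * k. a \<noteq> b \<and> v (x a) = v (x b)))"
    and inj: "\<And>x y. x \<in> A \<Longrightarrow> y \<in> A \<Longrightarrow> (\<forall>v\<in>set vs. v x = v y) \<Longrightarrow> x = y"
  shows "\<exists>X\<subseteq>A. X \<noteq> {} \<and>
    ((\<forall>xs ys. length xs = s \<and> length ys = s \<and> set xs \<subseteq> X \<and> set ys \<subseteq> X \<and>
        (\<forall>v\<in>set vs. sum_list (map v xs) = sum_list (map v ys)) \<longrightarrow> mset xs = mset ys) \<or> sidon s g X) \<and>
    1 / (32 * real s * 2 ^ 160) * real (card A) powr (real k / 20 / real s) \<le> real (card X)"
proof -
  obtain f where f: "\<forall>xs ys. (\<forall>v\<in>set vs. sum_list (map v xs) = sum_list (map v ys)) \<longrightarrow>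
      sum_list (map f xs) = sum_list (map f ys)"
    "\<forall>m\<le>s. \<forall>x. (\<forall>i<2 * m. x i \<in> A) \<longrightarrow> (\<Sum>i<2 * m. sgn2 m i * f (x i)) = 0 \<longrightarrow>
      (\<forall>v\<in>set vs. (\<Sum>i<2 * m. sgn2 m i * v (x i)) = 0)"
    using exists_encoding[OF A(1), of vs s] by blast
  obtain M b where M: "prime M" "M > 2 * s" and b: "0 \<le> b" "\<forall>h\<in>set (f # g # vs). \<forall>x\<in>A. \<bar>h x\<bar> \<le> b"
    "2 * int s * b < int M"
    by (rule exists_large_prime[OF A(1)])
  \<comment> \<open>Relations on 2k positions occur besides those on 2s; the encoding and the size
    of \<open>M\<close> are controlled only up to 2s.\<close>
  have ks: "k \<le> s"
  proof -
    have "2400 * \<alpha> \<le> real s" using alpha_le' sqrt_s_le by linarith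
    then have "real k \<le> real s" using alpha_eq by linarith
    then show ?thesis by simp
  qed
  have zero: "(\<Sum>i<2 * m. sgn2 m i * h (x i)) = 0"
    if m: "m \<le> s" and h: "h \<in> {f, g}" and x: "\<forall>i<2 * m. x i \<in> A" and d: "int M dvd (\<Sum>i<2 * m. sgn2 m i * h (x i))" for m h x
  proof (rule int_dvd_small_imp_zero[OF _ d])
    have "\<bar>\<Sum>i<2 * m. sgn2 m i * h (x i)\<bar> \<le> 2 * int m * b" using h x b by (intro abs_sum_sgn2_le) auto
    also have "\<dots> \<le> 2 * int s * b" using m b by (intro mult_right_mono) auto
    finally show "\<bar>\<Sum>i<2 * m. sgn2 m i * h (x i)\<bar> < int M" using b by linarith
  qed
  define Q where "Q = (\<lambda>v (cl :: int \<Rightarrow> nat \<times> nat \<times> int). card (cl ` v ` A) \<le> R \<and>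
      (\<forall>x c. (\<forall>i<2 * k. x i \<in> A \<and> cl (v (x i)) = c) \<longrightarrow> (\<forall>w\<in>set vs. (\<Sum>i<2 * k. sgn2 k i * w (x i)) = 0) \<longrightarrow>
        (\<Sum>i<2 * k. sgn2 k i * g (x i)) = 0 \<longrightarrow> (\<exists>a<2 * k. \<exists>b<2 * k. a \<noteq> b \<and> v (x a) = v (x b))))"
  have "\<forall>v\<in>set vs. \<exists>cl. Q v cl" unfolding Q_def using cls by blast
  from bchoice[OF this] obtain cl where Q: "\<forall>v\<in>set vs. Q v (cl v)" by blast
  have cl: "\<And>v. v \<in> set vs \<Longrightarrow> card (cl v ` v ` A) \<le> R"
      "\<And>v x c. v \<in> set vs \<Longrightarrow> (\<forall>i<2 * k. x i \<in> A \<and> cl v (v (x i)) = c) \<Longrightarrow> (\<forall>w\<in>set vs. (\<Sum>i<2 * k. sgn2 k i * w (x i)) = 0) \<Longrightarrow>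
        (\<Sum>i<2 * k. sgn2 k i * g (x i)) = 0 \<Longrightarrow> (\<exists>a<2 * k. \<exists>b<2 * k. a \<noteq> b \<and> v (x a) = v (x b))"
    using Q unfolding Q_def by blast+
  have "\<exists>X\<subseteq>A. X \<noteq> {} \<and> (sidon s f X \<or> sidon s g X) \<and>
    1 / (32 * real s * 2 ^ 160) * real (card A) powr (real k / 20 / real s) \<le> real (card X)"
  proof (rule sidon_dichotomy[OF k R alpha_eq mu_eq A M, where cl = cl and vs = vs])
    show "(\<Sum>i<2 * s. sgn2 s i * v (x i)) = 0"
      if "v \<in> set vs" "x \<in> relations M {..<2 * s} (sgn2 s) f (\<lambda>_. 0) (\<lambda>_. A)" for v x
    proof -
      have x: "\<forall>i<2 * s. x i \<in> A" "int M dvd (\<Sum>i<2 * s. sgn2 s i * f (x i))"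
        using that(2) by (auto simp: relations_def PiE_iff)
      then have "(\<Sum>i<2 * s. sgn2 s i * f (x i)) = 0" by (intro zero) auto
      then show ?thesis using f(2) x(1) that(1) by blast
    qed
    show "\<not> int M dvd v x - v y" if "v \<in> set vs" "x \<in> A" "y \<in> A" "v x \<noteq> v y" for v x y
    proof
      assume d: "int M dvd v x - v y"
      have "2 * 1 * b \<le> 2 * int s * b" using s b by (intro mult_right_mono) auto
      moreover have "\<bar>v x\<bar> \<le> b" "\<bar>v y\<bar> \<le> b" using b that by auto
      ultimately have "\<bar>v x - v y\<bar> < int M" using b(3) by linarith
      then have "v x - v y = 0" using d by (rule int_dvd_small_imp_zero)
      then show False using that by simp
    qed
    show "\<exists>a<2 * k. \<exists>b<2 * k. a \<noteq> b \<and> v (x a) = v (x b)"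
      if "v \<in> set vs" "x \<in> relations M {..<2 * k} (sgn2 k) f g (\<lambda>_. {y \<in> A. cl v (v y) = c})" for v x c
    proof (rule cl(2)[OF that(1)])
      show x: "\<forall>i<2 * k. x i \<in> A \<and> cl v (v (x i)) = c" using that(2) by (auto simp: relations_def PiE_iff)
      have d: "int M dvd (\<Sum>i<2 * k. sgn2 k i * f (x i))" "int M dvd (\<Sum>i<2 * k. sgn2 k i * g (x i))"
        using that(2) by (auto simp: relations_def)
      show "(\<Sum>i<2 * k. sgn2 k i * g (x i)) = 0" using x d ks by (intro zero) auto
      have "(\<Sum>i<2 * k. sgn2 k i * f (x i)) = 0" using x d ks by (intro zero) auto
      then show "\<forall>w\<in>set vs. (\<Sum>i<2 * k. sgn2 k i * w (x i)) = 0" using f(2) x ks by blast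
    qed
  qed (use cl inj in auto)
  then obtain X where X: "X \<subseteq> A" "X \<noteq> {}" "sidon s f X \<or> sidon s g X"
    "1 / (32 * real s * 2 ^ 160) * real (card A) powr (real k / 20 / real s) \<le> real (card X)" by blast
  have "(\<forall>xs ys. length xs = s \<and> length ys = s \<and> set xs \<subseteq> X \<and> set ys \<subseteq> X \<and>
        (\<forall>v\<in>set vs. sum_list (map v xs) = sum_list (map v ys)) \<longrightarrow> mset xs = mset ys) \<or> sidon s g X"
    using X(3) f(1) unfolding sidon_def by blast
  then show ?thesis using X by blast
qed

section \<open>Newton lines and p-adic decoupling\<close>

definition psupp :: "int poly \<Rightarrow> nat set" where
  "psupp \<phi> = {i. coeff \<phi> i \<noteq> 0}"

text \<open>The Newton line \<open>v \<mapsto> v\<^sub>p(a\<^sub>i) + i v\<close> of the \<open>i\<close>-th coefficient.\<close>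

definition nline :: "int \<Rightarrow> int poly \<Rightarrow> nat \<Rightarrow> nat \<Rightarrow> nat" where
  "nline p \<phi> i v = multiplicity p (coeff \<phi> i) + i * v"

text \<open>Away from these valuations the lowest Newton line over any nonempty set of exponents in
  the support is unique, and the ultrametric inequality becomes an equality.\<close>

definition ties :: "int \<Rightarrow> int poly \<Rightarrow> nat set" where
  "ties p \<phi> = {v. \<exists>i\<in>psupp \<phi>. \<exists>j\<in>psupp \<phi>. i < j \<and> nline p \<phi> i v = nline p \<phi> j v}"

definition minline :: "int \<Rightarrow> int poly \<Rightarrow> nat set \<Rightarrow> nat \<Rightarrow> nat" where
  "minline p \<phi> S v = (SOME m. m \<in> S \<and> (\<forall>i\<in>S - {m}. nline p \<phi> m v < nline p \<phi> i v))"

lemma psupp_subset: "psupp \<phi> \<subseteq> {..degree \<phi>}"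
  by (auto simp: psupp_def le_degree)

lemma finite_psupp [simp]: "finite (psupp \<phi>)"
  using psupp_subset finite_subset by blast

lemma poly_eq_sum_psupp: "poly \<phi> x = (\<Sum>i\<in>psupp \<phi>. coeff \<phi> i * x ^ i)"
  unfolding poly_altdef using psupp_subset by (intro sum.mono_neutral_right) (auto simp: psupp_def)

text \<open>Lines of different slopes meet at most once, and the meeting point is recovered from the
  pair of exponents by an exact division.\<close>

lemma ties_bound: "finite (ties p \<phi>)" "card (ties p \<phi>) \<le> (degree \<phi> + 1)\<^sup>2"
proof -
  let ?P = "{..degree \<phi>} \<times> {..degree \<phi>}"
  let ?F = "\<lambda>(i, j). (multiplicity p (coeff \<phi> i) - multiplicity p (coeff \<phi> j)) div (j - i)"
  have sub: "ties p \<phi> \<subseteq> ?F ` ?P"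
  proof
    fix v assume "v \<in> ties p \<phi>"
    then obtain i j where ij: "i \<in> psupp \<phi>" "j \<in> psupp \<phi>" "i < j" "nline p \<phi> i v = nline p \<phi> j v"
      by (auto simp: ties_def)
    have "j * v = i * v + (j - i) * v" using ij(3) by (simp flip: add_mult_distrib)
    then have "multiplicity p (coeff \<phi> i) - multiplicity p (coeff \<phi> j) = (j - i) * v"
      using ij(4) by (simp add: nline_def)
    then have "v = ?F (i, j)" using ij(3) by simp
    then show "v \<in> ?F ` ?P" using ij psupp_subset by blast
  qed
  show "finite (ties p \<phi>)" by (rule finite_subset[OF sub]) simp
  have "card (ties p \<phi>) \<le> card (?F ` ?P)" by (rule card_mono[OF _ sub]) simp
  also have "\<dots> \<le> card ?P" by (rule card_image_le) simp
  also have "\<dots> = (degree \<phi> + 1)\<^sup>2" by (simp add: card_cartesian_product power2_eq_square)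
  finally show "card (ties p \<phi>) \<le> (degree \<phi> + 1)\<^sup>2" .
qed

lemma minline:
  assumes S: "S \<subseteq> psupp \<phi>" "S \<noteq> {}" and v: "v \<notin> ties p \<phi>"
  shows "minline p \<phi> S v \<in> S"
    and "\<And>i. i \<in> S \<Longrightarrow> i \<noteq> minline p \<phi> S v \<Longrightarrow> nline p \<phi> (minline p \<phi> S v) v < nline p \<phi> i v"
proof -
  have "finite S" using S finite_psupp finite_subset by blast
  then have fin: "finite ((\<lambda>i. nline p \<phi> i v) ` S)" by simp
  then have "Min ((\<lambda>i. nline p \<phi> i v) ` S) \<in> (\<lambda>i. nline p \<phi> i v) ` S" using S by (intro Min_in) auto
  then obtain m where m: "m \<in> S" "nline p \<phi> m v = Min ((\<lambda>i. nline p \<phi> i v) ` S)" by auto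
  have "nline p \<phi> m v < nline p \<phi> i v" if i: "i \<in> S - {m}" for i
  proof -
    have le: "nline p \<phi> m v \<le> nline p \<phi> i v" unfolding m(2) using fin i by (intro Min_le) auto
    have "nline p \<phi> m v \<noteq> nline p \<phi> i v"
    proof
      assume eq: "nline p \<phi> m v = nline p \<phi> i v"
      have "m < i \<or> i < m" using i by auto
      moreover have "m \<in> psupp \<phi>" "i \<in> psupp \<phi>" using m i S by auto
      ultimately have "v \<in> ties p \<phi>" using eq unfolding ties_def by (auto intro: sym)
      then show False using v by simp
    qed
    then show ?thesis using le by simp
  qed
  then have "\<exists>m. m \<in> S \<and> (\<forall>i\<in>S - {m}. nline p \<phi> m v < nline p \<phi> i v)" using m by blast
  then have *: "minline p \<phi> S v \<in> S \<and> (\<forall>i\<in>S - {minline p \<phi> S v}. nline p \<phi> (minline p \<phi> S v) v < nline p \<phi> i v)"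
    unfolding minline_def by (rule someI_ex)
  show "minline p \<phi> S v \<in> S"
    "\<And>i. i \<in> S \<Longrightarrow> i \<noteq> minline p \<phi> S v \<Longrightarrow> nline p \<phi> (minline p \<phi> S v) v < nline p \<phi> i v"
    using * by auto
qed

text \<open>All other terms are divisible by one more power of \<open>p\<close> than the term of
  exponent \<open>m\<close>. This is applied to the full support, to the support without its
  constant or its dominant exponent, and to a single monomial.\<close>

lemma exact_power_sum:
  fixes p x :: int
  assumes p: "prime p" and x: "x \<noteq> 0" and S: "S \<subseteq> psupp \<phi>" and m: "m \<in> S"
    and less: "\<And>i. i \<in> S \<Longrightarrow> i \<noteq> m \<Longrightarrow> nline p \<phi> m (multiplicity p x) < nline p \<phi> i (multiplicity p x)"
  shows "p ^ nline p \<phi> m (multiplicity p x) dvd (\<Sum>i\<in>S. coeff \<phi> i * x ^ i)"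
    and "\<not> p ^ Suc (nline p \<phi> m (multiplicity p x)) dvd (\<Sum>i\<in>S. coeff \<phi> i * x ^ i)"
proof -
  define L where "L = nline p \<phi> m (multiplicity p x)"
  have finS: "finite S" using S finite_psupp finite_subset by blast
  have mult: "multiplicity p (coeff \<phi> i * x ^ i) = nline p \<phi> i (multiplicity p x)" if "i \<in> S" for i
    using that S p x by (subst prime_elem_multiplicity_mult_distrib)
      (auto simp: psupp_def nline_def prime_elem_multiplicity_power_distrib)
  have nz: "coeff \<phi> i * x ^ i \<noteq> 0" if "i \<in> S" for i using that S x by (auto simp: psupp_def)
  have others: "p ^ Suc L dvd (\<Sum>i\<in>S - {m}. coeff \<phi> i * x ^ i)"
  proof (rule dvd_sum)
    fix i assume i: "i \<in> S - {m}"
    then have "Suc L \<le> multiplicity p (coeff \<phi> i * x ^ i)" using less[of i] mult[of i] by (simp add: L_def)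
    then show "p ^ Suc L dvd coeff \<phi> i * x ^ i" by (rule multiplicity_dvd')
  qed
  have sum: "(\<Sum>i\<in>S. coeff \<phi> i * x ^ i) = coeff \<phi> m * x ^ m + (\<Sum>i\<in>S - {m}. coeff \<phi> i * x ^ i)"
    by (rule sum.remove[OF finS m])
  have mL: "multiplicity p (coeff \<phi> m * x ^ m) = L" using mult[OF m] by (simp add: L_def)
  have "p ^ L dvd coeff \<phi> m * x ^ m" using mL by (metis multiplicity_dvd)
  moreover have "p ^ L dvd (\<Sum>i\<in>S - {m}. coeff \<phi> i * x ^ i)" using others by (meson dvd_trans le_imp_power_dvd lessI less_imp_le)
  ultimately have 1: "p ^ L dvd (\<Sum>i\<in>S. coeff \<phi> i * x ^ i)" unfolding sum by (rule dvd_add)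
  have "\<not> is_unit p" using p not_prime_unit by blast
  then have "\<not> p ^ Suc L dvd coeff \<phi> m * x ^ m"
    using power_dvd_iff_le_multiplicity[of "coeff \<phi> m * x ^ m" p "Suc L"] nz[OF m] mL by simp
  then have 2: "\<not> p ^ Suc L dvd (\<Sum>i\<in>S. coeff \<phi> i * x ^ i)" unfolding sum using others dvd_add_left_iff by blast
  show "p ^ nline p \<phi> m (multiplicity p x) dvd (\<Sum>i\<in>S. coeff \<phi> i * x ^ i)"
    "\<not> p ^ Suc (nline p \<phi> m (multiplicity p x)) dvd (\<Sum>i\<in>S. coeff \<phi> i * x ^ i)"
    using 1 2 unfolding L_def by blast+
qed

text \<open>Each valuation at which two Newton lines meet forms a class of its own; the tag \<open>-1\<close> is not a valuation.\<close>

definition tie_class :: "int \<Rightarrow> int poly \<Rightarrow> (nat \<Rightarrow> nat \<times> nat) \<Rightarrow> int \<Rightarrow> nat \<times> nat \<times> int" where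
  "tie_class p \<phi> F z = (if nat z \<in> ties p \<phi> then (0, 0, z) else (fst (F (nat z)), snd (F (nat z)), - 1))"

text \<open>One (degree + 1)^2 counts the tie valuations, each a class of its own, the other the
  possible values of \<open>F\<close>.\<close>

lemma card_tie_class:
  assumes F: "\<And>v. v \<notin> ties p \<phi> \<Longrightarrow> F v \<in> {..degree \<phi>} \<times> {..degree \<phi>}"
  shows "card (tie_class p \<phi> F ` (\<lambda>x. int (w x)) ` A) \<le> 2 * (degree \<phi> + 1)\<^sup>2"
proof -
  let ?X = "(\<lambda>v. (0 :: nat, 0 :: nat, int v)) ` ties p \<phi>"
  let ?Y = "(\<lambda>q. (fst q, snd q, - 1 :: int)) ` ({..degree \<phi>} \<times> {..degree \<phi>})"
  have "tie_class p \<phi> F ` (\<lambda>x. int (w x)) ` A \<subseteq> ?X \<union> ?Y"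
    using F by (auto simp: tie_class_def image_iff)
  then have "card (tie_class p \<phi> F ` (\<lambda>x. int (w x)) ` A) \<le> card (?X \<union> ?Y)"
    using ties_bound(1) by (intro card_mono) auto
  also have "\<dots> \<le> card ?X + card ?Y" by (rule card_Un_le)
  also have "\<dots> \<le> card (ties p \<phi>) + card ({..degree \<phi>} \<times> {..degree \<phi>})"
    using ties_bound(1) by (intro add_mono card_image_le) auto
  also have "\<dots> \<le> (degree \<phi> + 1)\<^sup>2 + (degree \<phi> + 1)\<^sup>2"
    using ties_bound(2)[of p \<phi>] by (simp add: card_cartesian_product power2_eq_square)
  finally show ?thesis by simp
qed

lemma tie_class_eq:
  assumes "tie_class p \<phi> F (int a) = tie_class p \<phi> F (int b)" "a \<noteq> b"
  shows "a \<notin> ties p \<phi>" "b \<notin> ties p \<phi>" "F a = F b"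
  using assms by (auto simp: tie_class_def prod_eq_iff split: if_splits)

lemma inj_on_obtains_strict_min:
  fixes e :: "nat \<Rightarrow> nat"
  assumes "n \<ge> 1" "inj_on e {..<n}"
  obtains i where "i < n" "\<And>j. j < n \<Longrightarrow> j \<noteq> i \<Longrightarrow> e i < e j"
proof -
  have "Min (e ` {..<n}) \<in> e ` {..<n}" using assms by (intro Min_in) (auto simp: lessThan_empty_iff)
  then obtain i where i: "i < n" "e i = Min (e ` {..<n})" by auto
  show thesis
  proof (rule that[OF i(1)])
    fix j assume j: "j < n" "j \<noteq> i"
    then have "e i \<le> e j" unfolding i(2) by (intro Min_le) auto
    moreover have "e i \<noteq> e j" using assms(2) i j by (auto simp: inj_on_def)
    ultimately show "e i < e j" by simp
  qed
qed

lemma nline_eq_iff: "m \<ge> 1 \<Longrightarrow> nline p \<phi> m a = nline p \<phi> m b \<longleftrightarrow> a = b"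
  by (simp add: nline_def)

text \<open>Suppose all 2k valuations differ. Lying in one class, they have a common lowest line
  \<open>m\<close>, and since m \<ge> 1 the p-adic orders of the values of \<phi> minus its constant
  term are distinct; the term of least order cannot be cancelled. Exponent 0 is left out of
  \<open>S\<close> because a line of slope 0 does not separate valuations, and the constant terms
  cancel as there are equally many signs of each kind.\<close>

lemma additive_decoupling:
  fixes p :: int and A :: "int set"
  assumes p: "prime p" and d: "degree \<phi> \<ge> 1" and k: "k \<ge> 1" and A: "0 \<notin> A"
  shows "\<exists>cl::int \<Rightarrow> nat \<times> nat \<times> int. card (cl ` (\<lambda>x. int (multiplicity p x)) ` A) \<le> 2 * (degree \<phi> + 1)\<^sup>2 \<and>
    (\<forall>x c. (\<forall>i<2 * k. x i \<in> A \<and> cl (int (multiplicity p (x i))) = c) \<longrightarrow>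
      (\<Sum>i<2 * k. sgn2 k i * poly \<phi> (x i)) = 0 \<longrightarrow>
      (\<exists>a<2 * k. \<exists>b<2 * k. a \<noteq> b \<and> multiplicity p (x a) = multiplicity p (x b)))"
proof -
  define S where "S = psupp \<phi> - {0}"
  have lc: "degree \<phi> \<in> psupp \<phi>" using d leading_coeff_0_iff[of \<phi>] unfolding psupp_def by fastforce
  have S: "S \<subseteq> psupp \<phi>" "S \<noteq> {}" using d lc by (auto simp: S_def)
  define F where "F = (\<lambda>v. (minline p \<phi> S v, 0::nat))"
  have "F v \<in> {..degree \<phi>} \<times> {..degree \<phi>}" if "v \<notin> ties p \<phi>" for v
    using minline(1)[OF S that] psupp_subset[of \<phi>] by (auto simp: F_def S_def)
  then have card: "card (tie_class p \<phi> F ` (\<lambda>x. int (multiplicity p x)) ` A) \<le> 2 * (degree \<phi> + 1)\<^sup>2"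
    by (rule card_tie_class)
  have "\<exists>a<2 * k. \<exists>b<2 * k. a \<noteq> b \<and> multiplicity p (x a) = multiplicity p (x b)"
    if x: "\<forall>i<2 * k. x i \<in> A \<and> tie_class p \<phi> F (int (multiplicity p (x i))) = c"
      and sum0: "(\<Sum>i<2 * k. sgn2 k i * poly \<phi> (x i)) = 0" for x :: "nat \<Rightarrow> int" and c
  proof (rule ccontr)
    assume neg: "\<not> ?thesis"
    define v where "v = (\<lambda>i. multiplicity p (x i))"
    have vinj: "inj_on v {..<2 * k}" using neg by (auto simp: inj_on_def v_def)
    have v01: "v 0 \<noteq> v 1" using inj_onD[OF vinj, of 0 1] k by auto
    have cl: "tie_class p \<phi> F (int (v i)) = tie_class p \<phi> F (int (v j))" if "i < 2 * k" "j < 2 * k" for i j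
      using x that by (simp add: v_def)
    \<comment> \<open>A tie class contains only one valuation, while
      \<open>v 0 \<noteq> v 1\<close>; so every index has a partner of different valuation in its
      own class.\<close>
    have nt: "v i \<notin> ties p \<phi>" if i: "i < 2 * k" for i
    proof -
      define j :: nat where "j = (if v i = v 0 then 1 else 0)"
      have j: "j < 2 * k" "v i \<noteq> v j" using v01 k by (auto simp: j_def)
      show ?thesis by (rule tie_class_eq(1)[OF cl[OF i j(1)] j(2)])
    qed
    define m where "m = minline p \<phi> S (v 0)"
    have m: "minline p \<phi> S (v i) = m" if i: "i < 2 * k" for i
    proof (cases "v i = v 0")
      case False
      then have "F (v i) = F (v 0)" using tie_class_eq(3)[OF cl[OF i, of 0]] k by simp
      then show ?thesis by (simp add: F_def m_def)
    qed (simp add: m_def)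
    have mS: "m \<in> S" unfolding m_def using minline(1)[OF S nt[of 0]] k by simp
    then have m1: "m \<ge> 1" by (auto simp: S_def)
    define e where "e = (\<lambda>i. nline p \<phi> m (v i))"
    have "inj_on e {..<2 * k}" using vinj m1 by (auto simp: inj_on_def e_def nline_eq_iff)
    then obtain i0 where i0: "i0 < 2 * k" "\<And>j. j < 2 * k \<Longrightarrow> j \<noteq> i0 \<Longrightarrow> e i0 < e j"
      using inj_on_obtains_strict_min[of "2 * k" e] k by auto
    define \<psi> where "\<psi> = (\<lambda>i. \<Sum>l\<in>S. coeff \<phi> l * x i ^ l)"
    have ex: "p ^ e i dvd \<psi> i" "\<not> p ^ Suc (e i) dvd \<psi> i" if i: "i < 2 * k" for i
    proof -
      have xi: "x i \<noteq> 0" using x i A by auto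
      have "nline p \<phi> m (multiplicity p (x i)) < nline p \<phi> l (multiplicity p (x i))" if "l \<in> S" "l \<noteq> m" for l
        using minline(2)[OF S nt[OF i], of l] m[OF i] that by (simp add: v_def)
      from exact_power_sum[OF p xi S(1) mS this] show "p ^ e i dvd \<psi> i" "\<not> p ^ Suc (e i) dvd \<psi> i"
        unfolding e_def v_def \<psi>_def by blast+
    qed
    have phi: "poly \<phi> (x i) = coeff \<phi> 0 + \<psi> i" for i
    proof (cases "0 \<in> psupp \<phi>")
      case True
      then show ?thesis unfolding poly_eq_sum_psupp \<psi>_def S_def by (subst sum.remove[OF finite_psupp True]) simp
    next
      case False
      then show ?thesis unfolding poly_eq_sum_psupp \<psi>_def S_def by (simp add: psupp_def)
    qed
    have "(\<Sum>i<2 * k. sgn2 k i * poly \<phi> (x i)) = (\<Sum>i<2 * k. sgn2 k i * coeff \<phi> 0) + (\<Sum>i<2 * k. sgn2 k i * \<psi> i)"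
      by (simp add: phi sum.distrib distrib_left)
    also have "(\<Sum>i<2 * k. sgn2 k i * coeff \<phi> 0) = 0" by (simp add: sum_sgn2)
    finally have "(\<Sum>i<2 * k. sgn2 k i * \<psi> i) = 0" using sum0 by simp
    moreover have "(\<Sum>i<2 * k. sgn2 k i * \<psi> i) = sgn2 k i0 * \<psi> i0 + (\<Sum>i\<in>{..<2 * k} - {i0}. sgn2 k i * \<psi> i)"
      using i0(1) by (intro sum.remove) auto
    moreover have "p ^ Suc (e i0) dvd (\<Sum>i\<in>{..<2 * k} - {i0}. sgn2 k i * \<psi> i)"
    proof (rule dvd_sum)
      fix i assume i: "i \<in> {..<2 * k} - {i0}"
      then have "p ^ Suc (e i0) dvd p ^ e i" using i0(2)[of i] by (intro le_imp_power_dvd) auto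
      also have "p ^ e i dvd \<psi> i" using ex i by auto
      finally show "p ^ Suc (e i0) dvd sgn2 k i * \<psi> i" by simp
    qed
    ultimately have "p ^ Suc (e i0) dvd sgn2 k i0 * \<psi> i0"
      by (metis dvd_add_left_iff dvd_0_right)
    then have "p ^ Suc (e i0) dvd \<psi> i0" by (auto simp: sgn2_def split: if_splits)
    then show False using ex(2)[OF i0(1)] by simp
  qed
  then show ?thesis using card by (intro exI[of _ "tie_class p \<phi> F"]) blast
qed

lemma dvd_prod_diff:
  fixes a b :: "'i \<Rightarrow> int"
  assumes "finite I" "\<And>i. i \<in> I \<Longrightarrow> n dvd a i - b i"
  shows "n dvd prod a I - prod b I"
  using assms
proof (induction I rule: finite_induct)
  case (insert i I)
  have "prod a (insert i I) - prod b (insert i I) = a i * (prod a I - prod b I) + (a i - b i) * prod b I"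
    using insert by (simp add: algebra_simps)
  then show ?case using insert by (simp add: dvd_add)
qed simp

text \<open>Write each value of \<phi> as its dominant monomial times a factor 1 + correction. The
  dominant monomials have the same product on both sides because the \<open>x i\<close> do, hence so
  do the correction factors. A correction has order W' i - W i, the gap between the second lowest
  line m' and the lowest line m; as m' \<noteq> m these gaps are distinct for distinct valuations,
  and the smallest cannot be cancelled. A nonzero constant term guarantees a second line.\<close>

lemma multiplicative_decoupling:
  fixes p :: int and A :: "int set" and k :: nat
  assumes p: "prime p" and d: "degree \<phi> \<ge> 1" and phi0: "poly \<phi> 0 \<noteq> 0" and k: "k \<ge> 1" and A: "0 \<notin> A"
  shows "\<exists>cl::int \<Rightarrow> nat \<times> nat \<times> int. card (cl ` (\<lambda>x. int (multiplicity p x)) ` A) \<le> 2 * (degree \<phi> + 1)\<^sup>2 \<and>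
    (\<forall>x c. (\<forall>i<2 * k. x i \<in> A \<and> cl (int (multiplicity p (x i))) = c) \<longrightarrow>
      (\<Prod>i<k. x i) = (\<Prod>i=k..<2*k. x i) \<longrightarrow>
      (\<Prod>i<k. poly \<phi> (x i)) = (\<Prod>i=k..<2*k. poly \<phi> (x i)) \<longrightarrow>
      (\<exists>a<2 * k. \<exists>b<2 * k. a \<noteq> b \<and> multiplicity p (x a) = multiplicity p (x b)))"
proof -
  define S where "S = psupp \<phi>"
  have lc: "degree \<phi> \<in> psupp \<phi>" using d leading_coeff_0_iff[of \<phi>] unfolding psupp_def by fastforce
  have S: "S \<subseteq> psupp \<phi>" "S \<noteq> {}" using lc by (auto simp: S_def)
  have S0d: "0 \<in> S" "degree \<phi> \<in> S" using lc phi0 by (auto simp: S_def psupp_def poly_0_coeff_0)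
  have S2: "S - {l} \<subseteq> psupp \<phi>" "S - {l} \<noteq> {}" for l using S S0d d by (auto, cases "l = 0", auto)
  define F where "F = (\<lambda>v. (minline p \<phi> S v, minline p \<phi> (S - {minline p \<phi> S v}) v))"
  have "F v \<in> {..degree \<phi>} \<times> {..degree \<phi>}" if "v \<notin> ties p \<phi>" for v
    using minline(1)[OF S that] minline(1)[OF S2 that, of "minline p \<phi> S v"] psupp_subset[of \<phi>] by (auto simp: F_def S_def)
  then have card: "card (tie_class p \<phi> F ` (\<lambda>x. int (multiplicity p x)) ` A) \<le> 2 * (degree \<phi> + 1)\<^sup>2"
    by (rule card_tie_class)
  have "\<exists>a<2 * k. \<exists>b<2 * k. a \<noteq> b \<and> multiplicity p (x a) = multiplicity p (x b)"
    if x: "\<forall>i<2 * k. x i \<in> A \<and> tie_class p \<phi> F (int (multiplicity p (x i))) = c"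
      and px: "(\<Prod>i<k. x i) = (\<Prod>i=k..<2*k. x i)"
      and pphi: "(\<Prod>i<k. poly \<phi> (x i)) = (\<Prod>i=k..<2*k. poly \<phi> (x i))" for x :: "nat \<Rightarrow> int" and c
  proof (rule ccontr)
    assume neg: "\<not> ?thesis"
    define v where "v = (\<lambda>i. multiplicity p (x i))"
    have vinj: "inj_on v {..<2 * k}" using neg by (auto simp: inj_on_def v_def)
    have v01: "v 0 \<noteq> v 1" using inj_onD[OF vinj, of 0 1] k by auto
    have cl: "tie_class p \<phi> F (int (v i)) = tie_class p \<phi> F (int (v j))" if "i < 2 * k" "j < 2 * k" for i j
      using x that by (simp add: v_def)
    have nt: "v i \<notin> ties p \<phi>" if i: "i < 2 * k" for i
    proof -
      define j :: nat where "j = (if v i = v 0 then 1 else 0)"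
      have j: "j < 2 * k" "v i \<noteq> v j" using v01 k by (auto simp: j_def)
      show ?thesis by (rule tie_class_eq(1)[OF cl[OF i j(1)] j(2)])
    qed
    define m where "m = minline p \<phi> S (v 0)"
    define m' where "m' = minline p \<phi> (S - {m}) (v 0)"
    have F0: "F (v 0) = (m, m')" by (simp add: F_def m_def m'_def)
    have Fm: "F (v i) = (m, m')" if i: "i < 2 * k" for i
    proof (cases "v i = v 0")
      case True
      then show ?thesis by (simp only: F0)
    next
      case False
      then have "F (v i) = F (v 0)" using tie_class_eq(3)[OF cl[OF i, of 0]] k by simp
      then show ?thesis by (simp only: F0)
    qed
    have m: "minline p \<phi> S (v i) = m" "minline p \<phi> (S - {m}) (v i) = m'" if i: "i < 2 * k" for i
      using Fm[OF i] by (auto simp: F_def)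
    have mS: "m \<in> S" unfolding m_def using minline(1)[OF S nt[of 0]] k by simp
    have m'S: "m' \<in> S - {m}" unfolding m'_def using minline(1)[OF S2 nt[of 0]] k by simp
    define W where "W = (\<lambda>i. nline p \<phi> m (v i))"
    define W' where "W' = (\<lambda>i. nline p \<phi> m' (v i))"
    have WW': "W i < W' i" if i: "i < 2 * k" for i
      using minline(2)[OF S nt[OF i], of m'] m'S m(1)[OF i] by (auto simp: W_def W'_def)
    define e where "e = (\<lambda>i. W' i - W i)"
    have einj: "inj_on e {..<2 * k}"
    proof (rule inj_onI)
      fix i j assume ij: "i \<in> {..<2 * k}" "j \<in> {..<2 * k}" "e i = e j"
      then have "int (W' i) - int (W i) = int (W' j) - int (W j)"
        using WW'[of i] WW'[of j] by (simp add: e_def)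
      then have "(int m' - int m) * (int (v i) - int (v j)) = 0"
        by (simp add: W_def W'_def nline_def algebra_simps)
      then have "v i = v j" using m'S by auto
      then show "i = j" using vinj ij by (auto simp: inj_on_def)
    qed
    then obtain i0 where i0: "i0 < 2 * k" "\<And>j. j < 2 * k \<Longrightarrow> j \<noteq> i0 \<Longrightarrow> e i0 < e j"
      using inj_on_obtains_strict_min[of "2 * k" e] k by auto
    define g where "g = (\<lambda>i. coeff \<phi> m * x i ^ m)"
    define f where "f = (\<lambda>i. poly \<phi> (x i))"
    have x0: "x i \<noteq> 0" if "i < 2 * k" for i using x that A by auto
    have lessS: "nline p \<phi> m (multiplicity p (x i)) < nline p \<phi> l (multiplicity p (x i))"
      if "i < 2 * k" "l \<in> S" "l \<noteq> m" for i l
      using minline(2)[OF S nt[OF that(1)], of l] m(1)[OF that(1)] that by (simp add: v_def)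
    have fd: "p ^ W i dvd f i" "\<not> p ^ Suc (W i) dvd f i" if i: "i < 2 * k" for i
      using exact_power_sum[OF p x0[OF i] S(1) mS lessS[OF i]]
      unfolding W_def v_def f_def poly_eq_sum_psupp S_def by blast+
    have gd: "p ^ W i dvd g i" "\<not> p ^ Suc (W i) dvd g i" if i: "i < 2 * k" for i
      using exact_power_sum[OF p x0[OF i], of "{m}" \<phi> m] mS
      by (auto simp: W_def v_def g_def S_def)
    have fg: "p ^ W' i dvd f i - g i" "\<not> p ^ Suc (W' i) dvd f i - g i" if i: "i < 2 * k" for i
    proof -
      have "f i = g i + (\<Sum>l\<in>S - {m}. coeff \<phi> l * x i ^ l)"
        unfolding f_def g_def poly_eq_sum_psupp S_def using mS
        by (intro sum.remove) (auto simp: S_def)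
      then have eq: "f i - g i = (\<Sum>l\<in>S - {m}. coeff \<phi> l * x i ^ l)" by simp
      have less': "nline p \<phi> m' (multiplicity p (x i)) < nline p \<phi> l (multiplicity p (x i))"
        if "l \<in> S - {m}" "l \<noteq> m'" for l
        using minline(2)[OF S2 nt[OF i], of l m] m(2)[OF i] that by (simp add: v_def)
      show "p ^ W' i dvd f i - g i" "\<not> p ^ Suc (W' i) dvd f i - g i"
        unfolding eq W'_def v_def using exact_power_sum[OF p x0[OF i] S2(1) m'S less'] by blast+
    qed
    have p0: "p \<noteq> 0" using p by auto
    \<comment> \<open>Instead of comparing products of quotients f/g, the roles of \<open>f\<close>
      and \<open>g\<close> are exchanged on the second half, so that both sides are integral;
      division by p^W leaves factors prime to \<open>p\<close>.\<close>
    define a where "a = (\<lambda>i. (if i < k then f i else g i) div p ^ W i)"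
    define b where "b = (\<lambda>i. (if i < k then g i else f i) div p ^ W i)"
    have a: "(if i < k then f i else g i) = p ^ W i * a i" and b: "(if i < k then g i else f i) = p ^ W i * b i"
      if i: "i < 2 * k" for i using fd(1)[OF i] gd(1)[OF i] by (auto simp: a_def b_def)
    have split: "(\<Prod>i<2 * k. h i) = (\<Prod>i<k. h i) * (\<Prod>i=k..<2*k. h i)" for h :: "nat \<Rightarrow> int"
    proof -
      have eq: "{..<2 * k} = {..<k} \<union> {k..<2 * k}" by auto
      show ?thesis unfolding eq by (rule prod.union_disjoint) auto
    qed
    have pg: "(\<Prod>i<k. g i) = (\<Prod>i=k..<2*k. g i)"
      unfolding g_def prod.distrib prod_power_distrib[symmetric] px by simp
    have "(\<Prod>i<2 * k. p ^ W i * a i) = (\<Prod>i<2 * k. if i < k then f i else g i)" using a by (intro prod.cong) auto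
    also have "\<dots> = (\<Prod>i<k. f i) * (\<Prod>i=k..<2*k. g i)" unfolding split by simp
    also have "\<dots> = (\<Prod>i<k. g i) * (\<Prod>i=k..<2*k. f i)" using pg pphi by (simp add: f_def)
    also have "\<dots> = (\<Prod>i<2 * k. if i < k then g i else f i)" unfolding split by simp
    also have "\<dots> = (\<Prod>i<2 * k. p ^ W i * b i)" using b by (intro prod.cong) auto
    finally have "(\<Prod>i<2 * k. p ^ W i) * (\<Prod>i<2 * k. a i) = (\<Prod>i<2 * k. p ^ W i) * (\<Prod>i<2 * k. b i)"
      by (simp only: prod.distrib)
    then have ab: "(\<Prod>i<2 * k. a i) = (\<Prod>i<2 * k. b i)" using p0 by simp
    have diff: "p ^ e i dvd a i - b i" "\<not> p ^ Suc (e i) dvd a i - b i" if i: "i < 2 * k" for i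
    proof -
      have "p ^ W i * (a i - b i) = (if i < k then f i - g i else - (f i - g i))"
        using a[OF i] b[OF i] by (auto simp: algebra_simps split: if_splits)
      then have eq: "f i - g i = p ^ W i * (a i - b i) \<or> f i - g i = - (p ^ W i * (a i - b i))"
        by (auto split: if_splits)
      have "p ^ (W i + l) dvd f i - g i \<longleftrightarrow> p ^ W i * p ^ l dvd p ^ W i * (a i - b i)" for l
        using eq by (metis dvd_minus_iff power_add)
      then have "p ^ (W i + l) dvd f i - g i \<longleftrightarrow> p ^ l dvd a i - b i" for l
        using p0 by simp
      moreover have "W i + e i = W' i" "W i + Suc (e i) = Suc (W' i)" using WW'[OF i] by (auto simp: e_def)
      ultimately show "p ^ e i dvd a i - b i" "\<not> p ^ Suc (e i) dvd a i - b i" using fg[OF i] by metis+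
    qed
    have bunit: "\<not> p dvd b i" if i: "i < 2 * k" for i
    proof
      assume "p dvd b i"
      then have "p ^ Suc (W i) dvd p ^ W i * b i" by (simp add: mult_dvd_mono mult.commute)
      then show False using b[OF i] fd(2)[OF i] gd(2)[OF i] by (auto split: if_splits)
    qed
    let ?I = "{..<2 * k} - {i0}"
    have "p ^ Suc (e i0) dvd prod a ?I - prod b ?I"
    proof (rule dvd_prod_diff)
      fix i assume i: "i \<in> ?I"
      then have "p ^ Suc (e i0) dvd p ^ e i" using i0(2)[of i] by (intro le_imp_power_dvd) auto
      also have "p ^ e i dvd a i - b i" using diff i by auto
      finally show "p ^ Suc (e i0) dvd a i - b i" .
    qed simp
    then have "p ^ Suc (e i0) dvd a i0 * (prod a ?I - prod b ?I)" by simp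
    \<comment> \<open>All other factors of \<open>a\<close> and \<open>b\<close> agree modulo p^(e
      i0 + 1). Equality of the full products pushes this congruence onto the factor
      \<open>i0\<close>, because the remaining \<open>b i\<close> are prime to
      \<open>p\<close>.\<close>
    moreover have "a i0 * prod a ?I = b i0 * prod b ?I"
      using ab i0(1) prod.remove[of "{..<2 * k}" i0 a] prod.remove[of "{..<2 * k}" i0 b] by simp
    then have "a i0 * (prod a ?I - prod b ?I) = - ((a i0 - b i0) * prod b ?I)" by (simp add: algebra_simps)
    ultimately have 1: "p ^ Suc (e i0) dvd (a i0 - b i0) * prod b ?I" by simp
    have "\<not> p dvd prod b ?I" using p bunit by (subst prime_dvd_prod_iff) auto
    then have "coprime (p ^ Suc (e i0)) (prod b ?I)"
      using p prime_imp_coprime[of p] by (simp only: coprime_power_left_iff) simp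
    then have "p ^ Suc (e i0) dvd a i0 - b i0" using 1 by (simp only: coprime_dvd_mult_left_iff)
    then show False using diff(2)[OF i0(1)] by simp
  qed
  then show ?thesis using card by (intro exI[of _ "tie_class p \<phi> F"]) blast
qed

section \<open>Passing to integers and polynomials\<close>

lemma card_le_largest_card:
  assumes "finite A" "X \<subseteq> A" "P X"
  shows "card X \<le> largest_card P A"
  unfolding largest_card_def
proof (rule Max_ge)
  have "{card X |X. X \<subseteq> A \<and> P X} \<subseteq> card ` Pow A" by auto
  then show "finite {card X |X. X \<subseteq> A \<and> P X}" using assms(1) finite_subset by blast
  show "card X \<in> {card X |X. X \<subseteq> A \<and> P X}" using assms by blast
qed

lemma B_times_singleton: "B_times s {b}"
  using sidon_singleton[of s "\<lambda>_. 0" b] by (auto simp: B_times_def B_times_poly_def sidon_def)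

lemma sum_list_multiplicity_eq:
  fixes h :: "'a \<Rightarrow> int"
  assumes "prime p" "\<forall>x\<in>set xs. h x \<noteq> 0"
  shows "sum_list (map (\<lambda>x. int (multiplicity p (h x))) xs) = int (multiplicity p (prod_list (map h xs)))"
  using assms(2)
proof (induction xs)
  case (Cons x xs)
  have "prod_list (map h xs) \<noteq> 0" using Cons.prems by (auto simp: prod_list_zero_iff)
  then show ?case
    using Cons prime_elem_multiplicity_mult_distrib[OF prime_imp_prime_elem[OF assms(1)], of "h x" "prod_list (map h xs)"] by simp
qed simp

text \<open>Equal valuations determine the two products up to sign; the signs agree because each
  side has \<open>k\<close> factors, all of sign \<epsilon>.\<close>

lemma prod_eq_of_multiplicities:
  fixes y :: "nat \<Rightarrow> int" and k :: nat
  assumes y: "\<And>i. i < 2 * k \<Longrightarrow> y i \<noteq> 0 \<and> sgn (y i) = \<epsilon>"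
    and mult: "\<And>q::int. prime q \<Longrightarrow> (\<Sum>i<2 * k. sgn2 k i * int (multiplicity q (y i))) = 0"
  shows "(\<Prod>i<k. y i) = (\<Prod>i=k..<2*k. y i)"
proof -
  have nz: "(\<Prod>i<k. y i) \<noteq> 0" "(\<Prod>i=k..<2*k. y i) \<noteq> 0" using y by (auto simp: prod_zero_iff)
  have "multiplicity q (\<Prod>i<k. y i) = multiplicity q (\<Prod>i=k..<2*k. y i)" if q: "prime q" for q :: int
  proof -
    have "int (\<Sum>i<k. multiplicity q (y i)) = int (\<Sum>i=k..<2*k. multiplicity q (y i))"
      using mult[OF q] by (simp add: sum_sgn2)
    then have "(\<Sum>i<k. multiplicity q (y i)) = (\<Sum>i=k..<2*k. multiplicity q (y i))" by (simp only: of_nat_eq_iff)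
    moreover have "multiplicity q (\<Prod>i<k. y i) = (\<Sum>i<k. multiplicity q (y i))"
      using q y by (intro prime_elem_multiplicity_prod_distrib) auto
    moreover have "multiplicity q (\<Prod>i=k..<2*k. y i) = (\<Sum>i=k..<2*k. multiplicity q (y i))"
      using q y by (intro prime_elem_multiplicity_prod_distrib) auto
    ultimately show ?thesis by simp
  qed
  then have "normalize (\<Prod>i<k. y i) = normalize (\<Prod>i=k..<2*k. y i)"
    using nz by (intro multiplicity_eq_imp_eq) auto
  then have abs: "\<bar>\<Prod>i<k. y i\<bar> = \<bar>\<Prod>i=k..<2*k. y i\<bar>" by simp
  have sg: "sgn (\<Prod>i\<in>I. y i) = \<epsilon> ^ card I" if "I \<subseteq> {..<2 * k}" for I
  proof -
    have "finite I" using that finite_subset by blast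
    then show ?thesis using that
    proof (induction I rule: finite_induct)
      case (insert i I)
      then show ?case using y[of i] by (simp add: sgn_mult)
    qed simp
  qed
  have "sgn (\<Prod>i<k. y i) = sgn (\<Prod>i=k..<2*k. y i)"
  proof -
    have "{..<k} \<subseteq> {..<2 * k}" "{k..<2*k} \<subseteq> {..<2 * k}" by auto
    then show ?thesis using sg[of "{..<k}"] sg[of "{k..<2*k}"] by simp
  qed
  then show ?thesis using abs by (metis mult_sgn_abs)
qed

text \<open>Finitely many primes carry all the nonzero valuations on a finite set. They are listed
  because the encoding recurses over a list of coordinates.\<close>

lemma exists_valuation_list:
  fixes B :: "int set"
  assumes "finite B" "0 \<notin> B"
  obtains ps where "\<forall>p\<in>set ps. prime p" "\<forall>p. prime p \<longrightarrow> p \<notin> set ps \<longrightarrow> (\<forall>x\<in>B. multiplicity p x = 0)"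
proof -
  define Ps where "Ps = (\<Union>x\<in>B. prime_factors x)"
  have "finite Ps" using assms by (simp add: Ps_def)
  then obtain ps where ps: "set ps = Ps" using finite_list by blast
  show thesis
  proof (rule that[of ps])
    show "\<forall>p\<in>set ps. prime p" by (auto simp: ps Ps_def)
    show "\<forall>p. prime p \<longrightarrow> p \<notin> set ps \<longrightarrow> (\<forall>x\<in>B. multiplicity p x = 0)"
    proof (intro allI impI ballI)
      fix p x assume p: "prime p" "p \<notin> set ps" and x: "x \<in> B"
      then have "p \<notin> prime_factors x" by (auto simp: ps Ps_def)
      moreover have "x \<noteq> 0" using x assms by auto
      ultimately have "\<not> p dvd x" using p by (simp add: prime_factors_dvd)
      then show "multiplicity p x = 0" by (rule not_dvd_imp_multiplicity_0)
    qed
  qed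
qed

definition vals :: "int list \<Rightarrow> (int \<Rightarrow> int) list" where
  "vals ps = map (\<lambda>p x. int (multiplicity p x)) ps"

lemma vals_injective:
  assumes "\<forall>p\<in>set ps. prime p" "\<forall>p. prime p \<longrightarrow> p \<notin> set ps \<longrightarrow> (\<forall>x\<in>A. multiplicity p x = 0)"
    and "\<forall>x\<in>A. x \<noteq> 0 \<and> sgn x = \<epsilon>" "x \<in> A" "y \<in> A" "\<forall>v\<in>set (vals ps). v x = v y"
  shows "x = y"
proof -
  have "normalize x = normalize y"
  proof (rule multiplicity_eq_imp_eq)
    show "x \<noteq> 0" "y \<noteq> 0" using assms by auto
    fix p :: int assume "prime p"
    then show "multiplicity p x = multiplicity p y"
      using assms by (cases "p \<in> set ps") (auto simp: vals_def)
  qed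
  then have "\<bar>x\<bar> = \<bar>y\<bar>" by simp
  moreover have "sgn x = sgn y" using assms by simp
  ultimately show ?thesis by (metis mult_sgn_abs)
qed

lemma B_times_of_vals:
  assumes ps: "\<forall>p\<in>set ps. prime p" and X: "finite X" "0 \<notin> X"
    and sid: "\<forall>xs ys. length xs = s \<and> length ys = s \<and> set xs \<subseteq> X \<and> set ys \<subseteq> X \<and>
        (\<forall>v\<in>set (vals ps). sum_list (map v xs) = sum_list (map v ys)) \<longrightarrow> mset xs = mset ys"
  shows "B_times s X"
  unfolding B_times_def B_times_poly_def
proof (intro conjI allI impI X, elim conjE)
  fix n xs ys
  assume xs: "length xs = s" "set xs \<subseteq> X" "n = prod_list (map (poly [:0, 1:]) xs)"
    and ys: "length ys = s" "set ys \<subseteq> X" "n = prod_list (map (poly [:0, 1:]) ys)"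
  have id: "map (poly [:0, 1:]) zs = zs" for zs :: "int list" by (induction zs) auto
  have "sum_list (map v xs) = sum_list (map v ys)" if v: "v \<in> set (vals ps)" for v
  proof -
    obtain p where p: "p \<in> set ps" "v = (\<lambda>x. int (multiplicity p x))" using v by (auto simp: vals_def)
    have nz: "\<forall>x\<in>set xs. x \<noteq> 0" "\<forall>x\<in>set ys. x \<noteq> 0" using xs ys X by auto
    show ?thesis
      using sum_list_multiplicity_eq[of p xs "\<lambda>x. x"] sum_list_multiplicity_eq[of p ys "\<lambda>x. x"] ps p nz xs(3) ys(3)
      by (simp add: id)
  qed
  then show "mset xs = mset ys" using sid xs ys by blast
qed

text \<open>The dichotomy with the valuations as coordinates and \<phi> as second function; here the
  relation for \<phi> alone already yields two equal valuations.\<close>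

lemma additive_part:
  assumes tp: "tree_params s (real k / 5) ((4 * (real R)\<^sup>2 * (real k)\<^sup>2) ^ 4)"
    and k: "k \<ge> 1" and R: "R = 2 * (degree \<phi> + 1)\<^sup>2" and d: "degree \<phi> \<ge> 1"
    and A: "finite A" "A \<noteq> {}" "\<forall>x\<in>A. x \<noteq> 0 \<and> sgn x = \<epsilon>"
  shows "\<exists>X\<subseteq>A. (B_plus s \<phi> X \<or> B_times s X) \<and>
    1 / (32 * real s * 2 ^ 160) * real (card A) powr (real k / 20 / real s) \<le> real (card X)"
proof -
  have A0: "0 \<notin> A" using A by auto
  obtain ps where ps: "\<forall>p\<in>set ps. prime p" "\<forall>p. prime p \<longrightarrow> p \<notin> set ps \<longrightarrow> (\<forall>x\<in>A. multiplicity p x = 0)"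
    by (rule exists_valuation_list[OF A(1) A0])
  have R1: "R \<ge> 1" by (simp add: R)
  have "\<exists>X\<subseteq>A. X \<noteq> {} \<and>
    ((\<forall>xs ys. length xs = s \<and> length ys = s \<and> set xs \<subseteq> X \<and> set ys \<subseteq> X \<and>
        (\<forall>v\<in>set (vals ps). sum_list (map v xs) = sum_list (map v ys)) \<longrightarrow> mset xs = mset ys) \<or> sidon s (poly \<phi>) X) \<and>
    1 / (32 * real s * 2 ^ 160) * real (card A) powr (real k / 20 / real s) \<le> real (card X)"
  proof (rule tree_params.sidon_dichotomy_encoded[OF tp k R1 refl refl A(1,2)])
    fix v assume "v \<in> set (vals ps)"
    then obtain p where p: "prime p" "v = (\<lambda>x. int (multiplicity p x))" using ps by (auto simp: vals_def)
    show "\<exists>cl::int \<Rightarrow> nat \<times> nat \<times> int. card (cl ` v ` A) \<le> R \<and>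
      (\<forall>x c. (\<forall>i<2 * k. x i \<in> A \<and> cl (v (x i)) = c) \<longrightarrow> (\<forall>w\<in>set (vals ps). (\<Sum>i<2 * k. sgn2 k i * w (x i)) = 0) \<longrightarrow>
        (\<Sum>i<2 * k. sgn2 k i * poly \<phi> (x i)) = 0 \<longrightarrow> (\<exists>a<2 * k. \<exists>b<2 * k. a \<noteq> b \<and> v (x a) = v (x b)))"
      using additive_decoupling[OF p(1) d k A0] unfolding p(2) R of_nat_eq_iff by blast
  next
    show "x = y" if "x \<in> A" "y \<in> A" "\<forall>v\<in>set (vals ps). v x = v y" for x y
      by (rule vals_injective[OF ps A(3) that])
  qed
  then obtain X where X: "X \<subseteq> A" "(\<forall>xs ys. length xs = s \<and> length ys = s \<and> set xs \<subseteq> X \<and> set ys \<subseteq> X \<and>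
        (\<forall>v\<in>set (vals ps). sum_list (map v xs) = sum_list (map v ys)) \<longrightarrow> mset xs = mset ys) \<or> sidon s (poly \<phi>) X"
    "1 / (32 * real s * 2 ^ 160) * real (card A) powr (real k / 20 / real s) \<le> real (card X)" by blast
  have fX: "finite X" "0 \<notin> X" using X(1) A A0 finite_subset by blast+
  have "B_plus s \<phi> X \<or> B_times s X"
    using X(2)
  proof
    assume "sidon s (poly \<phi>) X"
    then have "B_plus s \<phi> X" using fX unfolding sidon_def B_plus_def by auto
    then show ?thesis ..
  next
    assume "\<forall>xs ys. length xs = s \<and> length ys = s \<and> set xs \<subseteq> X \<and> set ys \<subseteq> X \<and>
        (\<forall>v\<in>set (vals ps). sum_list (map v xs) = sum_list (map v ys)) \<longrightarrow> mset xs = mset ys"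
    then show ?thesis using B_times_of_vals[OF ps(1) fX] by blast
  qed
  then show ?thesis using X by blast
qed

text \<open>The second function \<open>g\<close> must now be an additive stand-in for \<phi>: it
  encodes the valuations of the values of \<phi> on \<open>A\<close>. Its relations, joined with
  those of the valuations of x, give the joint system of products, the fixed signs \<epsilon> and
  \<epsilon>' turning equal valuations into equal products.\<close>

lemma multiplicative_part:
  assumes tp: "tree_params s (real k / 5) ((4 * (real R)\<^sup>2 * (real k)\<^sup>2) ^ 4)" and ks: "k \<le> s"
    and k: "k \<ge> 1" and R: "R = 2 * (degree \<phi> + 1)\<^sup>2" and d: "degree \<phi> \<ge> 1" and phi0: "poly \<phi> 0 \<noteq> 0"
    and A: "finite A" "A \<noteq> {}" "\<forall>x\<in>A. x \<noteq> 0 \<and> sgn x = \<epsilon>" "\<forall>x\<in>A. poly \<phi> x \<noteq> 0 \<and> sgn (poly \<phi> x) = \<epsilon>'"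
  shows "\<exists>X\<subseteq>A. (B_times_poly s \<phi> X \<or> B_times s X) \<and>
    1 / (32 * real s * 2 ^ 160) * real (card A) powr (real k / 20 / real s) \<le> real (card X)"
proof -
  have A0: "0 \<notin> A" using A by auto
  have R1: "R \<ge> 1" by (simp add: R)
  obtain ps where ps: "\<forall>p\<in>set ps. prime p" "\<forall>p. prime p \<longrightarrow> p \<notin> set ps \<longrightarrow> (\<forall>x\<in>A. multiplicity p x = 0)"
    by (rule exists_valuation_list[OF A(1) A0])
  have "finite (poly \<phi> ` A)" "0 \<notin> poly \<phi> ` A" using A by auto
  then obtain qs where qs: "\<forall>p\<in>set qs. prime p" "\<forall>p. prime p \<longrightarrow> p \<notin> set qs \<longrightarrow> (\<forall>x\<in>poly \<phi> ` A. multiplicity p x = 0)"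
    by (rule exists_valuation_list)
  define ws where "ws = map (\<lambda>q x. int (multiplicity q (poly \<phi> x))) qs"
  obtain g where g: "\<forall>xs ys. (\<forall>v\<in>set ws. sum_list (map v xs) = sum_list (map v ys)) \<longrightarrow>
      sum_list (map g xs) = sum_list (map g ys)"
    "\<forall>m\<le>s. \<forall>x. (\<forall>i<2 * m. x i \<in> A) \<longrightarrow> (\<Sum>i<2 * m. sgn2 m i * g (x i)) = 0 \<longrightarrow>
      (\<forall>v\<in>set ws. (\<Sum>i<2 * m. sgn2 m i * v (x i)) = 0)"
    using exists_encoding[OF A(1), of ws s] by blast
  have "\<exists>X\<subseteq>A. X \<noteq> {} \<and>
    ((\<forall>xs ys. length xs = s \<and> length ys = s \<and> set xs \<subseteq> X \<and> set ys \<subseteq> X \<and>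
        (\<forall>v\<in>set (vals ps). sum_list (map v xs) = sum_list (map v ys)) \<longrightarrow> mset xs = mset ys) \<or> sidon s g X) \<and>
    1 / (32 * real s * 2 ^ 160) * real (card A) powr (real k / 20 / real s) \<le> real (card X)"
  proof (rule tree_params.sidon_dichotomy_encoded[OF tp k R1 refl refl A(1,2)])
    fix v assume "v \<in> set (vals ps)"
    then obtain p where p: "prime p" "v = (\<lambda>x. int (multiplicity p x))" using ps by (auto simp: vals_def)
    from multiplicative_decoupling[OF p(1) d phi0 k A0] obtain cl :: "int \<Rightarrow> nat \<times> nat \<times> int" where
      cl: "card (cl ` (\<lambda>x. int (multiplicity p x)) ` A) \<le> R"
      "\<forall>x c. (\<forall>i<2 * k. x i \<in> A \<and> cl (int (multiplicity p (x i))) = c) \<longrightarrow>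
      (\<Prod>i<k. x i) = (\<Prod>i=k..<2*k. x i) \<longrightarrow>
      (\<Prod>i<k. poly \<phi> (x i)) = (\<Prod>i=k..<2*k. poly \<phi> (x i)) \<longrightarrow>
      (\<exists>a<2 * k. \<exists>b<2 * k. a \<noteq> b \<and> multiplicity p (x a) = multiplicity p (x b))" unfolding R by blast
    have "\<exists>a<2 * k. \<exists>b<2 * k. a \<noteq> b \<and> v (x a) = v (x b)"
      if x: "\<forall>i<2 * k. x i \<in> A \<and> cl (v (x i)) = c"
        and wx: "\<forall>w\<in>set (vals ps). (\<Sum>i<2 * k. sgn2 k i * w (x i)) = 0"
        and gx: "(\<Sum>i<2 * k. sgn2 k i * g (x i)) = 0" for x c
    proof -
      have xA: "\<forall>i<2 * k. x i \<in> A" using x by blast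
      have 1: "(\<Prod>i<k. x i) = (\<Prod>i=k..<2*k. x i)"
      proof (rule prod_eq_of_multiplicities)
        show "x i \<noteq> 0 \<and> sgn (x i) = \<epsilon>" if "i < 2 * k" for i using that xA A(3) by blast
        show "(\<Sum>i<2 * k. sgn2 k i * int (multiplicity q (x i))) = 0" if q: "prime q" for q :: int
        proof (cases "q \<in> set ps")
          case True
          then show ?thesis using wx by (auto simp: vals_def)
        next
          case False
          then have "multiplicity q (x i) = 0" if "i < 2 * k" for i using ps(2) q xA that by blast
          then show ?thesis by simp
        qed
      qed
      have wsx: "\<forall>v\<in>set ws. (\<Sum>i<2 * k. sgn2 k i * v (x i)) = 0" using g(2) ks xA gx by blast
      have 2: "(\<Prod>i<k. poly \<phi> (x i)) = (\<Prod>i=k..<2*k. poly \<phi> (x i))"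
      proof (rule prod_eq_of_multiplicities)
        show "poly \<phi> (x i) \<noteq> 0 \<and> sgn (poly \<phi> (x i)) = \<epsilon>'" if "i < 2 * k" for i using that xA A(4) by blast
        show "(\<Sum>i<2 * k. sgn2 k i * int (multiplicity q (poly \<phi> (x i)))) = 0" if q: "prime q" for q :: int
        proof (cases "q \<in> set qs")
          case True
          then show ?thesis using wsx by (auto simp: ws_def)
        next
          case False
          then have "multiplicity q (poly \<phi> (x i)) = 0" if "i < 2 * k" for i using qs(2) q xA that by blast
          then show ?thesis by simp
        qed
      qed
      have "\<forall>i<2 * k. x i \<in> A \<and> cl (int (multiplicity p (x i))) = c" using x by (simp add: p(2))
      then have "\<exists>a<2 * k. \<exists>b<2 * k. a \<noteq> b \<and> multiplicity p (x a) = multiplicity p (x b)" using cl(2) 1 2 by blast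
      then show ?thesis by (simp add: p(2))
    qed
    then show "\<exists>cl::int \<Rightarrow> nat \<times> nat \<times> int. card (cl ` v ` A) \<le> R \<and>
      (\<forall>x c. (\<forall>i<2 * k. x i \<in> A \<and> cl (v (x i)) = c) \<longrightarrow> (\<forall>w\<in>set (vals ps). (\<Sum>i<2 * k. sgn2 k i * w (x i)) = 0) \<longrightarrow>
        (\<Sum>i<2 * k. sgn2 k i * g (x i)) = 0 \<longrightarrow> (\<exists>a<2 * k. \<exists>b<2 * k. a \<noteq> b \<and> v (x a) = v (x b)))"
      using cl(1) unfolding p(2) by blast
  next
    show "x = y" if "x \<in> A" "y \<in> A" "\<forall>v\<in>set (vals ps). v x = v y" for x y
      by (rule vals_injective[OF ps A(3) that])
  qed
  then obtain X where X: "X \<subseteq> A" "(\<forall>xs ys. length xs = s \<and> length ys = s \<and> set xs \<subseteq> X \<and> set ys \<subseteq> X \<and>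
        (\<forall>v\<in>set (vals ps). sum_list (map v xs) = sum_list (map v ys)) \<longrightarrow> mset xs = mset ys) \<or> sidon s g X"
    "1 / (32 * real s * 2 ^ 160) * real (card A) powr (real k / 20 / real s) \<le> real (card X)" by blast
  have fX: "finite X" "0 \<notin> X" using X(1) A A0 finite_subset by blast+
  have "B_times_poly s \<phi> X \<or> B_times s X"
    using X(2)
  proof
    assume sid: "sidon s g X"
    have "B_times_poly s \<phi> X"
      unfolding B_times_poly_def
    proof (intro conjI allI impI fX, elim conjE)
      fix n xs ys
      assume xs: "length xs = s" "set xs \<subseteq> X" "n = prod_list (map (poly \<phi>) xs)"
        and ys: "length ys = s" "set ys \<subseteq> X" "n = prod_list (map (poly \<phi>) ys)"
      have nz: "\<forall>x\<in>set xs. poly \<phi> x \<noteq> 0" "\<forall>x\<in>set ys. poly \<phi> x \<noteq> 0" using xs ys X(1) A(4) by auto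
      have "sum_list (map v xs) = sum_list (map v ys)" if v: "v \<in> set ws" for v
      proof -
        obtain q where q: "prime q" "v = (\<lambda>x. int (multiplicity q (poly \<phi> x)))" using v qs by (auto simp: ws_def)
        show ?thesis unfolding q(2)
          using sum_list_multiplicity_eq[OF q(1) nz(1)] sum_list_multiplicity_eq[OF q(1) nz(2)] xs(3) ys(3) by simp
      qed
      then have "sum_list (map g xs) = sum_list (map g ys)" using g(1) by blast
      then show "mset xs = mset ys" using sid xs ys unfolding sidon_def by blast
    qed
    then show ?thesis ..
  next
    assume "\<forall>xs ys. length xs = s \<and> length ys = s \<and> set xs \<subseteq> X \<and> set ys \<subseteq> X \<and>
        (\<forall>v\<in>set (vals ps). sum_list (map v xs) = sum_list (map v ys)) \<longrightarrow> mset xs = mset ys"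
    then show ?thesis using B_times_of_vals[OF ps(1) fX] by blast
  qed
  then show ?thesis using X by blast
qed

section \<open>The unconditional bound with exponent 1/(2s)\<close>

text \<open>For an injective function the second moment counts only the diagonal; the remaining 2s -
  2 factors are bounded trivially.\<close>

lemma energy_le_of_injective:
  assumes M: "M > 0" and s: "s \<ge> 1" and A: "finite A" "A \<noteq> {}"
    and inj: "\<And>x y. x \<in> A \<Longrightarrow> y \<in> A \<Longrightarrow> int M dvd f x - f y \<Longrightarrow> x = y"
  shows "energy (2 * s) M f (\<lambda>_. 0) A \<le> real (card A) ^ (2 * s - 1)"
proof -
  define N where "N = real (card A)"
  let ?R = "relations M {..<2 * 1} (sgn2 1) f (\<lambda>_. 0) (\<lambda>_. A)"
  have x01: "x 0 \<in> A" "x 1 \<in> A" "x 0 = x 1" "x \<in> extensional {..<2}" if x: "x \<in> ?R" for x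
  proof -
    show a: "x 0 \<in> A" "x 1 \<in> A" "x \<in> extensional {..<2}" using x by (auto simp: relations_def PiE_iff)
    have "int M dvd f (x 0) - f (x 1)" using x by (simp add: relations_def sgn2_def numeral_2_eq_2)
    then show "x 0 = x 1" using inj a by blast
  qed
  have "inj_on (\<lambda>x. x 0) ?R"
  proof (rule inj_onI)
    fix x y assume xy: "x \<in> ?R" "y \<in> ?R" "x 0 = y 0"
    show "x = y"
    proof (rule extensionalityI)
      show "x \<in> extensional {..<2}" "y \<in> extensional {..<2}" using x01 xy by auto
      fix i :: nat assume "i \<in> {..<2}"
      then have "i = 0 \<or> i = 1" by auto
      then show "x i = y i" using x01(3)[OF xy(1)] x01(3)[OF xy(2)] xy(3) by auto
    qed
  qed
  moreover have "(\<lambda>x. x 0) ` ?R \<subseteq> A" using x01 by auto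
  ultimately have "card ?R \<le> card A" using A by (intro card_inj_on_le) auto
  then have e2: "energy 2 M f (\<lambda>_. 0) A \<le> N"
    using energy_eq_card_relations[OF M A(1), of 1 f "\<lambda>_. 0"] by (simp add: N_def)
  have "energy (2 * s) M f (\<lambda>_. 0) A \<le> mean (grid M) (\<lambda>z. N ^ (2 * s - 2) * cmod (ft M f (\<lambda>_. 0) A z) ^ 2)"
    unfolding energy_def
  proof (rule mean_mono)
    fix z
    have "2 * s = (2 * s - 2) + 2" using s by simp
    then have "cmod (ft M f (\<lambda>_. 0) A z) ^ (2 * s) = cmod (ft M f (\<lambda>_. 0) A z) ^ (2 * s - 2) * cmod (ft M f (\<lambda>_. 0) A z) ^ 2"
      by (metis power_add)
    also have "\<dots> \<le> N ^ (2 * s - 2) * cmod (ft M f (\<lambda>_. 0) A z) ^ 2"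
      unfolding N_def by (intro mult_right_mono power_mono norm_ft_le) auto
    finally show "cmod (ft M f (\<lambda>_. 0) A z) ^ (2 * s) \<le> N ^ (2 * s - 2) * cmod (ft M f (\<lambda>_. 0) A z) ^ 2" .
  qed
  also have "\<dots> = N ^ (2 * s - 2) * energy 2 M f (\<lambda>_. 0) A" unfolding energy_def by (rule mean_cmult)
  also have "\<dots> \<le> N ^ (2 * s - 2) * N" using e2 by (intro mult_left_mono) (auto simp: N_def)
  also have "\<dots> = N ^ (2 * s - 1)"
  proof -
    have "2 * s - 1 = Suc (2 * s - 2)" using s by simp
    then show ?thesis by (simp only: power_Suc mult.commute)
  qed
  finally show ?thesis by (simp add: N_def)
qed

text \<open>Serves those \<open>s\<close> for which the depth k would be 0. The encoding is
  injective modulo \<open>M\<close>, so the norm is at most N^(1 - 1/(2s)), and the random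
  construction gives a Sidon set of about N^(1/(2s)) points. The factor 2^160 makes the constant
  agree with that of the other case.\<close>

lemma trivial_part:
  assumes s: "s \<ge> 1" and A: "finite A" "A \<noteq> {}" "\<forall>x\<in>A. x \<noteq> 0 \<and> sgn x = \<epsilon>"
  shows "\<exists>X\<subseteq>A. B_times s X \<and> 1 / (32 * real s * 2 ^ 160) * real (card A) powr (1 / 2 / real s) \<le> real (card X)"
proof -
  have A0: "0 \<notin> A" using A by auto
  obtain ps where ps: "\<forall>p\<in>set ps. prime p" "\<forall>p. prime p \<longrightarrow> p \<notin> set ps \<longrightarrow> (\<forall>x\<in>A. multiplicity p x = 0)"
    by (rule exists_valuation_list[OF A(1) A0])
  obtain f where f: "\<forall>xs ys. (\<forall>v\<in>set (vals ps). sum_list (map v xs) = sum_list (map v ys)) \<longrightarrow>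
      sum_list (map f xs) = sum_list (map f ys)"
    "\<forall>m\<le>s. \<forall>x. (\<forall>i<2 * m. x i \<in> A) \<longrightarrow> (\<Sum>i<2 * m. sgn2 m i * f (x i)) = 0 \<longrightarrow>
      (\<forall>v\<in>set (vals ps). (\<Sum>i<2 * m. sgn2 m i * v (x i)) = 0)"
    using exists_encoding[OF A(1), of "vals ps" s] by blast
  obtain M b where M: "prime M" "M > 2 * s" and b: "0 \<le> b" "\<forall>h\<in>set [f]. \<forall>x\<in>A. \<bar>h x\<bar> \<le> b" "2 * int s * b < int M"
    by (rule exists_large_prime[OF A(1)])
  have Mpos: "M > 0" using M by simp
  define N where "N = real (card A)"
  have N: "N > 0" using A by (simp add: N_def card_gt_0_iff)
  have inj: "x = y" if "x \<in> A" "y \<in> A" "int M dvd f x - f y" for x y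
  proof -
    have "\<bar>f x\<bar> \<le> b" "\<bar>f y\<bar> \<le> b" using b that by auto
    moreover have "2 * 1 * b \<le> 2 * int s * b" using s b by (intro mult_right_mono) auto
    ultimately have "\<bar>f x - f y\<bar> < int M" using b(3) by linarith
    then have "f x - f y = 0" using that(3) by (rule int_dvd_small_imp_zero)
    define z where "z = (\<lambda>i::nat. if i = 0 then x else y)"
    have "(\<Sum>i<2 * 1. sgn2 1 i * f (z i)) = 0"
      using \<open>f x - f y = 0\<close> by (simp add: z_def sgn2_def numeral_2_eq_2)
    moreover have "\<forall>i<2 * 1. z i \<in> A" using that by (simp add: z_def)
    ultimately have "\<forall>v\<in>set (vals ps). (\<Sum>i<2 * 1. sgn2 1 i * v (z i)) = 0" using f(2) s by blast
    then have "\<forall>v\<in>set (vals ps). v x = v y" by (simp add: z_def sgn2_def numeral_2_eq_2)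
    then show ?thesis by (intro vals_injective[OF ps A(3) that(1,2)])
  qed
  obtain X where X: "X \<subseteq> A" "sidon s f X" "X \<noteq> {}" "real (card A) \<le> 32 * real s * real (card X) * nrm (2 * s) M f (\<lambda>_. 0) A"
    by (rule exists_large_sidon[OF M s A(1,2)])
  define \<Phi> where "\<Phi> = nrm (2 * s) M f (\<lambda>_. 0) A"
  have "\<Phi> ^ (2 * s) \<le> N ^ (2 * s - 1)"
    unfolding \<Phi>_def N_def using energy_le_of_injective[OF Mpos s A(1,2) inj] s by (simp add: nrm_power)
  also have "\<dots> = N powr (2 * real s - 1)" using N s by (simp add: powr_realpow[symmetric] of_nat_diff)
  also have "\<dots> = (N powr (1 - 1 / 2 / real s)) ^ (2 * s)"
  proof -
    have "(N powr (1 - 1 / 2 / real s)) ^ (2 * s) = N powr ((1 - 1 / 2 / real s) * real (2 * s))"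
      using N by (simp add: powr_powr powr_realpow[symmetric])
    also have "(1 - 1 / 2 / real s) * real (2 * s) = 2 * real s - 1" using s by (simp add: algebra_simps)
    finally show ?thesis ..
  qed
  finally have "\<Phi> \<le> N powr (1 - 1 / 2 / real s)" using s N by (subst (asm) power_mono_iff) (auto simp: \<Phi>_def nrm_nonneg)
  then have "N \<le> 32 * real s * real (card X) * N powr (1 - 1 / 2 / real s)"
    using X(4) mult_left_mono[of \<Phi> "N powr (1 - 1 / 2 / real s)" "32 * real s * real (card X)"] by (simp add: \<Phi>_def N_def)
  then have "N powr (1 / 2 / real s) * N \<le> N powr (1 / 2 / real s) * (32 * real s * real (card X) * N powr (1 - 1 / 2 / real s))"
    by (intro mult_left_mono) auto
  also have "\<dots> = 32 * real s * real (card X) * (N powr (1 / 2 / real s) * N powr (1 - 1 / 2 / real s))" by simp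
  also have "N powr (1 / 2 / real s) * N powr (1 - 1 / 2 / real s) = N" using N by (simp flip: powr_add)
  finally have le: "N powr (1 / 2 / real s) \<le> 32 * real s * real (card X)" using N by simp
  have "1 / (32 * real s * 2 ^ 160) * N powr (1 / 2 / real s) \<le> 1 / (32 * real s) * N powr (1 / 2 / real s)"
    using s by (intro mult_right_mono) (auto simp: field_simps)
  also have "\<dots> \<le> real (card X)" using le s by (simp add: field_simps)
  finally have bound: "1 / (32 * real s * 2 ^ 160) * N powr (1 / 2 / real s) \<le> real (card X)" .
  have fX: "finite X" "0 \<notin> X" using X(1) A A0 finite_subset by blast+
  have "B_times s X"
    using X(2) f(1) unfolding sidon_def by (intro B_times_of_vals[OF ps(1) fX]) blast
  then show ?thesis using X(1) bound by (auto simp: N_def)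
qed

section \<open>Zeros, signs and the choice of parameters\<close>

text \<open>Discard 0 and the roots of \<phi>, at most degree + 1 points, and keep the most frequent
  of the four sign patterns of x and the value of \<phi> at x.\<close>

lemma exists_good_part:
  fixes A :: "int set"
  assumes A: "finite A" and phi: "\<phi> \<noteq> 0"
  obtains A0 \<epsilon> \<epsilon>' where "A0 \<subseteq> A" "\<forall>x\<in>A0. x \<noteq> 0 \<and> sgn x = \<epsilon>" "\<forall>x\<in>A0. poly \<phi> x \<noteq> 0 \<and> sgn (poly \<phi> x) = \<epsilon>'"
    "card A \<le> degree \<phi> + 1 + 4 * card A0"
proof -
  define Z where "Z = insert 0 {x. poly \<phi> x = 0}"
  define G where "G = (\<lambda>q. {x \<in> A - Z. sgn x = fst q \<and> sgn (poly \<phi> x) = snd q})"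
  define K where "K = {1 :: int, - 1} \<times> {1 :: int, - 1}"
  have K: "finite K" "K \<noteq> {}" by (auto simp: K_def)
  have K4: "card K \<le> 4" unfolding K_def card_cartesian_product by simp
  have fZ: "finite Z" using poly_roots_finite[OF phi] by (simp add: Z_def)
  have "card Z \<le> Suc (card {x. poly \<phi> x = 0})" unfolding Z_def using poly_roots_finite[OF phi] by (simp add: card_insert_if)
  also have "\<dots> \<le> Suc (degree \<phi>)" using card_poly_roots_bound[OF phi] by simp
  finally have cZ: "card Z \<le> degree \<phi> + 1" by simp
  obtain q0 where q0: "q0 \<in> K" "\<And>q. q \<in> K \<Longrightarrow> real (card (G q)) \<le> real (card (G q0))"
    using finite_obtains_max[OF K(1,2), of "\<lambda>q. real (card (G q))"] by blast
  have "A - Z \<subseteq> (\<Union>q\<in>K. G q)"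
  proof
    fix x assume x: "x \<in> A - Z"
    then have "x \<noteq> 0" "poly \<phi> x \<noteq> 0" by (auto simp: Z_def)
    then have "(sgn x, sgn (poly \<phi> x)) \<in> K" by (auto simp: K_def sgn_if)
    then show "x \<in> (\<Union>q\<in>K. G q)" using x by (force simp: G_def)
  qed
  then have "card (A - Z) \<le> card (\<Union>q\<in>K. G q)" using A K by (intro card_mono) (auto simp: G_def)
  also have "\<dots> \<le> (\<Sum>q\<in>K. card (G q))" by (rule card_UN_le[OF K(1)])
  also have "\<dots> \<le> card K * card (G q0)" using sum_bounded_above[of K "\<lambda>q. card (G q)" "card (G q0)"] q0(2) by simp
  also have "\<dots> \<le> 4 * card (G q0)" using K4 by simp
  finally have 1: "card (A - Z) \<le> 4 * card (G q0)" .
  have "card A \<le> card (Z \<union> (A - Z))" using A fZ by (intro card_mono) auto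
  also have "\<dots> \<le> card Z + card (A - Z)" by (rule card_Un_le)
  finally have "card A \<le> degree \<phi> + 1 + 4 * card (G q0)" using 1 cZ by linarith
  then show thesis by (intro that[of "G q0" "fst q0" "snd q0"]) (auto simp: G_def Z_def)
qed

text \<open>|A| is at most (degree + 5) max(1, |A0|), and e \<le> 1 lets the factor be taken out of
  the power. The maximum with 1 covers the case that \<open>A\<close> consists of 0 and roots, where
  a singleton suffices.\<close>

lemma max_largest_card_ge:
  fixes A :: "int set"
  assumes A: "finite A" and phi: "\<phi> \<noteq> 0" and c: "0 < c" "c \<le> 1" and e: "0 < e" "e \<le> 1"
    and part: "\<And>A0 \<epsilon> \<epsilon>'. finite A0 \<Longrightarrow> A0 \<noteq> {} \<Longrightarrow> \<forall>x\<in>A0. x \<noteq> 0 \<and> sgn x = \<epsilon> \<Longrightarrow>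
      \<forall>x\<in>A0. poly \<phi> x \<noteq> 0 \<and> sgn (poly \<phi> x) = \<epsilon>' \<Longrightarrow>
      \<exists>X\<subseteq>A0. (P X \<or> B_times s X) \<and> c * real (card A0) powr e \<le> real (card X)"
  shows "c / (real (degree \<phi>) + 5) * real (card A) powr e \<le> real (max (largest_card P A) (largest_card (B_times s) A))"
proof (cases "A = {}")
  case True
  then show ?thesis using e by simp
next
  case False
  define D where "D = real (degree \<phi>) + 5"
  have D: "D \<ge> 5" by (simp add: D_def)
  obtain A0 \<epsilon> \<epsilon>' where A0: "A0 \<subseteq> A" "\<forall>x\<in>A0. x \<noteq> 0 \<and> sgn x = \<epsilon>" "\<forall>x\<in>A0. poly \<phi> x \<noteq> 0 \<and> sgn (poly \<phi> x) = \<epsilon>'"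
    "card A \<le> degree \<phi> + 1 + 4 * card A0"
    by (rule exists_good_part[OF A phi])
  define t where "t = max 1 (real (card A0))"
  have "real (card A) \<le> real (degree \<phi> + 1 + 4 * card A0)" using A0(4) by (simp only: of_nat_le_iff)
  also have "\<dots> \<le> D * t"
  proof -
    have "real (degree \<phi>) * 1 \<le> real (degree \<phi>) * t" by (intro mult_left_mono) (auto simp: t_def)
    moreover have "real (card A0) \<le> t" "1 \<le> t" by (auto simp: t_def)
    ultimately have "real (degree \<phi>) + 1 + 4 * real (card A0) \<le> real (degree \<phi>) * t + t + 4 * t" by linarith
    then show ?thesis by (simp add: D_def algebra_simps)
  qed
  finally have "real (card A) powr e \<le> (D * t) powr e" using e by (intro powr_mono2) auto
  also have "\<dots> = D powr e * t powr e" using D by (simp add: powr_mult t_def)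
  also have "\<dots> \<le> D * t powr e"
  proof (rule mult_right_mono)
    have "D powr e \<le> D powr 1" using D e by (intro powr_mono) auto
    then show "D powr e \<le> D" using D by simp
  qed simp
  finally have "c / D * real (card A) powr e \<le> c / D * (D * t powr e)" using c D by (intro mult_left_mono) auto
  also have "\<dots> = c * t powr e" using D by simp
  finally have 1: "c / D * real (card A) powr e \<le> c * t powr e" .
  have "\<exists>X\<subseteq>A. (P X \<or> B_times s X) \<and> c * t powr e \<le> real (card X)"
  proof (cases "A0 = {}")
    case True
    obtain b where "b \<in> A" using False by blast
    then show ?thesis using True c B_times_singleton[of s b] by (intro exI[of _ "{b}"]) (auto simp: t_def)
  next
    case ne: False
    have fin: "finite A0" using A0(1) A finite_subset by blast
    then have "1 \<le> card A0" using ne by (simp add: Suc_le_eq card_gt_0_iff)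
    then have "t = real (card A0)" by (simp add: t_def)
    then obtain X where "X \<subseteq> A0" "P X \<or> B_times s X" "c * t powr e \<le> real (card X)"
      using part[OF fin ne A0(2,3)] by auto
    then show ?thesis using A0(1) by blast
  qed
  then obtain X where X: "X \<subseteq> A" "P X \<or> B_times s X" "c * t powr e \<le> real (card X)" by blast
  have "card X \<le> max (largest_card P A) (largest_card (B_times s) A)"
    using X(2) card_le_largest_card[OF A X(1), of P] card_le_largest_card[OF A X(1), of "B_times s"] by auto
  then have "real (card X) \<le> real (max (largest_card P A) (largest_card (B_times s) A))" by (simp only: of_nat_le_iff)
  then show ?thesis using 1 X(3) unfolding D_def by linarith
qed

text \<open>With y = 2 R k the price is \<mu> = y^8, and the two smallness conditions reduce to y^8
  \<le> s^(1/4) and y^(2k+1) \<le> s^(1/6). The exponent 32 k covers both, since 4 * 8 \<le> 32 k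
  and 6 (2k + 1) \<le> 32 k.\<close>

lemma tree_params_of_large:
  assumes R: "R \<ge> 8" and k: "k \<ge> 1" and large: "(2 * R * k) ^ (32 * k) \<le> s"
  shows "tree_params s (real k / 5) ((4 * (real R)\<^sup>2 * (real k)\<^sup>2) ^ 4)"
proof -
  define y where "y = 2 * real R * real k"
  have k1: "real k \<ge> 1" using k by simp
  have R8: "real R \<ge> 8" using R by simp
  have "16 * 1 \<le> (2 * real R) * real k" using R8 k1 by (intro mult_mono) auto
  then have y16: "y \<ge> 16" by (simp add: y_def)
  have "1 * real k \<le> (2 * real R) * real k" using R8 by (intro mult_right_mono) auto
  then have yk: "real k \<le> y" by (simp add: y_def)
  have mu: "(4 * (real R)\<^sup>2 * (real k)\<^sup>2) ^ 4 = y ^ 8"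
    by (simp add: y_def power_mult_distrib flip: power_mult)
  have "real ((2 * R * k) ^ (32 * k)) \<le> real s" using large by (simp only: of_nat_le_iff)
  then have sy: "y ^ (32 * k) \<le> real s" by (simp add: y_def)
  have "y ^ 0 \<le> y ^ (32 * k)" using y16 by (intro power_increasing) auto
  then have s1: "real s \<ge> 1" using sy by simp
  have root: "y ^ m \<le> real s powr (1 / real n)" if "m * n \<le> 32 * k" "n \<ge> 1" for m n
  proof -
    have "y ^ (m * n) \<le> y ^ (32 * k)" using y16 that by (intro power_increasing) auto
    then have "(y ^ m) ^ n \<le> real s" using sy by (simp add: power_mult)
    then have "((y ^ m) ^ n) powr (1 / real n) \<le> real s powr (1 / real n)" using y16 by (intro powr_mono2) auto
    moreover have "((y ^ m) ^ n) powr (1 / real n) = y ^ m"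
      using y16 that by (simp add: powr_powr powr_realpow[symmetric])
    ultimately show ?thesis by simp
  qed
  show ?thesis
    unfolding mu
  proof
    show "s \<ge> 1" using s1 by simp
    show "0 < real k / 5" using k by simp
    have "y ^ 0 \<le> y ^ 8" using y16 by (intro power_increasing) auto
    then show "1 \<le> y ^ 8" by simp
    have "sqrt (y ^ 8) = y ^ 4"
      using y16 by (intro real_sqrt_unique) (auto simp flip: power_mult)
    then have "2400 * (real k / 5) * sqrt (y ^ 8) = 480 * real k * y ^ 4" by simp
    also have "\<dots> \<le> y ^ 3 * y * y ^ 4"
    proof (intro mult_right_mono mult_mono)
      have "(16::real) ^ 3 \<le> y ^ 3" using y16 by (intro power_mono) auto
      then show "480 \<le> y ^ 3" by simp
    qed (use yk y16 in auto)
    also have "\<dots> = y ^ 8" by (simp add: power_numeral_reduce)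
    also have "\<dots> \<le> real s powr (1 / real 4)" using k by (intro root) auto
    finally show "2400 * (real k / 5) * sqrt (y ^ 8) \<le> real s powr (1 / 4)" by simp
    have "12 * (y ^ 8) powr (real k / 5) = 12 * y powr (8 * real k / 5)"
    proof -
      have "y ^ 8 = y powr 8" using y16 by simp
      then show ?thesis by (simp only: powr_powr) simp
    qed
    also have "\<dots> \<le> y * y powr (2 * real k)"
      using y16 by (intro mult_mono powr_mono) auto
    also have "\<dots> = y ^ (2 * k + 1)"
      using y16 by (simp add: powr_realpow[symmetric] powr_add)
    also have "\<dots> \<le> real s powr (1 / real 6)" using k by (intro root) auto
    finally show "12 * (y ^ 8) powr (real k / 5) \<le> real s powr (1 / 6)" by simp
  qed
qed

text \<open>As 2^(3/2) < 3 and 2^(1/2) < 3/2, the denominator log log s stays away from 0 already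
  from s = 3 on.\<close>

lemma log_log_ge_half:
  assumes "s \<ge> 3"
  shows "log 2 (real s) \<ge> 3/2" "log 2 (log 2 (real s)) \<ge> 1/2"
proof -
  have "(2 powr (3/2)) ^ 2 = (2::real) powr 3" by (simp add: powr_powr powr_realpow[symmetric])
  also have "\<dots> \<le> 3 ^ 2" by simp
  finally have "2 powr (3/2) \<le> (3::real)" by (rule power2_le_imp_le) simp
  then have "2 powr (3/2) \<le> real s" using assms by linarith
  then show 1: "log 2 (real s) \<ge> 3/2" using assms by (subst le_log_iff) auto
  have "(2 powr (1/2)) ^ 2 = (2::real) powr 1" by (simp add: powr_powr powr_realpow[symmetric])
  also have "\<dots> \<le> (3/2) ^ 2" by (simp add: power2_eq_square)
  finally have "2 powr (1/2) \<le> (3/2::real)" by (rule power2_le_imp_le) simp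
  then have "2 powr (1/2) \<le> log 2 (real s)" using 1 by linarith
  then show "log 2 (log 2 (real s)) \<ge> 1/2" using 1 by (subst le_log_iff) auto
qed

text \<open>Since k \<le> log s, log k is at most log log s; with log log s \<ge> 1/2 this bounds k
  (log C + log k) by c (1 + 2 log C) log s, and \<open>c\<close> is chosen so that 32 times this
  bound is log s.\<close>

lemma exists_depth:
  fixes C s :: nat
  assumes C: "C \<ge> 2" and s: "s \<ge> 3"
  defines "c \<equiv> 1 / (32 * (1 + 2 * log 2 (real C)))"
  defines "k \<equiv> nat \<lfloor>c * log 2 (real s) / log 2 (log 2 (real s))\<rfloor>"
  shows "k \<ge> 1 \<Longrightarrow> (C * k) ^ (32 * k) \<le> s"
proof -
  assume k: "k \<ge> 1"
  define L where "L = log 2 (real s)"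
  define l where "l = log 2 L"
  have L: "L \<ge> 3/2" and l: "l \<ge> 1/2" using log_log_ge_half[OF s] by (auto simp: L_def l_def)
  have lC: "log 2 (real C) \<ge> 1" using C by (simp add: le_log_iff)
  have c0: "0 < c" "c \<le> 1/96"
    using lC by (simp_all add: c_def field_simps)
  have kx: "real k \<le> c * L / l" unfolding k_def L_def l_def using k[unfolded k_def] by linarith
  have "c * L / l \<le> c * L / (1/2)" using c0 L l by (intro divide_left_mono) auto
  also have "\<dots> \<le> L" using c0 L mult_right_mono[of c "1/96" L] by simp
  finally have kL: "real k \<le> L" using kx by linarith
  have "log 2 (real k) \<le> l" unfolding l_def using k kL L by (subst log_le_cancel_iff) auto
  then have lCk: "log 2 (real (C * k)) \<le> log 2 (real C) + l"
    using C k by (simp add: log_mult)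
  have "log 2 (real ((C * k) ^ (32 * k))) = 32 * real k * log 2 (real (C * k))"
    using C k by (simp add: log_nat_power)
  also have "\<dots> \<le> 32 * real k * (log 2 (real C) + l)" using lCk by (intro mult_left_mono) auto
  also have "\<dots> \<le> 32 * (c * L / l) * (log 2 (real C) + l)" using kx lC l by (intro mult_right_mono mult_left_mono) auto
  also have "\<dots> = 32 * c * L * (log 2 (real C) / l + 1)" using l by (simp add: field_simps)
  also have "\<dots> \<le> 32 * c * L * (log 2 (real C) / (1/2) + 1)"
    using l lC c0 L by (intro mult_left_mono add_right_mono divide_left_mono) auto
  also have "\<dots> = L" using lC by (simp add: c_def field_simps)
  finally have "log 2 (real ((C * k) ^ (32 * k))) \<le> log 2 (real s)" by (simp only: L_def)
  then have "real ((C * k) ^ (32 * k)) \<le> real s" using C k s by (subst (asm) log_le_cancel_iff) auto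
  then show ?thesis by (simp only: of_nat_le_iff)
qed

theorem theorem1p4:
  fixes d :: nat
  assumes "d \<ge> 1"
  shows "\<exists>c::real. c > 0 \<and> (\<forall>s::nat. s \<ge> 3 \<longrightarrow>
    (\<exists>\<delta>::real. \<delta> \<ge> c * log 2 (real s) / log 2 (log 2 (real s)) \<and>
      (\<exists>C::real. C > 0 \<and>
        (\<forall>(A::int set) (\<phi>::int poly). finite A \<and> degree \<phi> = d \<longrightarrow>
          real (max (largest_card (B_plus s \<phi>) A) (largest_card (B_times s) A))
            \<ge> C * real (card A) powr (\<delta> / real s))) \<and>
      (\<exists>C::real. C > 0 \<and>
        (\<forall>(A::int set) (\<phi>::int poly). finite A \<and> degree \<phi> = d \<and> poly \<phi> 0 \<noteq> 0 \<longrightarrow>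
          real (max (largest_card (B_times_poly s \<phi>) A) (largest_card (B_times s) A))
            \<ge> C * real (card A) powr (\<delta> / real s)))))"
proof -
  define R :: nat where "R = 2 * (d + 1)\<^sup>2"
  define C where "C = 2 * R"
  define c where "c = 1 / (32 * (1 + 2 * log 2 (real C)))"
  have "(2::nat)\<^sup>2 \<le> (d + 1)\<^sup>2" using assms by (intro power_mono) auto
  then have R8: "R \<ge> 8" by (simp add: R_def)
  then have C2: "C \<ge> 2" by (simp add: C_def)
  then have "log 2 (real C) \<ge> 0" by simp
  then have c0: "0 < c" by (simp add: c_def)
  show ?thesis
  \<comment> \<open>40 = 2 * 20: rounding x down to k loses at most a factor 2 when k \<ge> 1, and
    the exponent obtained from depth k is k/20.\<close>
  proof (rule exI[of _ "c / 40"], intro conjI allI impI)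
    show "0 < c / 40" using c0 by simp
    fix s :: nat assume s3: "s \<ge> 3"
    define x where "x = c * log 2 (real s) / log 2 (log 2 (real s))"
    define k where "k = nat \<lfloor>x\<rfloor>"
    define c1 where "c1 = 1 / (32 * real s * (2 ^ 160 :: real))"
    have c1: "0 < c1" "c1 \<le> 1" using s3 by (auto simp: c1_def field_simps)
    have s1: "s \<ge> 1" using s3 by simp
    \<comment> \<open>One \<delta> has to serve both claims and all polynomials of degree
      \<open>d\<close>, so the two conclusions are bundled before \<delta> is chosen.\<close>
    define Q where "Q = (\<lambda>\<delta>::real.
      \<forall>\<phi> A \<epsilon> \<epsilon>'. degree \<phi> = d \<longrightarrow> finite A \<longrightarrow> A \<noteq> {} \<longrightarrow> (\<forall>x\<in>A. x \<noteq> 0 \<and> sgn x = \<epsilon>) \<longrightarrow>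
        (\<forall>x\<in>A. poly \<phi> x \<noteq> 0 \<and> sgn (poly \<phi> x) = \<epsilon>') \<longrightarrow>
        (\<exists>X\<subseteq>A. (B_plus s \<phi> X \<or> B_times s X) \<and> c1 * real (card A) powr (\<delta> / real s) \<le> real (card X)) \<and>
        (poly \<phi> 0 \<noteq> 0 \<longrightarrow>
          (\<exists>X\<subseteq>A. (B_times_poly s \<phi> X \<or> B_times s X) \<and> c1 * real (card A) powr (\<delta> / real s) \<le> real (card X))))"
    have "\<exists>\<delta>::real. x / 40 \<le> \<delta> \<and> 0 < \<delta> / real s \<and> \<delta> / real s \<le> 1 \<and> Q \<delta>"
    proof (cases "k \<ge> 1")
      case False
      \<comment> \<open>At depth 0 the required exponent x/40 is below 1/2, which the unconditional
        bound delivers.\<close>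
      then have "x \<le> 1" unfolding k_def by linarith
      then have 1: "x / 40 \<le> 1 / 2" by simp
      have 2: "0 < 1 / 2 / real s" "1 / 2 / real s \<le> 1" using s3 by (auto simp: field_simps)
      show ?thesis
        unfolding Q_def
      proof (intro exI[of _ "1 / 2"] conjI allI impI 1 2)
        fix \<phi> :: "int poly" and A :: "int set" and \<epsilon> \<epsilon>' :: int
        assume A: "finite A" "A \<noteq> {}" "\<forall>x\<in>A. x \<noteq> 0 \<and> sgn x = \<epsilon>"
        obtain X where X: "X \<subseteq> A" "B_times s X" "c1 * real (card A) powr (1 / 2 / real s) \<le> real (card X)"
          using trivial_part[OF s1 A] unfolding c1_def by blast
        show "\<exists>X\<subseteq>A. (B_plus s \<phi> X \<or> B_times s X) \<and> c1 * real (card A) powr (1 / 2 / real s) \<le> real (card X)"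
          "\<exists>X\<subseteq>A. (B_times_poly s \<phi> X \<or> B_times s X) \<and> c1 * real (card A) powr (1 / 2 / real s) \<le> real (card X)"
          using X by blast+
      qed
    next
      case True
      have large: "(2 * R * k) ^ (32 * k) \<le> s"
        using exists_depth[OF C2 s3] True unfolding k_def x_def c_def C_def by blast
      note tp = tree_params_of_large[OF R8 True large]
      have "1 * k \<le> 2 * R * k" using R8 by (intro mult_right_mono) auto
      also have "\<dots> \<le> (2 * R * k) ^ (32 * k)" using R8 True by (intro self_le_power) auto
      finally have ks: "k \<le> s" using large by simp
      have "x \<le> 2 * real k" using True unfolding k_def by linarith
      then have 1: "x / 40 \<le> real k / 20" by simp
      have 2: "0 < real k / 20 / real s" "real k / 20 / real s \<le> 1" using True ks s3 by (auto simp: field_simps)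
      show ?thesis
        unfolding Q_def
      proof (intro exI[of _ "real k / 20"] conjI allI impI 1 2)
        fix \<phi> :: "int poly" and A :: "int set" and \<epsilon> \<epsilon>' :: int
        assume deg: "degree \<phi> = d" and A: "finite A" "A \<noteq> {}" "\<forall>x\<in>A. x \<noteq> 0 \<and> sgn x = \<epsilon>"
          "\<forall>x\<in>A. poly \<phi> x \<noteq> 0 \<and> sgn (poly \<phi> x) = \<epsilon>'"
        have R': "R = 2 * (degree \<phi> + 1)\<^sup>2" and d': "degree \<phi> \<ge> 1" using deg assms by (simp_all add: R_def)
        show "\<exists>X\<subseteq>A. (B_plus s \<phi> X \<or> B_times s X) \<and> c1 * real (card A) powr (real k / 20 / real s) \<le> real (card X)"
          unfolding c1_def by (rule additive_part[OF tp True R' d' A(1,2,3)])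
        assume "poly \<phi> 0 \<noteq> 0"
        then show "\<exists>X\<subseteq>A. (B_times_poly s \<phi> X \<or> B_times s X) \<and> c1 * real (card A) powr (real k / 20 / real s) \<le> real (card X)"
          unfolding c1_def by (rule multiplicative_part[OF tp ks True R' d' _ A])
      qed
    qed
    then obtain \<delta> where \<delta>: "x / 40 \<le> \<delta>" "0 < \<delta> / real s" "\<delta> / real s \<le> 1"
      and Q: "Q \<delta>"
      by blast
    have part: "(\<exists>X\<subseteq>A. (B_plus s \<phi> X \<or> B_times s X) \<and> c1 * real (card A) powr (\<delta> / real s) \<le> real (card X)) \<and>
        (poly \<phi> 0 \<noteq> 0 \<longrightarrow>
          (\<exists>X\<subseteq>A. (B_times_poly s \<phi> X \<or> B_times s X) \<and> c1 * real (card A) powr (\<delta> / real s) \<le> real (card X)))"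
      if "degree \<phi> = d" "finite A" "A \<noteq> {}" "\<forall>x\<in>A. x \<noteq> 0 \<and> sgn x = \<epsilon>" "\<forall>x\<in>A. poly \<phi> x \<noteq> 0 \<and> sgn (poly \<phi> x) = \<epsilon>'"
      for \<phi> A \<epsilon> \<epsilon>'
      by (rule Q[unfolded Q_def, THEN spec, THEN spec, THEN spec, THEN spec,
            THEN mp, THEN mp, THEN mp, THEN mp, THEN mp, OF that])
    let ?c = "c1 / (real d + 5)"
    have cpos: "?c > 0" using c1 by simp
    show "\<exists>\<delta>::real. \<delta> \<ge> c / 40 * log 2 (real s) / log 2 (log 2 (real s)) \<and>
      (\<exists>C::real. C > 0 \<and>
        (\<forall>(A::int set) (\<phi>::int poly). finite A \<and> degree \<phi> = d \<longrightarrow>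
          real (max (largest_card (B_plus s \<phi>) A) (largest_card (B_times s) A))
            \<ge> C * real (card A) powr (\<delta> / real s))) \<and>
      (\<exists>C::real. C > 0 \<and>
        (\<forall>(A::int set) (\<phi>::int poly). finite A \<and> degree \<phi> = d \<and> poly \<phi> 0 \<noteq> 0 \<longrightarrow>
          real (max (largest_card (B_times_poly s \<phi>) A) (largest_card (B_times s) A))
            \<ge> C * real (card A) powr (\<delta> / real s)))"
    proof (rule exI[of _ \<delta>], intro conjI)
      show "\<delta> \<ge> c / 40 * log 2 (real s) / log 2 (log 2 (real s))" using \<delta>(1) by (simp add: x_def)
    next
      have "?c * real (card A) powr (\<delta> / real s) \<le> real (max (largest_card (B_plus s \<phi>) A) (largest_card (B_times s) A))"
        if A: "finite A" and deg: "degree \<phi> = d" for A :: "int set" and \<phi> :: "int poly"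
      proof -
        have phi: "\<phi> \<noteq> 0" using deg assms by auto
        show ?thesis
          unfolding deg[symmetric]
          by (rule max_largest_card_ge[OF A phi c1 \<delta>(2,3) conjunct1[OF part[OF deg]]])
      qed
      then show "\<exists>C::real. C > 0 \<and>
        (\<forall>(A::int set) (\<phi>::int poly). finite A \<and> degree \<phi> = d \<longrightarrow>
          real (max (largest_card (B_plus s \<phi>) A) (largest_card (B_times s) A))
            \<ge> C * real (card A) powr (\<delta> / real s))"
        using cpos by blast
    next
      have "?c * real (card A) powr (\<delta> / real s) \<le> real (max (largest_card (B_times_poly s \<phi>) A) (largest_card (B_times s) A))"
        if A: "finite A" and deg: "degree \<phi> = d" and phi0: "poly \<phi> 0 \<noteq> 0" for A :: "int set" and \<phi> :: "int poly"
      proof -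
        have phi: "\<phi> \<noteq> 0" using deg assms by auto
        show ?thesis
          unfolding deg[symmetric]
          by (rule max_largest_card_ge[OF A phi c1 \<delta>(2,3) mp[OF conjunct2[OF part[OF deg]] phi0]])
      qed
      then show "\<exists>C::real. C > 0 \<and>
        (\<forall>(A::int set) (\<phi>::int poly). finite A \<and> degree \<phi> = d \<and> poly \<phi> 0 \<noteq> 0 \<longrightarrow>
          real (max (largest_card (B_times_poly s \<phi>) A) (largest_card (B_times s) A))
            \<ge> C * real (card A) powr (\<delta> / real s))"
        using cpos by blast
    qed
  qed
qed

end
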